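(* Let $V\in C^2(\mathbb{R}^d)$ be such that $\mu(dx)=e^{-V(x)}dx$ is a probability measure on $\mathbb{R}^d$, and let $\nu$ be a probability measure on $\mathbb{R}^d$. Assume that $\mathrm{Hess}_V$ is bounded and that, for some constant $K>0$, $\mathrm{Hess}_V\ge K I$ holds outside a compact set. Then $\mu*\nu$ satisfies the log-Sobolev inequality, i.e. there is a constant $C>0$ such that $$(\mu*\nu)(f^2\log f^2)\le C(\mu*\nu)(|\nabla f|^2),\quad f\in C_b^1(\mathbb{R}^d),\ (\mu*\nu)(f^2)=1,$$ provided the following two conditions hold: (C1) There exists a constant $c>0$ such that $\nu_x(f^2)-\nu_x(f)^2\le c\|\nabla f\|_\infty^2$ for all $f\in C_b^1(\mathbb{R}^d)$ and all $x\in\mathbb{R}^d$. (C2) $\displaystyle\limsup_{|x|\to\infty}\frac{\int_{\mathbb{R}^d}|\nabla V(-z)|\,\nu_x(dz)}{|x|}<K$.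
   Context: For a measure $m$ and a function $g$, $m(g):=\int g\,dm$. The convolution is $(\mu*\nu)(A)=\int 1_A(x+y)\,\mu(dx)\nu(dy)$. $C_b^1(\mathbb{R}^d)$ denotes the bounded $C^1$ functions on $\mathbb{R}^d$ with bounded gradient; $\|\cdot\|_\infty$ is the supremum norm. $\mathrm{Hess}_V$ is the Hessian matrix of $V$, $I$ is the identity matrix, inequalities between symmetric matrices are in the sense of quadratic forms, and $\nabla V(-z)$ is the gradient of $V$ evaluated at $-z$. Set $p_\nu(x)=\int_{\mathbb{R}^d}e^{-V(x-z)}\,\nu(dz)$, and for $x\in\mathbb{R}^d$ let $\nu_x$ be the probability measure $\nu_x(dz)=\frac{1}{p_\nu(x)}e^{-V(x-z)}\,\nu(dz)$. *)

theory Defs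
  imports "HOL-Probability.Probability"
begin

definition gradient :: "(real ^ 'n \<Rightarrow> real) \<Rightarrow> real ^ 'n \<Rightarrow> real ^ 'n" where
  "gradient f x = (THE D. GDERIV f x :> D)"

lemma gradient_eqI:
  fixes f :: "real ^ 'n \<Rightarrow> real"
  assumes "GDERIV f x :> D"
  shows "gradient f x = D"
proof -
  have "E = D" if "GDERIV f x :> E" for E
  proof -
    have "(\<lambda>h. h \<bullet> E) = (\<lambda>h. h \<bullet> D)"
      using that assms unfolding gderiv_def by (rule has_derivative_unique)
    then show ?thesis by (metis vector_eq_ldot)
  qed
  with assms show ?thesis unfolding gradient_def by blast
qed

lemma GDERIV_gradient:
  fixes f :: "real ^ 'n \<Rightarrow> real"
  assumes "f differentiable (at x)"
  shows "GDERIV f x :> gradient f x"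
proof -
  from assms obtain f' where f': "(f has_derivative f') (at x)"
    by (auto simp: differentiable_def)
  then have lin: "linear f'"
    by (rule has_derivative_linear)
  have "f' = (\<lambda>h. h \<bullet> adjoint f' 1)"
    using adjoint_works[OF lin, of _ 1] by auto
  with f' have "GDERIV f x :> adjoint f' 1"
    by (simp add: gderiv_def)
  then show ?thesis by (metis gradient_eqI)
qed

text \<open>The \<open>(i, j)\<close> entry of \<open>hessian f x\<close> is the \<open>j\<close>-th partial derivative of the
  \<open>i\<close>-th component of the gradient.\<close>

definition hessian :: "(real ^ 'n \<Rightarrow> real) \<Rightarrow> real ^ 'n \<Rightarrow> real ^ 'n ^ 'n" where
  "hessian f x = jacobian (gradient f) (at x)"

definition C1 :: "(real ^ 'n \<Rightarrow> real) \<Rightarrow> bool" where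
  "C1 f \<longleftrightarrow> (\<forall>x. f differentiable (at x)) \<and> continuous_on UNIV (gradient f)"

definition C2 :: "(real ^ 'n \<Rightarrow> real) \<Rightarrow> bool" where
  "C2 f \<longleftrightarrow> C1 f \<and> (\<forall>x. gradient f differentiable (at x)) \<and> continuous_on UNIV (hessian f)"

definition Cb1 :: "(real ^ 'n \<Rightarrow> real) set" where
  "Cb1 = {f. C1 f \<and> bounded (range f) \<and> bounded (range (gradient f))}"

definition quad_form_le :: "real ^ 'n ^ 'n \<Rightarrow> real ^ 'n ^ 'n \<Rightarrow> bool" where
  "quad_form_le A B \<longleftrightarrow> (\<forall>v. v \<bullet> (A *v v) \<le> v \<bullet> (B *v v))"

definition gibbs :: "(real ^ 'n \<Rightarrow> real) \<Rightarrow> (real ^ 'n) measure" where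
  "gibbs V = density lborel (\<lambda>x. ennreal (exp (- V x)))"

definition p_conv :: "(real ^ 'n \<Rightarrow> real) \<Rightarrow> (real ^ 'n) measure \<Rightarrow> real ^ 'n \<Rightarrow> real" where
  "p_conv V \<nu> x = (\<integral>z. exp (- V (x - z)) \<partial>\<nu>)"

text \<open>If \<open>\<nu>\<close> is a probability measure, \<open>V\<close> is \<open>C2\<close> and its Hessian is uniformly positive
  definite outside a compact set, then \<open>V\<close> is bounded below, so \<open>p_conv V \<nu> x\<close> is the integral
  of a bounded positive function and \<open>tilted V \<nu> x\<close> is a probability measure.\<close>

definition tilted :: "(real ^ 'n \<Rightarrow> real) \<Rightarrow> (real ^ 'n) measure \<Rightarrow> real ^ 'n \<Rightarrow> (real ^ 'n) measure" where
  "tilted V \<nu> x = density \<nu> (\<lambda>z. ennreal (exp (- V (x - z)) / p_conv V \<nu> x))"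

text \<open>The convention \<open>0 log 0 = 0\<close> holds automatically. For a probability measure \<open>m\<close> on the
  Borel sets, all integrands below are bounded and Borel, hence integrable.\<close>

definition log_sobolev :: "(real ^ 'n) measure \<Rightarrow> bool" where
  "log_sobolev m \<longleftrightarrow>
     (\<exists>C>0. \<forall>f\<in>Cb1. (\<integral>x. (f x)\<^sup>2 \<partial>m) = 1 \<longrightarrow>
        (\<integral>x. (f x)\<^sup>2 * ln ((f x)\<^sup>2) \<partial>m) \<le> C * (\<integral>x. (norm (gradient f x))\<^sup>2 \<partial>m))"

end

theory Submission
  imports Defs
begin

text \<open>Write \<open>p\<close> for the Lebesgue density of the convolution. The proof uses two properties of \<open>p\<close>, for
suitable constants \<open>L\<close>, \<open>a > 0\<close> and \<open>b\<close>: the growth bound \<open>|\<nabla>p(x)| \<le> L (1 + |x|) p(x)\<close> and the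
drift bound \<open>x \<bullet> \<nabla>p(x) \<le> (b - a |x|\<^sup>2) p(x)\<close>. They come from averaging over the tilted measures:
\<open>\<nabla>V(x - z)\<close> differs from \<open>\<nabla>V(-z)\<close> by at most a multiple of \<open>|x|\<close>, since the Hessian is bounded,
while its component along \<open>x\<close> gains at least \<open>K |x|\<^sup>2\<close> up to a multiple of \<open>|x|\<close>, since the segment
between the two points spends only a bounded length in the region where \<open>V\<close> is not convex
(\<open>gradient_increment_lower\<close>). The averaged \<open>|\<nabla>V(-z)|\<close> costs at most \<open>K' |x|\<close> with \<open>K' < K\<close>, so a
positive multiple of \<open>|x|\<^sup>2\<close> survives (\<open>norm_G_le_far\<close>, \<open>drift_far\<close>).

Every probability density with these two properties satisfies the logarithmic Sobolev inequality.
Integrating \<open>x \<bullet> \<nabla>(f\<^sup>2 p)\<close> by parts and using the drift bound controls \<open>\<integral> f\<^sup>2 |x|\<^sup>2 p\<close> by \<open>\<integral> f\<^sup>2 p\<close>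
and \<open>\<integral> |\<nabla>f|\<^sup>2 p\<close> (\<open>second_moment_le\<close>). Hence the mass of \<open>f\<^sup>2 p\<close> outside a large ball is small up to
a gradient term, and the Poincare inequality on that ball gives one for \<open>p\<close> (\<open>poincare\<close>). The same
second moment bound transfers an entropy bound for Lebesgue measure, applied to \<open>u \<surd>p\<close>, to the
measure \<open>p dx\<close> (\<open>entropy_plus_bound\<close>): the gradient of \<open>\<surd>p\<close> and the logarithm of \<open>p\<close> only produce
the weights \<open>(1 + |x|\<^sup>2) p\<close>. The Euclidean bound itself compares a function with its averages over
balls whose radius is chosen according to the size of the function (\<open>euclidean_entropy_bound\<close>).

Finally, if \<open>\<integral> f\<^sup>2 p = 1\<close> and \<open>f = m + u\<close> with \<open>m\<close> the mean of \<open>f\<close>, then \<open>f\<^sup>2 ln f\<^sup>2 - (f\<^sup>2 - 1)\<close> is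
quadratically small in \<open>u\<close> up to the term \<open>u\<^sup>2 max 0 (ln u\<^sup>2)\<close>. So the entropy of \<open>f\<^sup>2\<close> is bounded by
the variance of \<open>f\<close> and the entropy term of \<open>u\<close>, and both are bounded by \<open>\<integral> |\<nabla>f|\<^sup>2 p\<close>.\<close>

section \<open>Gradients, increments and scaling\<close>

lemma continuous_on_GDERIV:
  assumes "\<And>x. GDERIV f x :> D x"
  shows "continuous_on S f"
  using assms unfolding gderiv_def
  by (blast intro: continuous_at_imp_continuous_on has_derivative_continuous)

lemma nn_integral_lborel_affine_euclidean:
  fixes f :: "'a::euclidean_space \<Rightarrow> ennreal"
  assumes [measurable]: "f \<in> borel_measurable borel" and c: "c > 0"
  shows "(\<integral>\<^sup>+x. f x \<partial>lborel) = ennreal (c ^ DIM('a)) * (\<integral>\<^sup>+x. f (t + c *\<^sub>R x) \<partial>lborel)"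
  using c
  by (subst lborel_affine[of c t])
     (auto simp: nn_integral_density nn_integral_distr nn_integral_cmult ennreal_power)

text \<open>Stated in extended nonnegative reals, so that it can be integrated over further variables by
Tonelli's theorem.\<close>

lemma increment_sq_le_integral_gradient_sq:
  fixes f :: "'a::euclidean_space \<Rightarrow> real"
  assumes f: "\<And>x. GDERIV f x :> D x" and D: "continuous_on UNIV D"
  shows "ennreal ((f (x + h) - f x)\<^sup>2)
    \<le> ennreal ((norm h)\<^sup>2) * (\<integral>\<^sup>+t. ennreal ((norm (D (x + t *\<^sub>R h)))\<^sup>2) * indicator {0..1} t \<partial>lborel)"
proof -
  define \<phi> where "\<phi> t = D (x + t *\<^sub>R h) \<bullet> h" for t
  have cD: "continuous_on {0..1::real} (\<lambda>t. D (x + t *\<^sub>R h))"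
    by (rule continuous_on_compose2[OF D]) (auto intro!: continuous_intros)
  have c: "continuous_on {0..1} \<phi>"
    unfolding \<phi>_def by (intro continuous_intros cD)
  define I where "I = f (x + h) - f x"
  have der: "((\<lambda>t. f (x + t *\<^sub>R h)) has_vector_derivative \<phi> t) (at t within {0..1})" for t
  proof -
    have "((\<lambda>t. f (x + t *\<^sub>R h)) has_derivative (\<lambda>s. (s *\<^sub>R h) \<bullet> D (x + t *\<^sub>R h))) (at t within {0..1})"
      by (rule has_derivative_compose[of "\<lambda>t. x + t *\<^sub>R h" _ _ _ f])
         (use f[unfolded gderiv_def, of "x + t *\<^sub>R h"] in \<open>auto intro!: derivative_eq_intros\<close>)
    then show ?thesis
      by (simp add: has_vector_derivative_def \<phi>_def inner_commute)
  qed
  have ftc: "(\<phi> has_integral I) {0..1}"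
    using fundamental_theorem_of_calculus[of 0 1 "\<lambda>t. f (x + t *\<^sub>R h)" \<phi>] der by (simp add: I_def)
  define J where "J = integral {0..1} (\<lambda>t. (norm (D (x + t *\<^sub>R h)))\<^sup>2)"
  have J: "((\<lambda>t. (norm (D (x + t *\<^sub>R h)))\<^sup>2) has_integral J) {0..1}"
    unfolding J_def by (intro integrable_integral integrable_continuous_interval continuous_intros cD)
  have nn: "(\<integral>\<^sup>+t. ennreal ((norm (D (x + t *\<^sub>R h)))\<^sup>2) * indicator {0..1} t \<partial>lborel) = ennreal J"
  proof -
    have [measurable]: "(\<lambda>t. norm (D (x + t *\<^sub>R h))) \<in> borel_measurable borel"
      by (intro borel_measurable_continuous_onI continuous_intros continuous_on_compose2[OF D]) auto
    have "(\<integral>\<^sup>+t. ennreal ((norm (D (x + t *\<^sub>R h)))\<^sup>2 * indicator {0..1} t) \<partial>lborel) = ennreal J"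
    proof (rule nn_integral_has_integral_lborel)
      have "(\<lambda>t. (norm (D (x + t *\<^sub>R h)))\<^sup>2 * indicator {0..1} t)
          = (\<lambda>t. if t \<in> {0..1} then (norm (D (x + t *\<^sub>R h)))\<^sup>2 else 0)" by auto
      then show "((\<lambda>t. (norm (D (x + t *\<^sub>R h)))\<^sup>2 * indicator {0..1} t) has_integral J) UNIV"
        using J by (simp only: has_integral_restrict_UNIV)
    qed auto
    then show ?thesis by (simp add: ennreal_mult' ennreal_indicator)
  qed
  have "((\<lambda>t. 2 * I * \<phi> t - I\<^sup>2) has_integral (2 * I * I - I\<^sup>2)) {0..1}"
    using has_integral_diff[OF has_integral_mult_right[OF ftc, of "2 * I"] has_integral_const_real[of "I\<^sup>2" 0 1]]
    by simp
  moreover have "((\<lambda>t. (norm h)\<^sup>2 * (norm (D (x + t *\<^sub>R h)))\<^sup>2) has_integral ((norm h)\<^sup>2 * J)) {0..1}"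
    by (intro has_integral_mult_right J)
  moreover have "2 * I * \<phi> t - I\<^sup>2 \<le> (norm h)\<^sup>2 * (norm (D (x + t *\<^sub>R h)))\<^sup>2" for t
  proof -
    have "(\<phi> t)\<^sup>2 \<le> (norm (D (x + t *\<^sub>R h)) * norm h)\<^sup>2"
      unfolding \<phi>_def using Cauchy_Schwarz_ineq2 by (metis abs_ge_zero power2_abs power_mono)
    moreover have "0 \<le> (\<phi> t - I)\<^sup>2" by simp
    ultimately show ?thesis by (simp add: power2_eq_square algebra_simps)
  qed
  \<comment> \<open>The Cauchy-Schwarz inequality for the integral of \<open>\<phi>\<close>: integrate \<open>2 I \<phi> - I\<^sup>2 \<le> \<phi>\<^sup>2\<close>,
    where \<open>I\<close> is the integral of \<open>\<phi>\<close>.\<close>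
  ultimately have "2 * I * I - I\<^sup>2 \<le> (norm h)\<^sup>2 * J"
    by (rule has_integral_le)
  then have "I\<^sup>2 \<le> (norm h)\<^sup>2 * J" by (simp add: power2_eq_square)
  moreover have "J \<ge> 0" using J by (rule has_integral_nonneg) simp
  ultimately show ?thesis unfolding nn I_def[symmetric]
    by (simp add: ennreal_mult'[symmetric] ennreal_leI)
qed

lemma translation_sq_le_gradient_sq:
  fixes f :: "'a::euclidean_space \<Rightarrow> real"
  assumes f: "\<And>x. GDERIV f x :> D x" and D: "continuous_on UNIV D"
  shows "(\<integral>\<^sup>+x. ennreal ((f (x + h) - f x)\<^sup>2) \<partial>lborel)
    \<le> ennreal ((norm h)\<^sup>2) * (\<integral>\<^sup>+x. ennreal ((norm (D x))\<^sup>2) \<partial>lborel)"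
proof -
  have [measurable]: "D \<in> borel_measurable borel"
    using D by (rule borel_measurable_continuous_onI)
  have tr: "(\<integral>\<^sup>+x. ennreal ((norm (D (x + s)))\<^sup>2) \<partial>lborel) = (\<integral>\<^sup>+x. ennreal ((norm (D x))\<^sup>2) \<partial>lborel)" for s
    using nn_integral_lborel_affine_euclidean[of "\<lambda>x. ennreal ((norm (D x))\<^sup>2)" 1 s]
    by (simp add: add.commute)
  have "(\<integral>\<^sup>+x. ennreal ((f (x + h) - f x)\<^sup>2) \<partial>lborel)
    \<le> (\<integral>\<^sup>+x. ennreal ((norm h)\<^sup>2) * (\<integral>\<^sup>+t. ennreal ((norm (D (x + t *\<^sub>R h)))\<^sup>2) * indicator {0..1} t \<partial>lborel) \<partial>lborel)"
    by (intro nn_integral_mono increment_sq_le_integral_gradient_sq[OF f D])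
  also have "\<dots> = ennreal ((norm h)\<^sup>2) * (\<integral>\<^sup>+x. (\<integral>\<^sup>+t. ennreal ((norm (D (x + t *\<^sub>R h)))\<^sup>2) * indicator {0..1::real} t \<partial>lborel) \<partial>lborel)"
    by (subst nn_integral_cmult) auto
  also have "(\<integral>\<^sup>+x. (\<integral>\<^sup>+t. ennreal ((norm (D (x + t *\<^sub>R h)))\<^sup>2) * indicator {0..1::real} t \<partial>lborel) \<partial>lborel)
     = (\<integral>\<^sup>+t. (\<integral>\<^sup>+x. ennreal ((norm (D (x + t *\<^sub>R h)))\<^sup>2) * indicator {0..1::real} t \<partial>lborel) \<partial>lborel)"
    by (rule lborel_pair.Fubini') simp
  also have "\<dots> = (\<integral>\<^sup>+t. (\<integral>\<^sup>+x. ennreal ((norm (D x))\<^sup>2) \<partial>lborel) * indicator {0..1::real} t \<partial>lborel)"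
    by (subst nn_integral_multc) (auto simp: tr)
  also have "\<dots> = (\<integral>\<^sup>+x. ennreal ((norm (D x))\<^sup>2) \<partial>lborel)"
    by (subst nn_integral_cmult) auto
  finally show ?thesis .
qed

section \<open>An entropy bound on Euclidean space\<close>

text \<open>As the integral of \<open>v\<^sup>2\<close> is at most 1, the mean of \<open>v\<^sup>2\<close> over a ball of volume \<open>\<beta>\<close> is at most
\<open>1 / \<beta>\<close>. Where \<open>v\<^sup>2\<close> is at least \<open>4 / \<beta>\<close>, the function therefore differs from most of its values
nearby, and \<open>v\<^sup>2\<close> is at most four times the mean square of the increments \<open>v (x + h) - v x\<close> over
the ball; the gradient controls these.\<close>

lemma superlevel_sq_le_gradient_sq:
  fixes v :: "'a::euclidean_space \<Rightarrow> real"
  assumes v: "\<And>x. GDERIV v x :> D x" and D: "continuous_on UNIV D"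
    and norm1: "(\<integral>\<^sup>+x. ennreal ((v x)\<^sup>2) \<partial>lborel) \<le> 1" and r: "r > 0"
  shows "(\<integral>\<^sup>+x. ennreal ((v x)\<^sup>2) * indicator {x. 4 / measure lborel (ball (0::'a) r) \<le> (v x)\<^sup>2} x \<partial>lborel)
    \<le> ennreal (4 * r\<^sup>2) * (\<integral>\<^sup>+x. ennreal ((norm (D x))\<^sup>2) \<partial>lborel)"
proof -
  define B where "B = ball (0::'a) r"
  define \<beta> where "\<beta> = measure lborel B"
  define G where "G = (\<integral>\<^sup>+x. ennreal ((norm (D x))\<^sup>2) \<partial>lborel)"
  define S where "S = {x. 4 / \<beta> \<le> (v x)\<^sup>2}"
  have \<beta>: "\<beta> > 0" using r by (simp add: \<beta>_def B_def content_ball_pos)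
  have eB: "emeasure lborel B = ennreal \<beta>"
    unfolding \<beta>_def using emeasure_lborel_ball_finite[of "0::'a" r]
    by (intro emeasure_eq_ennreal_measure) (auto simp: B_def)
  have "continuous_on UNIV v"
    by (rule continuous_on_GDERIV[OF v])
  then have v_meas[measurable]: "v \<in> borel_measurable borel"
    by (rule borel_measurable_continuous_onI)
  have [measurable]: "B \<in> sets borel" "S \<in> sets borel" by (auto simp: B_def S_def)
  define I where "I x = (\<integral>\<^sup>+h. ennreal ((v (x + h) - v x)\<^sup>2) * indicator B h \<partial>lborel)" for x
  have I_meas[measurable]: "I \<in> borel_measurable borel"
    unfolding I_def by measurable
  have tr: "(\<integral>\<^sup>+h. ennreal ((v (x + h))\<^sup>2) \<partial>lborel) \<le> 1" for x
    using nn_integral_lborel_affine_euclidean[of "\<lambda>x. ennreal ((v x)\<^sup>2)" 1 x] norm1 by simp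
  have pt: "ennreal \<beta> * (ennreal ((v x)\<^sup>2) * indicator S x) \<le> 4 * I x" for x
  proof (cases "x \<in> S")
    case True
    have "ennreal (\<beta> * (v x)\<^sup>2) = (\<integral>\<^sup>+h. ennreal ((v x)\<^sup>2) * indicator B h \<partial>lborel)"
      using \<beta> by (subst nn_integral_cmult_indicator) (auto simp: eB ennreal_mult mult.commute)
    also have "\<dots> \<le> (\<integral>\<^sup>+h. 2 * (ennreal ((v (x + h) - v x)\<^sup>2) * indicator B h) + 2 * ennreal ((v (x + h))\<^sup>2) \<partial>lborel)"
    proof (intro nn_integral_mono)
      fix h
      have "0 \<le> (2 * v (x + h) - v x)\<^sup>2" by simp
      \<comment> \<open>The difference of the two sides is \<open>(2 v (x + h) - v x)\<^sup>2\<close>.\<close>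
      then have "(v x)\<^sup>2 \<le> 2 * (v (x + h) - v x)\<^sup>2 + 2 * (v (x + h))\<^sup>2"
        by (simp add: power2_eq_square algebra_simps)
      then have "ennreal ((v x)\<^sup>2) \<le> ennreal (2 * (v (x + h) - v x)\<^sup>2 + 2 * (v (x + h))\<^sup>2)"
        by (rule ennreal_leI)
      also have "\<dots> = 2 * ennreal ((v (x + h) - v x)\<^sup>2) + 2 * ennreal ((v (x + h))\<^sup>2)"
        by (simp add: ennreal_mult)
      finally show "ennreal ((v x)\<^sup>2) * indicator B h
          \<le> 2 * (ennreal ((v (x + h) - v x)\<^sup>2) * indicator B h) + 2 * ennreal ((v (x + h))\<^sup>2)"
        by (auto simp: indicator_def)
    qed
    also have "\<dots> = 2 * I x + 2 * (\<integral>\<^sup>+h. ennreal ((v (x + h))\<^sup>2) \<partial>lborel)"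
      unfolding I_def by (subst nn_integral_add) (auto simp: nn_integral_cmult)
    also have "\<dots> \<le> 2 * I x + 2"
      using tr[of x] by (intro add_left_mono) (metis mult.right_neutral mult_left_mono zero_le)
    finally have *: "ennreal (\<beta> * (v x)\<^sup>2) \<le> 2 * I x + 2" .
    have "4 \<le> \<beta> * (v x)\<^sup>2" using True \<beta> by (simp add: S_def divide_simps mult.commute)
    have "ennreal (\<beta> * (v x)\<^sup>2) \<le> 4 * I x"
    proof (cases "I x")
      case top then show ?thesis by (simp add: ennreal_mult_top)
    next
      case (real i)
      then have "2 * I x + 2 = ennreal (2 * i + 2)" by (simp add: ennreal_mult)
      with * have "ennreal (\<beta> * (v x)\<^sup>2) \<le> ennreal (2 * i + 2)" by (simp only:)
      then have "\<beta> * (v x)\<^sup>2 \<le> 2 * i + 2" using real by (subst (asm) ennreal_le_iff) auto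
      with \<open>4 \<le> \<beta> * (v x)\<^sup>2\<close> have "\<beta> * (v x)\<^sup>2 \<le> 4 * i" by linarith
      then have "ennreal (\<beta> * (v x)\<^sup>2) \<le> ennreal (4 * i)" by (rule ennreal_leI)
      with real show ?thesis by (simp add: ennreal_mult)
    qed
    then show ?thesis using True \<beta> by (simp add: ennreal_mult)
  qed simp
  have "ennreal \<beta> * (\<integral>\<^sup>+x. ennreal ((v x)\<^sup>2) * indicator S x \<partial>lborel)
      = (\<integral>\<^sup>+x. ennreal \<beta> * (ennreal ((v x)\<^sup>2) * indicator S x) \<partial>lborel)"
    by (subst nn_integral_cmult) auto
  also have "\<dots> \<le> (\<integral>\<^sup>+x. 4 * I x \<partial>lborel)" by (intro nn_integral_mono pt)
  also have "\<dots> = 4 * (\<integral>\<^sup>+x. I x \<partial>lborel)" by (subst nn_integral_cmult) auto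
  also have "(\<integral>\<^sup>+x. I x \<partial>lborel) = (\<integral>\<^sup>+h. (\<integral>\<^sup>+x. ennreal ((v (x + h) - v x)\<^sup>2) * indicator B h \<partial>lborel) \<partial>lborel)"
    unfolding I_def by (rule lborel_pair.Fubini') simp
  also have "\<dots> \<le> (\<integral>\<^sup>+h. ennreal (r\<^sup>2) * G * indicator B h \<partial>lborel)"
  proof (intro nn_integral_mono)
    fix h
    show "(\<integral>\<^sup>+x. ennreal ((v (x + h) - v x)\<^sup>2) * indicator B h \<partial>lborel) \<le> ennreal (r\<^sup>2) * G * indicator B h"
    proof (cases "h \<in> B")
      case True
      then have "(norm h)\<^sup>2 \<le> r\<^sup>2" by (intro power_mono) (auto simp: B_def)
      then have "ennreal ((norm h)\<^sup>2) * G \<le> ennreal (r\<^sup>2) * G"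
        by (intro mult_right_mono ennreal_leI) auto
      with translation_sq_le_gradient_sq[OF v D, of h] True show ?thesis
        by (simp add: G_def[symmetric])
    qed simp
  qed
  also have "\<dots> = ennreal (r\<^sup>2) * G * ennreal \<beta>"
    by (simp add: nn_integral_cmult_indicator eB)
  also have "4 * (ennreal (r\<^sup>2) * G * ennreal \<beta>) = ennreal \<beta> * (ennreal (4 * r\<^sup>2) * G)"
    by (simp add: ennreal_mult ac_simps)
  finally have "ennreal \<beta> * (\<integral>\<^sup>+x. ennreal ((v x)\<^sup>2) * indicator S x \<partial>lborel) \<le> ennreal \<beta> * (ennreal (4 * r\<^sup>2) * G)"
    by (simp add: mult_left_mono)
  then show ?thesis
    using \<beta> by (simp add: ennreal_mult_le_mult_iff G_def S_def \<beta>_def B_def)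
qed

text \<open>The logarithm of \<open>t\<close> is, up to an additive constant, \<open>ln b\<close> times the number of levels \<open>\<tau> b\<^sup>k\<close>
below \<open>t\<close>. This writes \<open>v\<^sup>2 ln v\<^sup>2\<close> as a sum over superlevel sets.\<close>

lemma ln_le_geometric_level_count:
  fixes t \<tau> b :: real
  assumes t: "t \<ge> 0" and \<tau>: "\<tau> > 0" and b: "b > 1"
  shows "ennreal (max 0 (ln t)) \<le> ennreal (max 0 (ln \<tau>)) + (\<Sum>k. ennreal (ln b) * indicator {\<tau> * b ^ k ..} t)"
proof (cases "t = 0")
  case False
  with t have t: "t > 0" by simp
  define n where "n = (LEAST n. t < \<tau> * b ^ n)"
  obtain m where "t / \<tau> < b ^ m" using real_arch_pow[OF b] by blast
  then have "t < \<tau> * b ^ m" using \<tau> by (simp add: divide_simps mult.commute)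
  then have n: "t < \<tau> * b ^ n" unfolding n_def by (rule LeastI)
  have less: "\<tau> * b ^ k \<le> t" if "k < n" for k
    using not_less_Least[OF that[unfolded n_def]] by simp
  have "ln t \<le> ln (\<tau> * b ^ n)" using n t by simp
  also have "\<dots> = ln \<tau> + real n * ln b" using \<tau> b by (simp add: ln_mult ln_realpow)
  finally have "max 0 (ln t) \<le> max 0 (ln \<tau>) + real n * ln b" using b by auto
  then have "ennreal (max 0 (ln t)) \<le> ennreal (max 0 (ln \<tau>) + real n * ln b)" by (rule ennreal_leI)
  also have "\<dots> = ennreal (max 0 (ln \<tau>)) + (\<Sum>k<n. ennreal (ln b) * indicator {\<tau> * b ^ k ..} t)"
    using b less by (simp add: ennreal_mult ennreal_of_nat_eq_real_of_nat)
  also have "\<dots> \<le> ennreal (max 0 (ln \<tau>)) + (\<Sum>k. ennreal (ln b) * indicator {\<tau> * b ^ k ..} t)"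
    by (intro add_left_mono sum_le_suminf) auto
  finally show ?thesis .
qed simp

text \<open>On the superlevel set at height \<open>4\<close> divided by the volume of the ball of radius \<open>2\<^sup>-\<^sup>k\<close>, the
integral of \<open>v\<^sup>2\<close> is at most \<open>4 \<cdot> 4\<^sup>-\<^sup>k\<close> times the energy of \<open>v\<close>. These heights form a geometric
sequence in \<open>k\<close>, so the positive part of \<open>ln v\<^sup>2\<close> counts them, and the bounds have a finite sum.\<close>

lemma euclidean_entropy_bound:
  obtains c A :: real where "c \<ge> 0" "A \<ge> 0"
    "\<And>(v :: 'a::euclidean_space \<Rightarrow> real) D. (\<And>x. GDERIV v x :> D x) \<Longrightarrow> continuous_on UNIV D \<Longrightarrow>
       (\<integral>\<^sup>+x. ennreal ((v x)\<^sup>2) \<partial>lborel) \<le> 1 \<Longrightarrow>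
       (\<integral>\<^sup>+x. ennreal ((v x)\<^sup>2 * max 0 (ln ((v x)\<^sup>2))) \<partial>lborel)
         \<le> ennreal c * (\<integral>\<^sup>+x. ennreal ((v x)\<^sup>2) \<partial>lborel)
           + ennreal A * (\<integral>\<^sup>+x. ennreal ((norm (D x))\<^sup>2) \<partial>lborel)"
proof -
  define \<omega> where "\<omega> = measure lborel (ball (0::'a) 1)"
  define \<tau> where "\<tau> = 4 / \<omega>"
  define b where "b = (2::real) ^ DIM('a)"
  have \<omega>: "\<omega> > 0" by (simp add: \<omega>_def content_ball_pos)
  then have \<tau>: "\<tau> > 0" by (simp add: \<tau>_def)
  have b: "b > 1" unfolding b_def by (rule one_less_power) auto
  have lev: "4 / measure lborel (ball (0::'a) ((1/2) ^ k)) = \<tau> * b ^ k" for k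
    using content_ball_conv_unit_ball[of "(1/2)^k" "0::'a"]
    by (simp add: \<tau>_def b_def \<omega>_def power_divide divide_simps power_mult[symmetric] mult.commute)
  show thesis
  proof (rule that[of "max 0 (ln \<tau>)" "ln b * (16 / 3)"])
    fix v :: "'a \<Rightarrow> real" and D
    assume v: "\<And>x. GDERIV v x :> D x" and D: "continuous_on UNIV D"
      and n1: "(\<integral>\<^sup>+x. ennreal ((v x)\<^sup>2) \<partial>lborel) \<le> 1"
    define G where "G = (\<integral>\<^sup>+x. ennreal ((norm (D x))\<^sup>2) \<partial>lborel)"
    have "continuous_on UNIV v"
      by (rule continuous_on_GDERIV[OF v])
    then have v_meas[measurable]: "v \<in> borel_measurable borel"
      by (rule borel_measurable_continuous_onI)
    have "(\<integral>\<^sup>+x. ennreal ((v x)\<^sup>2 * max 0 (ln ((v x)\<^sup>2))) \<partial>lborel)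
      \<le> (\<integral>\<^sup>+x. ennreal (max 0 (ln \<tau>)) * ennreal ((v x)\<^sup>2)
           + (\<Sum>k. ennreal (ln b) * (ennreal ((v x)\<^sup>2) * indicator {x. \<tau> * b ^ k \<le> (v x)\<^sup>2} x)) \<partial>lborel)"
    proof (intro nn_integral_mono)
      fix x
      have "ennreal ((v x)\<^sup>2 * max 0 (ln ((v x)\<^sup>2))) = ennreal ((v x)\<^sup>2) * ennreal (max 0 (ln ((v x)\<^sup>2)))"
        by (simp add: ennreal_mult)
      also have "\<dots> \<le> ennreal ((v x)\<^sup>2) * (ennreal (max 0 (ln \<tau>)) + (\<Sum>k. ennreal (ln b) * indicator {\<tau> * b ^ k ..} ((v x)\<^sup>2)))"
        by (intro mult_left_mono ln_le_geometric_level_count \<tau> b) auto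
      also have "\<dots> = ennreal (max 0 (ln \<tau>)) * ennreal ((v x)\<^sup>2)
           + (\<Sum>k. ennreal (ln b) * (ennreal ((v x)\<^sup>2) * indicator {x. \<tau> * b ^ k \<le> (v x)\<^sup>2} x))"
        by (simp add: distrib_left mult.commute mult.left_commute ennreal_suminf_cmult[symmetric] indicator_def
            del: ennreal_suminf_cmult)
      finally show "ennreal ((v x)\<^sup>2 * max 0 (ln ((v x)\<^sup>2))) \<le> \<dots>" .
    qed
    also have "\<dots> = ennreal (max 0 (ln \<tau>)) * (\<integral>\<^sup>+x. ennreal ((v x)\<^sup>2) \<partial>lborel)
        + (\<Sum>k. ennreal (ln b) * (\<integral>\<^sup>+x. ennreal ((v x)\<^sup>2) * indicator {x. \<tau> * b ^ k \<le> (v x)\<^sup>2} x \<partial>lborel))"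
    proof -
      have *: "(\<integral>\<^sup>+x. (\<Sum>k. ennreal (ln b) * (ennreal ((v x)\<^sup>2) * indicator {x. \<tau> * b ^ k \<le> (v x)\<^sup>2} x)) \<partial>lborel)
        = (\<Sum>k. (\<integral>\<^sup>+x. ennreal (ln b) * (ennreal ((v x)\<^sup>2) * indicator {x. \<tau> * b ^ k \<le> (v x)\<^sup>2} x) \<partial>lborel))"
        by (rule nn_integral_suminf) measurable
      have **: "(\<integral>\<^sup>+x. ennreal (ln b) * (ennreal ((v x)\<^sup>2) * indicator {x. \<tau> * b ^ k \<le> (v x)\<^sup>2} x) \<partial>lborel)
        = ennreal (ln b) * (\<integral>\<^sup>+x. ennreal ((v x)\<^sup>2) * indicator {x. \<tau> * b ^ k \<le> (v x)\<^sup>2} x \<partial>lborel)" for k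
        by (rule nn_integral_cmult) measurable
      show ?thesis
        unfolding **[symmetric] *[symmetric]
        by (subst nn_integral_add, measurable, subst nn_integral_cmult) auto
    qed
    also have "(\<Sum>k. ennreal (ln b) * (\<integral>\<^sup>+x. ennreal ((v x)\<^sup>2) * indicator {x. \<tau> * b ^ k \<le> (v x)\<^sup>2} x \<partial>lborel))
        \<le> (\<Sum>k. ennreal (ln b) * (ennreal (4 * (1/4) ^ k) * G))"
    proof (intro suminf_le mult_left_mono)
      fix k
      show "(\<integral>\<^sup>+x. ennreal ((v x)\<^sup>2) * indicator {x. \<tau> * b ^ k \<le> (v x)\<^sup>2} x \<partial>lborel)
          \<le> ennreal (4 * (1/4) ^ k) * G"
        using superlevel_sq_le_gradient_sq[OF v D n1, of "(1/2)^k"]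
        unfolding lev G_def by (simp add: power_divide power2_eq_square power_mult_distrib[symmetric])
    qed auto
    also have "\<dots> = ennreal (ln b * (16/3)) * G"
    proof -
      have "(\<Sum>k. ennreal (4 * (1/4) ^ k)) = ennreal (16/3)"
      proof (rule suminf_ennreal_eq)
        show "(\<lambda>k. 4 * (1/4) ^ k) sums (16/3::real)"
          using sums_mult[OF geometric_sums[of "1/4::real"], of 4] by simp
      qed auto
      moreover have "ennreal (ln b * (16/3)) = ennreal (ln b) * ennreal (16/3)"
        using b by (intro ennreal_mult) auto
      ultimately show ?thesis
        by (simp only: ennreal_suminf_cmult ennreal_suminf_multc mult.assoc)
    qed
    finally show "(\<integral>\<^sup>+x. ennreal ((v x)\<^sup>2 * max 0 (ln ((v x)\<^sup>2))) \<partial>lborel)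
         \<le> ennreal (max 0 (ln \<tau>)) * (\<integral>\<^sup>+x. ennreal ((v x)\<^sup>2) \<partial>lborel)
           + ennreal (ln b * (16 / 3)) * (\<integral>\<^sup>+x. ennreal ((norm (D x))\<^sup>2) \<partial>lborel)"
      by (simp add: G_def add_left_mono)
  qed (use b in auto)
qed

section \<open>A Poincare inequality on balls\<close>

text \<open>The point \<open>(1 - t) x + t y\<close> is an affine function of \<open>y\<close> with factor \<open>t\<close> and of \<open>x\<close> with factor
\<open>1 - t\<close>. One of the factors is at least \<open>1/2\<close>, and substituting in that variable costs at most
\<open>2\<^sup>d\<close>.\<close>

lemma interpolated_mass_le:
  fixes \<Phi> :: "'a::euclidean_space \<Rightarrow> ennreal"
  assumes [measurable]: "\<Phi> \<in> borel_measurable borel" "B \<in> sets borel" and t: "0 \<le> t" "t \<le> 1"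
  shows "(\<integral>\<^sup>+x. \<integral>\<^sup>+y. \<Phi> (x + t *\<^sub>R (y - x)) * indicator B x * indicator B y \<partial>lborel \<partial>lborel)
    \<le> ennreal (2 ^ DIM('a)) * emeasure lborel B * (\<integral>\<^sup>+x. \<Phi> x \<partial>lborel)"
proof -
  define J where "J = (\<integral>\<^sup>+x. \<Phi> x \<partial>lborel)"
  have sc: "(\<integral>\<^sup>+y. \<Phi> (a + s *\<^sub>R y) \<partial>lborel) \<le> ennreal (2 ^ DIM('a)) * J" if "s \<ge> 1/2" for a s
  proof -
    have "1 \<le> (2 * s) ^ DIM('a)" using that by (intro one_le_power) auto
    then have "1 \<le> ennreal (2 ^ DIM('a)) * ennreal (s ^ DIM('a))"
      using that by (simp add: ennreal_mult[symmetric] power_mult_distrib)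
    then have "1 * (\<integral>\<^sup>+y. \<Phi> (a + s *\<^sub>R y) \<partial>lborel)
        \<le> ennreal (2 ^ DIM('a)) * ennreal (s ^ DIM('a)) * (\<integral>\<^sup>+y. \<Phi> (a + s *\<^sub>R y) \<partial>lborel)"
      by (rule mult_right_mono) simp
    also have "\<dots> = ennreal (2 ^ DIM('a)) * J"
      using nn_integral_lborel_affine_euclidean[of \<Phi> s a] that by (simp add: J_def mult.assoc)
    finally show ?thesis by simp
  qed
  have fin: "(\<integral>\<^sup>+x. ennreal (2 ^ DIM('a)) * J * indicator B x \<partial>lborel) = ennreal (2 ^ DIM('a)) * emeasure lborel B * J"
    by (subst nn_integral_cmult_indicator) (auto simp: ac_simps)
  show ?thesis
  proof (cases "t \<ge> 1/2")
    case True
    have "(\<integral>\<^sup>+x. \<integral>\<^sup>+y. \<Phi> (x + t *\<^sub>R (y - x)) * indicator B x * indicator B y \<partial>lborel \<partial>lborel)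
      \<le> (\<integral>\<^sup>+x. \<integral>\<^sup>+y. indicator B x * \<Phi> ((1 - t) *\<^sub>R x + t *\<^sub>R y) \<partial>lborel \<partial>lborel)"
      by (intro nn_integral_mono) (auto simp: indicator_def algebra_simps)
    also have "\<dots> = (\<integral>\<^sup>+x. indicator B x * (\<integral>\<^sup>+y. \<Phi> ((1 - t) *\<^sub>R x + t *\<^sub>R y) \<partial>lborel) \<partial>lborel)"
      by (subst nn_integral_cmult) auto
    also have "\<dots> \<le> (\<integral>\<^sup>+x. ennreal (2 ^ DIM('a)) * J * indicator B x \<partial>lborel)"
      by (intro nn_integral_mono) (use sc[OF True] in \<open>auto simp: indicator_def\<close>)
    also note fin
    finally show ?thesis unfolding J_def .
  next
    case False
    have "(\<integral>\<^sup>+x. \<integral>\<^sup>+y. \<Phi> (x + t *\<^sub>R (y - x)) * indicator B x * indicator B y \<partial>lborel \<partial>lborel)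
      \<le> (\<integral>\<^sup>+x. \<integral>\<^sup>+y. indicator B y * \<Phi> (t *\<^sub>R y + (1 - t) *\<^sub>R x) \<partial>lborel \<partial>lborel)"
      by (intro nn_integral_mono) (auto simp: indicator_def algebra_simps)
    also have "\<dots> = (\<integral>\<^sup>+y. \<integral>\<^sup>+x. indicator B y * \<Phi> (t *\<^sub>R y + (1 - t) *\<^sub>R x) \<partial>lborel \<partial>lborel)"
      by (rule lborel_pair.Fubini') simp
    also have "\<dots> = (\<integral>\<^sup>+y. indicator B y * (\<integral>\<^sup>+x. \<Phi> (t *\<^sub>R y + (1 - t) *\<^sub>R x) \<partial>lborel) \<partial>lborel)"
      by (subst nn_integral_cmult) auto
    also have "\<dots> \<le> (\<integral>\<^sup>+x. ennreal (2 ^ DIM('a)) * J * indicator B x \<partial>lborel)"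
      by (intro nn_integral_mono) (use sc[of "1 - t"] False in \<open>auto simp: indicator_def\<close>)
    also note fin
    finally show ?thesis unfolding J_def .
  qed
qed

text \<open>The increment along a segment in the ball is bounded by the gradient on the segment, and the
previous lemma bounds the density with which these segments, for random end points, fill the ball.\<close>

lemma ball_two_point_poincare:
  fixes f :: "'a::euclidean_space \<Rightarrow> real" and r :: real
  assumes f: "\<And>x. GDERIV f x :> D x" and D: "continuous_on UNIV D"
  defines "B \<equiv> ball (0::'a) r"
  shows "(\<integral>\<^sup>+x. \<integral>\<^sup>+y. ennreal ((f y - f x)\<^sup>2) * indicator B x * indicator B y \<partial>lborel \<partial>lborel)
    \<le> ennreal ((2 * r)\<^sup>2 * 2 ^ DIM('a)) * emeasure lborel B
       * (\<integral>\<^sup>+x. ennreal ((norm (D x))\<^sup>2) * indicator B x \<partial>lborel)"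
proof -
  have [measurable]: "D \<in> borel_measurable borel"
    using D by (rule borel_measurable_continuous_onI)
  have [measurable]: "B \<in> sets borel" by (simp add: B_def)
  define \<Phi> where "\<Phi> x = ennreal ((norm (D x))\<^sup>2) * indicator B x" for x
  have [measurable]: "\<Phi> \<in> borel_measurable borel" unfolding \<Phi>_def by measurable
  define F where "F x y t = \<Phi> (x + t *\<^sub>R (y - x)) * indicator B x * indicator B y * indicator {0..1::real} t" for x y t
  have F_meas[measurable]: "(\<lambda>(x, y, t). F x y t) \<in> borel_measurable (borel \<Otimes>\<^sub>M borel \<Otimes>\<^sub>M borel)"
    unfolding F_def by measurable
  have [measurable]: "(\<lambda>x. \<integral>\<^sup>+y. (\<integral>\<^sup>+t. F x y t \<partial>lborel) \<partial>lborel) \<in> borel_measurable borel"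
      "(\<lambda>y. \<integral>\<^sup>+t. F x y t \<partial>lborel) \<in> borel_measurable borel"
      "(\<lambda>(x, t). \<integral>\<^sup>+y. F x y t \<partial>lborel) \<in> borel_measurable (lborel \<Otimes>\<^sub>M lborel)"
      "(\<lambda>(t, x). \<integral>\<^sup>+y. F x y t \<partial>lborel) \<in> borel_measurable (lborel \<Otimes>\<^sub>M lborel)" for x
    unfolding F_def by measurable
  have pt: "ennreal ((f y - f x)\<^sup>2) * indicator B x * indicator B y
     \<le> ennreal ((2 * r)\<^sup>2) * (\<integral>\<^sup>+t. F x y t \<partial>lborel)" for x y
  proof (cases "x \<in> B \<and> y \<in> B")
    case True
    have seg: "x + t *\<^sub>R (y - x) \<in> B" if "0 \<le> t" "t \<le> 1" for t
    proof -
      have "(1 - t) *\<^sub>R x + t *\<^sub>R y \<in> B"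
        using True that convex_ball[of "0::'a" r] unfolding B_def by (intro convexD) auto
      then show ?thesis by (simp add: algebra_simps)
    qed
    have "(norm (y - x))\<^sup>2 \<le> (2 * r)\<^sup>2"
      using True norm_triangle_ineq4[of y x] by (intro power_mono) (auto simp: B_def)
    have "ennreal ((f y - f x)\<^sup>2) \<le> ennreal ((norm (y - x))\<^sup>2) *
       (\<integral>\<^sup>+t. ennreal ((norm (D (x + t *\<^sub>R (y - x))))\<^sup>2) * indicator {0..1} t \<partial>lborel)"
      using increment_sq_le_integral_gradient_sq[OF f D, of x "y - x"] by simp
    also have "\<dots> \<le> ennreal ((2 * r)\<^sup>2) *
       (\<integral>\<^sup>+t. ennreal ((norm (D (x + t *\<^sub>R (y - x))))\<^sup>2) * indicator {0..1} t \<partial>lborel)"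
      using \<open>(norm (y - x))\<^sup>2 \<le> (2 * r)\<^sup>2\<close> by (intro mult_right_mono ennreal_leI) auto
    also have "(\<integral>\<^sup>+t. ennreal ((norm (D (x + t *\<^sub>R (y - x))))\<^sup>2) * indicator {0..1} t \<partial>lborel)
        = (\<integral>\<^sup>+t. F x y t \<partial>lborel)"
      using True seg by (intro nn_integral_cong) (auto simp: F_def \<Phi>_def indicator_def)
    finally show ?thesis using True by simp
  qed auto
  have "(\<integral>\<^sup>+x. \<integral>\<^sup>+y. ennreal ((f y - f x)\<^sup>2) * indicator B x * indicator B y \<partial>lborel \<partial>lborel)
    \<le> (\<integral>\<^sup>+x. \<integral>\<^sup>+y. ennreal ((2 * r)\<^sup>2) * (\<integral>\<^sup>+t. F x y t \<partial>lborel) \<partial>lborel \<partial>lborel)"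
    by (intro nn_integral_mono pt)
  also have "\<dots> = ennreal ((2 * r)\<^sup>2) * (\<integral>\<^sup>+x. \<integral>\<^sup>+y. (\<integral>\<^sup>+t. F x y t \<partial>lborel) \<partial>lborel \<partial>lborel)"
    by (simp add: nn_integral_cmult)
  also have "(\<integral>\<^sup>+x. \<integral>\<^sup>+y. (\<integral>\<^sup>+t. F x y t \<partial>lborel) \<partial>lborel \<partial>lborel)
     = (\<integral>\<^sup>+x. \<integral>\<^sup>+t. (\<integral>\<^sup>+y. F x y t \<partial>lborel) \<partial>lborel \<partial>lborel)"
    by (intro nn_integral_cong lborel_pair.Fubini') simp
  also have "\<dots> = (\<integral>\<^sup>+t. \<integral>\<^sup>+x. (\<integral>\<^sup>+y. F x y t \<partial>lborel) \<partial>lborel \<partial>lborel)"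
    by (rule lborel_pair.Fubini') simp
  also have "\<dots> \<le> (\<integral>\<^sup>+t. ennreal (2 ^ DIM('a)) * emeasure lborel B * (\<integral>\<^sup>+x. \<Phi> x \<partial>lborel) * indicator {0..1::real} t \<partial>lborel)"
  proof (intro nn_integral_mono)
    fix t :: real
    show "(\<integral>\<^sup>+x. (\<integral>\<^sup>+y. F x y t \<partial>lborel) \<partial>lborel)
       \<le> ennreal (2 ^ DIM('a)) * emeasure lborel B * (\<integral>\<^sup>+x. \<Phi> x \<partial>lborel) * indicator {0..1::real} t"
    proof (cases "t \<in> {0..1}")
      case True
      then show ?thesis using interpolated_mass_le[of \<Phi> B t] by (simp add: F_def)
    qed (simp add: F_def)
  qed
  also have "\<dots> = ennreal (2 ^ DIM('a)) * emeasure lborel B * (\<integral>\<^sup>+x. \<Phi> x \<partial>lborel)"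
    by (subst nn_integral_cmult_indicator) auto
  finally show ?thesis
    by (simp add: \<Phi>_def ennreal_mult mult.assoc mult_left_mono)
qed

section \<open>The radial integration by parts formula\<close>

lemma
  fixes f :: "'a::euclidean_space \<Rightarrow> real"
  assumes c: "c > 0"
  shows integrable_lborel_scale_iff: "integrable lborel (\<lambda>x. f (c *\<^sub>R x)) \<longleftrightarrow> integrable lborel f"
    and integral_lborel_scale: "(\<integral>x. f (c *\<^sub>R x) \<partial>lborel) = (\<integral>x. f x \<partial>lborel) / c ^ DIM('a)"
proof -
  have *: "integrable lborel (\<lambda>x. g (c *\<^sub>R x))" if c: "c > 0" and g: "integrable lborel g"
    for c and g :: "'a \<Rightarrow> real"
  proof -
    have [measurable]: "g \<in> borel_measurable borel" using g by auto
    have "(\<integral>\<^sup>+x. norm (g x) \<partial>lborel) = ennreal (c ^ DIM('a)) * (\<integral>\<^sup>+x. norm (g (0 + c *\<^sub>R x)) \<partial>lborel)"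
      using c by (intro nn_integral_lborel_affine_euclidean) auto
    with g c show ?thesis
      by (auto simp: integrable_iff_bounded ennreal_mult_less_top)
  qed
  have **: "integrable lborel f" if "integrable lborel (\<lambda>x. f (c *\<^sub>R x))"
    using *[OF _ that, of "1 / c"] c by simp
  show iff: "integrable lborel (\<lambda>x. f (c *\<^sub>R x)) \<longleftrightarrow> integrable lborel f"
    using *[OF c] ** by blast
  show "(\<integral>x. f (c *\<^sub>R x) \<partial>lborel) = (\<integral>x. f x \<partial>lborel) / c ^ DIM('a)"
  proof (cases "integrable lborel f")
    case True
    then have [measurable]: "f \<in> borel_measurable borel" by auto
    have "(\<integral>x. f x \<partial>lborel) = (\<integral>x. f x \<partial>density (distr lborel borel (\<lambda>x. 0 + c *\<^sub>R x)) (\<lambda>_. \<bar>c\<bar> ^ DIM('a)))"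
      using c by (subst lborel_affine[of c 0]) auto
    also have "\<dots> = c ^ DIM('a) * (\<integral>x. f (c *\<^sub>R x) \<partial>lborel)"
      using c by (simp add: integral_density integral_distr ennreal_power)
    finally show ?thesis using c by simp
  next
    case False
    with iff show ?thesis by (simp add: not_integrable_integral_eq)
  qed
qed

text \<open>The divergence theorem for the vector field \<open>h(x) x\<close>, proved through dilations: the map
\<open>x \<mapsto> h (e\<^sup>s x)\<close> has integral \<open>e\<^sup>-\<^sup>d\<^sup>s\<close> times that of \<open>h\<close>, and its derivative in \<open>s\<close> is
\<open>\<phi> (e\<^sup>s x)\<close> with \<open>\<phi> y = y \<bullet> H y\<close>, which scales in the same way. Integrating the derivative over
\<open>0 \<le> s \<le> 1\<close> and exchanging the integrals compares both.\<close>

lemma integral_radial_derivative: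
  fixes h :: "'a::euclidean_space \<Rightarrow> real"
  assumes h: "\<And>x. GDERIV h x :> H x" and H: "continuous_on UNIV H"
    and int_h: "integrable lborel h" and int_H: "integrable lborel (\<lambda>x. x \<bullet> H x)"
  shows "(\<integral>x. x \<bullet> H x \<partial>lborel) = - (real DIM('a) * (\<integral>x. h x \<partial>lborel))"
proof -
  define d where "d = real DIM('a)"
  have d: "d > 0" by (simp add: d_def)
  define \<phi> where "\<phi> y = y \<bullet> H y" for y
  define J where "J = (\<integral>x. \<phi> x \<partial>lborel)"
  have cphi: "continuous_on UNIV \<phi>" unfolding \<phi>_def by (intro continuous_intros H)
  then have [measurable]: "\<phi> \<in> borel_measurable borel" by (rule borel_measurable_continuous_onI)
  have iphi: "integrable lborel \<phi>" using int_H unfolding \<phi>_def[abs_def] .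
  define F where "F s x = indicator {0..1} s * \<phi> (exp s *\<^sub>R x)" for s :: real and x :: 'a
  have [measurable]: "(\<lambda>(s, x). F s x) \<in> borel_measurable (borel \<Otimes>\<^sub>M borel)"
    unfolding F_def by measurable
  have expd: "exp s ^ DIM('a) = exp (d * s)" for s :: real
    by (simp add: d_def exp_of_nat_mult)
  have Fx: "(\<integral>s. F s x \<partial>lborel) = h (exp 1 *\<^sub>R x) - h x" for x
  proof -
    have "(\<integral>s. \<phi> (exp s *\<^sub>R x) * indicator {0..1} s \<partial>lborel) = h (exp 1 *\<^sub>R x) - h (exp 0 *\<^sub>R x)"
    proof (rule integral_FTC_Icc_real)
      fix s :: real
      have "((\<lambda>s. h (exp s *\<^sub>R x)) has_derivative (\<lambda>t. (t *\<^sub>R exp s *\<^sub>R x) \<bullet> H (exp s *\<^sub>R x))) (at s)"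
        by (rule has_derivative_compose[of "\<lambda>s. exp s *\<^sub>R x" _ _ _ h])
           (use h[unfolded gderiv_def, of "exp s *\<^sub>R x"] in \<open>auto intro!: derivative_eq_intros\<close>)
      then show "((\<lambda>s. h (exp s *\<^sub>R x)) has_real_derivative \<phi> (exp s *\<^sub>R x)) (at s)"
        by (rule has_derivative_imp_has_field_derivative) (simp add: \<phi>_def)
      have "continuous_on UNIV (\<lambda>s. \<phi> (exp s *\<^sub>R x))"
        by (intro continuous_on_compose2[OF cphi] continuous_intros) auto
      then show "isCont (\<lambda>s. \<phi> (exp s *\<^sub>R x)) s"
        by (simp add: continuous_on_eq_continuous_at)
    qed auto
    then show ?thesis by (simp add: F_def mult.commute)
  qed
  have Fs: "(\<integral>x. F s x \<partial>lborel) = J * (exp (- d * s) * indicator {0..1} s)" for s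
    unfolding F_def using integral_lborel_scale[of "exp s" \<phi>]
    by (simp add: expd J_def exp_minus divide_inverse)
  have Fs_abs: "(\<integral>x. norm (F s x) \<partial>lborel) = (\<integral>x. \<bar>\<phi> x\<bar> \<partial>lborel) * (exp (- d * s) * indicator {0..1} s)" for s
    unfolding F_def using integral_lborel_scale[of "exp s" "\<lambda>x. \<bar>\<phi> x\<bar>"]
    by (simp add: expd abs_mult exp_minus divide_inverse)
  have I: "has_bochner_integral lborel (\<lambda>s. exp (- d * s) * indicator {0..1} s) ((1 - exp (- d)) / d)"
  proof -
    have "has_bochner_integral lborel (\<lambda>s. exp (- d * s) * indicator {0..1} s) ((- exp (- d * 1) / d) - (- exp (- d * 0) / d))"
      by (rule has_bochner_integral_FTC_Icc_real)
         (use d in \<open>auto intro!: derivative_eq_intros continuous_intros\<close>)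
    then show ?thesis by (simp add: diff_divide_distrib)
  qed
  have "integrable (lborel \<Otimes>\<^sub>M lborel) (\<lambda>(s, x). F s x)"
  proof (rule lborel_pair.Fubini_integrable)
    show "integrable lborel (\<lambda>s. \<integral>x. norm (case (s, x) of (s, x) \<Rightarrow> F s x) \<partial>lborel)"
      using I by (simp only: split Fs_abs) (auto simp: has_bochner_integral_iff)
    show "AE s in lborel. integrable lborel (\<lambda>x. case (s, x) of (s, x) \<Rightarrow> F s x)"
      unfolding F_def using iphi by (simp add: integrable_lborel_scale_iff[of "exp _" \<phi>])
  qed simp
  then have "(\<integral>x. (\<integral>s. F s x \<partial>lborel) \<partial>lborel) = (\<integral>s. (\<integral>x. F s x \<partial>lborel) \<partial>lborel)"
    by (rule lborel_pair.Fubini_integral)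
  moreover have "(\<integral>s. (\<integral>x. F s x \<partial>lborel) \<partial>lborel) = J * ((1 - exp (- d)) / d)"
    unfolding Fs using I by (simp add: has_bochner_integral_iff)
  moreover have "(\<integral>x. h (exp 1 *\<^sub>R x) \<partial>lborel) = (\<integral>x. h x \<partial>lborel) * exp (- d)"
    using integral_lborel_scale[of "exp 1" h] by (simp add: expd exp_minus divide_inverse)
  moreover have "integrable lborel (\<lambda>x. h (exp 1 *\<^sub>R x))"
    using int_h by (simp add: integrable_lborel_scale_iff[of "exp 1" h])
  moreover have "(\<integral>x. h (exp 1 *\<^sub>R x) - h x \<partial>lborel) = (\<integral>x. h (exp 1 *\<^sub>R x) \<partial>lborel) - (\<integral>x. h x \<partial>lborel)"
    using \<open>integrable lborel (\<lambda>x. h (exp 1 *\<^sub>R x))\<close> int_h by (rule Bochner_Integration.integral_diff)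
  ultimately have "J * ((1 - exp (- d)) / d) = - ((1 - exp (- d)) * (\<integral>x. h x \<partial>lborel))"
    unfolding Fx by (simp add: right_diff_distrib left_diff_distrib mult.commute)
  then have "(1 - exp (- d)) * J = (1 - exp (- d)) * (- (d * (\<integral>x. h x \<partial>lborel)))"
    using d by (simp add: divide_simps mult.commute mult.left_commute)
  moreover have "1 - exp (- d) \<noteq> 0" using d by simp
  ultimately have "J = - (d * (\<integral>x. h x \<partial>lborel))"
    by (metis mult_left_cancel)
  then show ?thesis by (simp add: J_def \<phi>_def d_def)
qed

section \<open>Densities with a radial drift\<close>

lemma le_one_plus_sq: "r \<le> 1 + r\<^sup>2" for r :: real
  using zero_le_power2[of "r - 1 / 2"] by (simp add: power2_eq_square algebra_simps)

lemma has_real_derivative_along_ray: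
  fixes p :: "'a::euclidean_space \<Rightarrow> real"
  assumes "GDERIV p (t *\<^sub>R x) :> g"
  shows "((\<lambda>t. p (t *\<^sub>R x)) has_real_derivative x \<bullet> g) (at t)"
proof -
  have "((\<lambda>t. p (t *\<^sub>R x)) has_derivative (\<lambda>s. (s *\<^sub>R x) \<bullet> g)) (at t)"
    by (rule has_derivative_compose[of "\<lambda>t. t *\<^sub>R x" _ _ _ p])
       (use assms[unfolded gderiv_def] in \<open>auto intro!: derivative_eq_intros\<close>)
  then show ?thesis
    by (rule has_derivative_imp_has_field_derivative) simp
qed

text \<open>For \<open>p = e\<^sup>-\<^sup>W\<close>, \<open>norm_G_le\<close> and \<open>drift\<close> say that \<open>\<nabla>W\<close> grows at most linearly and that
\<open>x \<bullet> \<nabla>W(x) \<ge> a |x|\<^sup>2 - b\<close>. They are stated for \<open>p\<close> because for a convolution \<open>p\<close> and \<open>G\<close>, unlike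
\<open>W\<close>, are averages over \<open>\<nu>\<close>.\<close>

locale confined_density =
  fixes p :: "'a::euclidean_space \<Rightarrow> real" and G :: "'a \<Rightarrow> 'a" and L a b :: real
  assumes GDERIV_p: "\<And>x. GDERIV p x :> G x"
    and continuous_G: "continuous_on UNIV G"
    and p_pos: "\<And>x. p x > 0"
    and integrable_p: "integrable lborel p"
    and norm_G_le: "\<And>x. norm (G x) \<le> L * (1 + norm x) * p x"
    and drift: "\<And>x. x \<bullet> G x \<le> (b - a * (norm x)\<^sup>2) * p x"
    and L_pos: "L > 0" and a_pos: "a > 0" and b_nonneg: "b \<ge> 0"
begin

lemma continuous_p: "continuous_on UNIV p"
  by (rule continuous_on_GDERIV[OF GDERIV_p])

lemma borel_measurable_p [measurable]: "p \<in> borel_measurable borel"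
  using continuous_p by (rule borel_measurable_continuous_onI)

text \<open>Along a ray \<open>ln p\<close> decreases at most at the rate \<open>L (1 + |x|) |x|\<close>.\<close>

lemma p_lower: "p 0 * exp (- (2 * L * (1 + (norm x)\<^sup>2))) \<le> p x"
proof -
  define C where "C = L * (1 + norm x) * norm x"
  have "ln (p (0 *\<^sub>R x)) + 0 * C \<le> ln (p (1 *\<^sub>R x)) + 1 * C"
  proof (rule DERIV_nonneg_imp_nondecreasing[where f = "\<lambda>t. ln (p (t *\<^sub>R x)) + t * C"])
    fix t :: real assume t: "0 \<le> t" "t \<le> 1"
    have "norm (G (t *\<^sub>R x)) \<le> L * (1 + norm (t *\<^sub>R x)) * p (t *\<^sub>R x)" by (rule norm_G_le)
    also have "\<dots> \<le> L * (1 + norm x) * p (t *\<^sub>R x)"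
      using t L_pos p_pos[of "t *\<^sub>R x"]
      by (intro mult_right_mono mult_left_mono) (auto simp: mult_left_le_one_le)
    finally have "norm x * norm (G (t *\<^sub>R x)) \<le> norm x * (L * (1 + norm x) * p (t *\<^sub>R x))"
      by (rule mult_left_mono) simp
    then have "\<bar>x \<bullet> G (t *\<^sub>R x)\<bar> \<le> C * p (t *\<^sub>R x)"
      using Cauchy_Schwarz_ineq2[of x "G (t *\<^sub>R x)"] by (simp add: C_def ac_simps)
    then have "0 \<le> x \<bullet> G (t *\<^sub>R x) / p (t *\<^sub>R x) + C"
      using p_pos[of "t *\<^sub>R x"] by (simp add: field_simps)
    moreover have "((\<lambda>t. ln (p (t *\<^sub>R x)) + t * C) has_real_derivative
        x \<bullet> G (t *\<^sub>R x) / p (t *\<^sub>R x) + C) (at t)"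
      using p_pos[of "t *\<^sub>R x"]
      by (auto intro!: derivative_eq_intros has_real_derivative_along_ray GDERIV_p simp: field_simps)
    ultimately show "\<exists>y. ((\<lambda>t. ln (p (t *\<^sub>R x)) + t * C) has_real_derivative y) (at t) \<and> 0 \<le> y"
      by blast
  qed simp
  moreover have "C \<le> 2 * L * (1 + (norm x)\<^sup>2)"
  proof -
    have "(1 + norm x) * norm x \<le> 2 * (1 + (norm x)\<^sup>2)"
      using le_one_plus_sq[of "norm x"] zero_le_power2[of "norm x"]
      unfolding power2_eq_square distrib_right distrib_left by linarith
    then have "L * ((1 + norm x) * norm x) \<le> L * (2 * (1 + (norm x)\<^sup>2))"
      using L_pos by (intro mult_left_mono) auto
    then show ?thesis by (simp add: C_def algebra_simps)
  qed
  ultimately have "ln (p 0) - 2 * L * (1 + (norm x)\<^sup>2) \<le> ln (p x)" by simp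
  then have "exp (ln (p 0) - 2 * L * (1 + (norm x)\<^sup>2)) \<le> exp (ln (p x))" by simp
  then show ?thesis using p_pos[of 0] p_pos[of x] by (simp add: exp_diff exp_minus divide_simps)
qed

text \<open>One Gaussian lies below a multiple of \<open>p\<close> and is therefore integrable; the others follow by
scaling.\<close>

lemma integrable_gaussian:
  assumes s: "s > 0"
  shows "integrable lborel (\<lambda>x::'a. exp (- (s * (norm x)\<^sup>2)))"
proof -
  have "integrable lborel (\<lambda>x::'a. exp (- (2 * L * (norm x)\<^sup>2)))"
  proof (rule Bochner_Integration.integrable_bound)
    show "integrable lborel (\<lambda>x. exp (2 * L) / p 0 * p x)"
      using integrable_p by simp
    show "AE x::'a in lborel. norm (exp (- (2 * L * (norm x)\<^sup>2))) \<le> norm (exp (2 * L) / p 0 * p x)"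
    proof (rule AE_I2)
      fix x :: 'a
      have "p 0 * (exp (- (2 * L)) * exp (- (2 * L * (norm x)\<^sup>2))) \<le> p x"
        using p_lower[of x] by (simp add: exp_add[symmetric] algebra_simps)
      then show "norm (exp (- (2 * L * (norm x)\<^sup>2))) \<le> norm (exp (2 * L) / p 0 * p x)"
        using p_pos[of 0] p_pos[of x] by (simp add: exp_minus field_simps)
    qed
  qed simp
  then have "integrable lborel (\<lambda>x::'a. exp (- (2 * L * (norm (sqrt (s / (2 * L)) *\<^sub>R x))\<^sup>2)))"
    using s L_pos by (subst integrable_lborel_scale_iff) auto
  moreover have "2 * L * (norm (sqrt (s / (2 * L)) *\<^sub>R x))\<^sup>2 = s * (norm x)\<^sup>2" for x :: 'a
    using s L_pos by (simp add: power_mult_distrib)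
  ultimately show ?thesis by simp
qed

text \<open>Outside a ball of radius \<open>R\<close> the drift makes \<open>p(x) e\<^bsup>a |x|\<^sup>2/4\<^esup>\<close> decrease along rays, so this
function attains its supremum on the ball.\<close>

lemma p_upper: obtains M where "\<And>x. p x \<le> M * exp (- (a / 4 * (norm x)\<^sup>2))"
proof -
  define R where "R = sqrt (2 * b / a) + 1"
  have R: "R > 0" using a_pos b_nonneg by (simp add: R_def add_nonneg_pos)
  have R2: "2 * b \<le> a * r\<^sup>2" if "r \<ge> R" for r
  proof -
    have "sqrt (2 * b / a) \<le> r" using that by (simp add: R_def)
    then have "(sqrt (2 * b / a))\<^sup>2 \<le> r\<^sup>2" using a_pos b_nonneg by (intro power_mono) auto
    then show ?thesis using a_pos b_nonneg by (simp add: field_simps)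
  qed
  define P where "P x = p x * exp (a / 4 * (norm x)\<^sup>2)" for x
  have "continuous_on (cball 0 R) P"
    unfolding P_def by (intro continuous_intros continuous_on_subset[OF continuous_p]) auto
  then obtain x0 where x0: "x0 \<in> cball 0 R" "\<And>x. x \<in> cball 0 R \<Longrightarrow> P x \<le> P x0"
    using continuous_attains_sup[of "cball (0::'a) R" P] R by auto
  have far: "P x \<le> P ((R / norm x) *\<^sub>R x)" if x: "norm x \<ge> R" for x
  proof -
    have "P (1 *\<^sub>R x) \<le> P ((R / norm x) *\<^sub>R x)"
    proof (rule DERIV_nonpos_imp_nonincreasing[where f = "\<lambda>t. P (t *\<^sub>R x)"])
      show "R / norm x \<le> 1" using x R by (subst divide_le_eq_1_pos) auto
      fix t assume t: "R / norm x \<le> t" "t \<le> 1"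
      then have t0: "t > 0" using R x by (smt (verit) divide_pos_pos)
      have "norm x > 0" using R x by linarith
      then have tn: "norm (t *\<^sub>R x) \<ge> R" using t t0 by (simp add: pos_divide_le_eq)
      have "t * (x \<bullet> G (t *\<^sub>R x)) \<le> (b - a * (norm (t *\<^sub>R x))\<^sup>2) * p (t *\<^sub>R x)"
        using drift[of "t *\<^sub>R x"] by simp
      also have "\<dots> \<le> (- (a / 2) * (norm (t *\<^sub>R x))\<^sup>2) * p (t *\<^sub>R x)"
        using R2[OF tn] p_pos[of "t *\<^sub>R x"] by (intro mult_right_mono) auto
      also have "\<dots> = t * (- (a / 2) * t * (norm x)\<^sup>2 * p (t *\<^sub>R x))"
        using t0 by (simp add: power_mult_distrib power2_eq_square)
      finally have "x \<bullet> G (t *\<^sub>R x) \<le> - (a / 2) * t * (norm x)\<^sup>2 * p (t *\<^sub>R x)"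
        using t0 by (rule mult_left_le_imp_le)
      then have le: "x \<bullet> G (t *\<^sub>R x) + a / 2 * t * (norm x)\<^sup>2 * p (t *\<^sub>R x) \<le> 0" by simp
      have "((\<lambda>t. p (t *\<^sub>R x) * exp (a / 4 * (t * norm x)\<^sup>2)) has_real_derivative
          (x \<bullet> G (t *\<^sub>R x) + a / 2 * t * (norm x)\<^sup>2 * p (t *\<^sub>R x)) * exp (a / 4 * (t * norm x)\<^sup>2)) (at t)"
        by (auto intro!: derivative_eq_intros has_real_derivative_along_ray GDERIV_p
            simp: power2_eq_square algebra_simps)
      moreover have "(\<lambda>t. P (t *\<^sub>R x)) = (\<lambda>t. p (t *\<^sub>R x) * exp (a / 4 * (t * norm x)\<^sup>2))"
        by (auto simp: P_def power_mult_distrib)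
      ultimately show "\<exists>y. ((\<lambda>t. P (t *\<^sub>R x)) has_real_derivative y) (at t) \<and> y \<le> 0"
        using le by (auto intro!: mult_nonpos_nonneg)
    qed
    then show ?thesis by simp
  qed
  have P_le: "P x \<le> P x0" for x
  proof (cases "norm x \<le> R")
    case False
    then have "P x \<le> P ((R / norm x) *\<^sub>R x)" by (intro far) simp
    also have "\<dots> \<le> P x0" using False R by (intro x0) auto
    finally show ?thesis .
  qed (use x0 in auto)
  have "p x \<le> P x0 * exp (- (a / 4 * (norm x)\<^sup>2))" for x
    using P_le[of x] unfolding P_def[of x] by (simp add: exp_minus field_simps)
  then show thesis by (rule that)
qed

lemma integrable_quadratic_growth:
  fixes g :: "'a \<Rightarrow> real"
  assumes [measurable]: "g \<in> borel_measurable borel" and g: "\<And>x. \<bar>g x\<bar> \<le> B * (1 + (norm x)\<^sup>2) * p x"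
  shows "integrable lborel g"
proof -
  obtain M where M: "\<And>x. p x \<le> M * exp (- (a / 4 * (norm x)\<^sup>2))" by (rule p_upper) blast
  have M0: "M > 0" using M[of 0] p_pos[of 0] by simp
  have "0 \<le> B * p 0" using order_trans[OF abs_ge_zero g[of 0]] by simp
  then have B0: "B \<ge> 0" using p_pos[of 0] by (simp add: zero_le_mult_iff)
  show ?thesis
  proof (rule Bochner_Integration.integrable_bound)
    show "integrable lborel (\<lambda>x::'a. B * M * (1 + 8 / a) * exp (- (a / 8 * (norm x)\<^sup>2)))"
      using integrable_gaussian[of "a / 8"] a_pos by simp
    show "AE x in lborel. norm (g x) \<le> norm (B * M * (1 + 8 / a) * exp (- (a / 8 * (norm x)\<^sup>2)))"
    proof (rule AE_I2)
      fix x :: 'a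
      define y where "y = (norm x)\<^sup>2"
      have y: "y \<ge> 0" by (simp add: y_def)
      have e1: "a / 8 * y \<le> exp (a / 8 * y)" using exp_ge_add_one_self[of "a / 8 * y"] by linarith
      have e2: "1 \<le> exp (a / 8 * y)" using y a_pos by simp
      have "1 + y = 1 + 8 / a * (a / 8 * y)" using a_pos by simp
      also have "\<dots> \<le> exp (a / 8 * y) + 8 / a * exp (a / 8 * y)"
        using a_pos by (intro add_mono mult_left_mono e1 e2) auto
      finally have e3: "1 + y \<le> (1 + 8 / a) * exp (a / 8 * y)"
        by (simp add: distrib_right)
      have "(1 + y) * exp (- (a / 4 * y)) \<le> (1 + 8 / a) * exp (a / 8 * y) * exp (- (a / 4 * y))"
        using e3 by (intro mult_right_mono) auto
      also have "\<dots> = (1 + 8 / a) * exp (- (a / 8 * y))"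
        by (simp add: mult.assoc exp_add[symmetric])
      finally have e4: "(1 + y) * exp (- (a / 4 * y)) \<le> (1 + 8 / a) * exp (- (a / 8 * y))" .
      have "\<bar>g x\<bar> \<le> B * (1 + y) * p x" using g[of x] by (simp add: y_def)
      also have "\<dots> \<le> B * (1 + y) * (M * exp (- (a / 4 * y)))"
        using M[of x] B0 y by (intro mult_left_mono) (auto simp: y_def)
      also have "\<dots> = B * M * ((1 + y) * exp (- (a / 4 * y)))" by simp
      also have "\<dots> \<le> B * M * ((1 + 8 / a) * exp (- (a / 8 * y)))"
        using e4 B0 M0 by (intro mult_left_mono) auto
      finally show "norm (g x) \<le> norm (B * M * (1 + 8 / a) * exp (- (a / 8 * (norm x)\<^sup>2)))"
        using a_pos B0 M0 by (simp add: y_def abs_mult mult.assoc)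
    qed
  qed simp
qed

text \<open>Integrate \<open>x \<bullet> \<nabla>(f\<^sup>2 p) = 2 f p (x \<bullet> \<nabla>f) + f\<^sup>2 (x \<bullet> \<nabla>p)\<close>. The left side has integral
\<open>-d \<integral> f\<^sup>2 p\<close>; in the last term the drift produces \<open>-a \<integral> f\<^sup>2 |x|\<^sup>2 p\<close>; the cross term is absorbed by
Young's inequality with weight \<open>a/2\<close>.\<close>

lemma second_moment_le:
  fixes f :: "'a \<Rightarrow> real"
  assumes f: "\<And>x. GDERIV f x :> D x" and D: "continuous_on UNIV D"
    and fB: "\<And>x. \<bar>f x\<bar> \<le> B" and DB: "\<And>x. norm (D x) \<le> B"
  shows "a / 2 * (\<integral>x. (f x)\<^sup>2 * (norm x)\<^sup>2 * p x \<partial>lborel)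
    \<le> (b + real DIM('a)) * (\<integral>x. (f x)\<^sup>2 * p x \<partial>lborel) + 2 / a * (\<integral>x. (norm (D x))\<^sup>2 * p x \<partial>lborel)"
proof -
  have B0: "B \<ge> 0" using fB[of 0] by simp
  have cf: "continuous_on UNIV f"
    by (rule continuous_on_GDERIV[OF f])
  note [measurable] = borel_measurable_continuous_onI[OF cf] borel_measurable_continuous_onI[OF D]
    borel_measurable_continuous_onI[OF continuous_G]
  have f2: "(f x)\<^sup>2 \<le> B\<^sup>2" for x using fB[of x] by (metis abs_ge_zero power2_abs power_mono)
  have D2: "(norm (D x))\<^sup>2 \<le> B\<^sup>2" for x using DB[of x] by (intro power_mono) auto
  have one: "norm x \<le> 1 + (norm x)\<^sup>2" "1 \<le> 1 + (norm x)\<^sup>2" "(norm x)\<^sup>2 \<le> 1 + (norm x)\<^sup>2"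
    "norm x * (1 + norm x) \<le> 2 * (1 + (norm x)\<^sup>2)" for x :: 'a
    using le_one_plus_sq[of "norm x"] zero_le_power2[of "norm x"]
    unfolding power2_eq_square distrib_left by linarith+
  have i0: "integrable lborel (\<lambda>x. (f x)\<^sup>2 * p x)"
  proof (rule integrable_quadratic_growth)
    fix x
    show "\<bar>(f x)\<^sup>2 * p x\<bar> \<le> B\<^sup>2 * (1 + (norm x)\<^sup>2) * p x"
      using mult_mono[OF f2[of x] one(2)[of x]] p_pos[of x]
      by (simp add: abs_mult)
  qed measurable
  have i1: "integrable lborel (\<lambda>x. (f x)\<^sup>2 * (norm x)\<^sup>2 * p x)"
  proof (rule integrable_quadratic_growth)
    fix x
    show "\<bar>(f x)\<^sup>2 * (norm x)\<^sup>2 * p x\<bar> \<le> B\<^sup>2 * (1 + (norm x)\<^sup>2) * p x"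
      using mult_mono[OF f2[of x] one(3)[of x]] p_pos[of x]
      by (simp add: abs_mult)
  qed measurable
  have i2: "integrable lborel (\<lambda>x. (norm (D x))\<^sup>2 * p x)"
  proof (rule integrable_quadratic_growth)
    fix x
    show "\<bar>(norm (D x))\<^sup>2 * p x\<bar> \<le> B\<^sup>2 * (1 + (norm x)\<^sup>2) * p x"
      using mult_mono[OF D2[of x] one(2)[of x]] p_pos[of x]
      by (simp add: abs_mult)
  qed measurable
  have i3: "integrable lborel (\<lambda>x. f x * (x \<bullet> D x) * p x)"
  proof (rule integrable_quadratic_growth)
    fix x
    have "\<bar>x \<bullet> D x\<bar> \<le> norm x * B"
      using Cauchy_Schwarz_ineq2[of x "D x"] mult_left_mono[OF DB[of x] norm_ge_zero[of x]] by linarith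
    then have "\<bar>f x\<bar> * \<bar>x \<bullet> D x\<bar> \<le> B * (norm x * B)"
      using fB[of x] B0 by (intro mult_mono) auto
    also have "\<dots> \<le> B\<^sup>2 * (1 + (norm x)\<^sup>2)"
      using mult_left_mono[OF one(1)[of x], of "B\<^sup>2"] by (simp add: power2_eq_square mult.commute mult.left_commute)
    finally show "\<bar>f x * (x \<bullet> D x) * p x\<bar> \<le> B\<^sup>2 * (1 + (norm x)\<^sup>2) * p x"
      using p_pos[of x] by (simp add: abs_mult)
  qed measurable
  have i4: "integrable lborel (\<lambda>x. (f x)\<^sup>2 * (x \<bullet> G x))"
  proof (rule integrable_quadratic_growth)
    fix x
    have "\<bar>x \<bullet> G x\<bar> \<le> norm x * (L * (1 + norm x) * p x)"
      using Cauchy_Schwarz_ineq2[of x "G x"] mult_left_mono[OF norm_G_le[of x] norm_ge_zero[of x]] by linarith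
    also have "\<dots> = L * p x * (norm x * (1 + norm x))" by simp
    also have "\<dots> \<le> L * p x * (2 * (1 + (norm x)\<^sup>2))"
      using one(4)[of x] L_pos p_pos[of x] by (intro mult_left_mono) auto
    finally have "(f x)\<^sup>2 * \<bar>x \<bullet> G x\<bar> \<le> B\<^sup>2 * (L * p x * (2 * (1 + (norm x)\<^sup>2)))"
      using f2[of x] by (intro mult_mono) auto
    also have "\<dots> = (B\<^sup>2 * L * 2) * (1 + (norm x)\<^sup>2) * p x" by simp
    finally show "\<bar>(f x)\<^sup>2 * (x \<bullet> G x)\<bar> \<le> (B\<^sup>2 * L * 2) * (1 + (norm x)\<^sup>2) * p x"
      by (simp add: abs_mult)
  qed measurable
  define h where "h x = (f x)\<^sup>2 * p x" for x
  define H where "H x = (2 * f x * p x) *\<^sub>R D x + (f x)\<^sup>2 *\<^sub>R G x" for x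
  have h: "GDERIV h x :> H x" for x
    unfolding gderiv_def h_def H_def
    by (rule derivative_eq_intros f[unfolded gderiv_def] GDERIV_p[unfolded gderiv_def] refl)+
       (auto simp: fun_eq_iff inner_add_right algebra_simps)
  have xH: "x \<bullet> H x = 2 * (f x * (x \<bullet> D x) * p x) + (f x)\<^sup>2 * (x \<bullet> G x)" for x
    by (simp add: H_def inner_add_right)
  have "(\<integral>x. x \<bullet> H x \<partial>lborel) = - (real DIM('a) * (\<integral>x. h x \<partial>lborel))"
  proof (rule integral_radial_derivative[OF h])
    show "continuous_on UNIV H"
      unfolding H_def by (intro continuous_intros cf D continuous_G continuous_p)
    show "integrable lborel h" using i0 unfolding h_def[abs_def] .
    show "integrable lborel (\<lambda>x. x \<bullet> H x)" unfolding xH using i3 i4 by auto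
  qed
  then have id: "2 * (\<integral>x. f x * (x \<bullet> D x) * p x \<partial>lborel) + (\<integral>x. (f x)\<^sup>2 * (x \<bullet> G x) \<partial>lborel)
      = - (real DIM('a) * (\<integral>x. (f x)\<^sup>2 * p x \<partial>lborel))"
    unfolding xH h_def using i3 i4 by simp
  have "(\<integral>x. (f x)\<^sup>2 * (x \<bullet> G x) \<partial>lborel)
      \<le> (\<integral>x. b * ((f x)\<^sup>2 * p x) - a * ((f x)\<^sup>2 * (norm x)\<^sup>2 * p x) \<partial>lborel)"
  proof (rule integral_mono)
    fix x
    show "(f x)\<^sup>2 * (x \<bullet> G x) \<le> b * ((f x)\<^sup>2 * p x) - a * ((f x)\<^sup>2 * (norm x)\<^sup>2 * p x)"
      using mult_left_mono[OF drift[of x], of "(f x)\<^sup>2"] by (simp add: algebra_simps)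
  qed (use i0 i1 i4 in auto)
  also have "\<dots> = b * (\<integral>x. (f x)\<^sup>2 * p x \<partial>lborel) - a * (\<integral>x. (f x)\<^sup>2 * (norm x)\<^sup>2 * p x \<partial>lborel)"
    using i0 i1 by simp
  finally have le1: "(\<integral>x. (f x)\<^sup>2 * (x \<bullet> G x) \<partial>lborel) \<le> \<dots>" .
  have "(\<integral>x. 2 * (f x * (x \<bullet> D x) * p x) \<partial>lborel)
      \<le> (\<integral>x. a / 2 * ((f x)\<^sup>2 * (norm x)\<^sup>2 * p x) + 2 / a * ((norm (D x))\<^sup>2 * p x) \<partial>lborel)"
  proof (rule integral_mono)
    fix x
    have "2 * (f x * (x \<bullet> D x)) \<le> 2 * (\<bar>f x\<bar> * (norm x * norm (D x)))"
      using mult_left_mono[OF Cauchy_Schwarz_ineq2[of x "D x"], of "\<bar>f x\<bar>"] by (simp add: abs_mult[symmetric])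
    also have "\<dots> \<le> a / 2 * ((\<bar>f x\<bar> * norm x)\<^sup>2) + 2 / a * (norm (D x))\<^sup>2"
    proof -
      have "0 \<le> (a * (\<bar>f x\<bar> * norm x) - 2 * norm (D x))\<^sup>2 / (2 * a)" using a_pos by simp
      also have "\<dots> = a / 2 * ((\<bar>f x\<bar> * norm x)\<^sup>2) + 2 / a * (norm (D x))\<^sup>2 - 2 * (\<bar>f x\<bar> * (norm x * norm (D x)))"
        using a_pos by (simp add: power2_eq_square field_simps)
      finally show ?thesis by simp
    qed
    finally have "2 * (f x * (x \<bullet> D x)) * p x \<le> (a / 2 * ((\<bar>f x\<bar> * norm x)\<^sup>2) + 2 / a * (norm (D x))\<^sup>2) * p x"
      using p_pos[of x] by (intro mult_right_mono) auto
    then show "2 * (f x * (x \<bullet> D x) * p x) \<le> a / 2 * ((f x)\<^sup>2 * (norm x)\<^sup>2 * p x) + 2 / a * ((norm (D x))\<^sup>2 * p x)"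
      by (simp add: power_mult_distrib distrib_right mult.assoc)
  qed (use i1 i2 i3 in auto)
  also have "\<dots> = a / 2 * (\<integral>x. (f x)\<^sup>2 * (norm x)\<^sup>2 * p x \<partial>lborel) + 2 / a * (\<integral>x. (norm (D x))\<^sup>2 * p x \<partial>lborel)"
    using i1 i2 by simp
  finally have le2: "2 * (\<integral>x. f x * (x \<bullet> D x) * p x \<partial>lborel)
     \<le> a / 2 * (\<integral>x. (f x)\<^sup>2 * (norm x)\<^sup>2 * p x \<partial>lborel) + 2 / a * (\<integral>x. (norm (D x))\<^sup>2 * p x \<partial>lborel)"
    by simp
  show ?thesis using id le1 le2 by (simp add: algebra_simps)
qed

end

section \<open>From the entropy bound to the logarithmic Sobolev inequality\<close>

text \<open>For small \<open>u\<close> this is \<open>t ln t \<le> (t - 1) + (t - 1)\<^sup>2\<close> with \<open>t = (m + u)\<^sup>2\<close>, where \<open>t - 1\<close> is linear in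
\<open>u\<close> and \<open>s\<close>; for large \<open>u\<close> it follows from \<open>t \<le> 4 u\<^sup>2\<close>. The term \<open>t - 1\<close> is kept apart because it
integrates to 0 when \<open>\<integral> f\<^sup>2 p = 1\<close>, and \<open>s\<close> will be the variance of \<open>f = m + u\<close>.\<close>

lemma sq_ln_sq_le_deviation:
  fixes m u s :: real
  assumes s: "s = 1 - m\<^sup>2" "s \<ge> 0"
  shows "(m + u)\<^sup>2 * ln ((m + u)\<^sup>2)
    \<le> ((m + u)\<^sup>2 - 1) + 18 * (s\<^sup>2 + u\<^sup>2 + u\<^sup>2 * max 0 (ln (u\<^sup>2)))"
proof -
  define t where "t = (m + u)\<^sup>2"
  have t0: "t \<ge> 0" by (simp add: t_def)
  have m1: "\<bar>m\<bar> \<le> 1" using s by (simp add: abs_square_le_1)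
  show ?thesis
  proof (cases "\<bar>u\<bar> \<le> 1")
    case True
    have "t * ln t \<le> t * (t - 1)"
      using t0 by (cases "t = 0") (auto intro!: mult_left_mono ln_le_minus_one)
    also have "\<dots> = (t - 1) + (t - 1)\<^sup>2" by (simp add: power2_eq_square algebra_simps)
    also have "(t - 1)\<^sup>2 \<le> 18 * u\<^sup>2 + 2 * s\<^sup>2"
    proof -
      have "t - 1 = 2 * m * u + u * u - s" by (simp add: t_def s power2_eq_square algebra_simps)
      moreover have "\<bar>m * u\<bar> \<le> \<bar>u\<bar>" using m1 by (simp add: abs_mult mult_left_le_one_le)
      moreover have "\<bar>u * u\<bar> \<le> \<bar>u\<bar>" using True by (simp only: abs_mult mult_left_le_one_le abs_ge_zero)
      ultimately have "\<bar>t - 1\<bar> \<le> 3 * \<bar>u\<bar> + s" using s(2) by linarith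
      then have "(t - 1)\<^sup>2 \<le> (3 * \<bar>u\<bar> + s)\<^sup>2" by (metis abs_ge_zero power2_abs power_mono)
      also have "\<dots> \<le> 2 * (3 * \<bar>u\<bar>)\<^sup>2 + 2 * s\<^sup>2"
        using zero_le_power2[of "3 * \<bar>u\<bar> - s"] by (simp add: power2_sum power2_diff)
      finally show ?thesis by (simp add: power_mult_distrib)
    qed
    also have "18 * u\<^sup>2 + 2 * s\<^sup>2 \<le> 18 * (s\<^sup>2 + u\<^sup>2 + u\<^sup>2 * max 0 (ln (u\<^sup>2)))"
      by (simp add: distrib_left add_increasing2)
    finally show ?thesis by (simp add: t_def)
  next
    case False
    then have u1: "\<bar>u\<bar> > 1" by simp
    then have u2: "u\<^sup>2 \<ge> 1" using one_le_power[of "\<bar>u\<bar>" 2] by simp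
    have "\<bar>m + u\<bar> \<le> 2 * \<bar>u\<bar>" using m1 u1 by linarith
    then have "(m + u)\<^sup>2 \<le> (2 * \<bar>u\<bar>)\<^sup>2" by (metis abs_ge_zero power2_abs power_mono)
    then have t4: "t \<le> 4 * u\<^sup>2" by (simp add: t_def power_mult_distrib)
    have "ln (4::real) \<le> 3" using ln_le_minus_one[of "4::real"] by simp
    have "t * ln t \<le> 4 * u\<^sup>2 * (3 + ln (u\<^sup>2))"
    proof (cases "t \<le> 1")
      case True
      have "t * ln t \<le> 0" using t0 True by (cases "t = 0") (auto intro!: mult_nonneg_nonpos)
      also have "0 \<le> 4 * u\<^sup>2 * (3 + ln (u\<^sup>2))" using u2 by (intro mult_nonneg_nonneg add_nonneg_nonneg) auto
      finally show ?thesis .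
    next
      case False
      then have "ln t \<le> ln (4 * u\<^sup>2)" using t4 by (intro ln_mono) auto
      also have "\<dots> = ln 4 + ln (u\<^sup>2)" using u2 by (intro ln_mult_pos) auto
      also have "\<dots> \<le> 3 + ln (u\<^sup>2)" using \<open>ln (4::real) \<le> 3\<close> by simp
      finally show ?thesis using t4 False t0 by (intro mult_mono) auto
    qed
    then have tl: "t * ln t \<le> 12 * u\<^sup>2 + 4 * (u\<^sup>2 * ln (u\<^sup>2))" by (simp add: algebra_simps)
    have "ln (u\<^sup>2) \<ge> 0" using u2 by simp
    then have w: "u\<^sup>2 * ln (u\<^sup>2) \<ge> 0" by (rule mult_nonneg_nonneg[OF zero_le_power2])
    have "t * ln t - (t - 1) \<le> 18 * (u\<^sup>2 + u\<^sup>2 * ln (u\<^sup>2))"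
      using tl w t0 u2 unfolding distrib_left by linarith
    moreover have "max 0 (ln (u\<^sup>2)) = ln (u\<^sup>2)" using \<open>ln (u\<^sup>2) \<ge> 0\<close> by simp
    ultimately show ?thesis
      using zero_le_power2[of s] unfolding t_def[symmetric] distrib_left by linarith
  qed
qed

context confined_density begin

lemma integrable_mult_p:
  fixes g :: "'a \<Rightarrow> real"
  assumes [measurable]: "g \<in> borel_measurable borel" and g: "\<And>x. \<bar>g x\<bar> \<le> B * (1 + (norm x)\<^sup>2)"
  shows "integrable lborel (\<lambda>x. g x * p x)"
proof (rule integrable_quadratic_growth)
  show "\<bar>g x * p x\<bar> \<le> B * (1 + (norm x)\<^sup>2) * p x" for x
    using mult_right_mono[OF g[of x], of "p x"] p_pos[of x] by (simp add: abs_mult)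
qed measurable

lemma integrable_bounded_mult_p:
  fixes g :: "'a \<Rightarrow> real"
  assumes g: "g \<in> borel_measurable borel" "\<And>x. \<bar>g x\<bar> \<le> B"
  shows "integrable lborel (\<lambda>x. g x * p x)"
proof (rule integrable_mult_p[OF g(1)])
  fix x
  have "B \<ge> 0" using g(2)[of x] by linarith
  then show "\<bar>g x\<bar> \<le> B * (1 + (norm x)\<^sup>2)"
    using g(2)[of x] mult_left_mono[of 1 "1 + (norm x)\<^sup>2" B] by simp
qed

lemma integrable_sq_norm_sq_mult_p:
  fixes g :: "'a \<Rightarrow> real"
  assumes [measurable]: "g \<in> borel_measurable borel" and g: "\<And>x. \<bar>g x\<bar> \<le> B"
  shows "integrable lborel (\<lambda>x. (g x)\<^sup>2 * (norm x)\<^sup>2 * p x)"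
proof (rule integrable_mult_p)
  fix x
  have "(g x)\<^sup>2 \<le> B\<^sup>2" using g[of x] by (metis abs_ge_zero power2_abs power_mono)
  then show "\<bar>(g x)\<^sup>2 * (norm x)\<^sup>2\<bar> \<le> B\<^sup>2 * (1 + (norm x)\<^sup>2)"
    by (simp add: abs_mult mult_mono)
qed measurable

text \<open>Outside the ball \<open>f\<^sup>2\<close> is at most \<open>f\<^sup>2 |x|\<^sup>2 / r\<^sup>2\<close>. For the given size of \<open>r\<close> the second moment bound
then returns at most half of \<open>\<integral> f\<^sup>2 p\<close>, which is absorbed.\<close>

lemma poincare_off_ball:
  assumes r: "r > 0" "4 * (b + real DIM('a)) \<le> a * r\<^sup>2"
    and f: "\<And>x. GDERIV f x :> D x" and D: "continuous_on UNIV D"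
    and fB: "\<And>x. \<bar>f x\<bar> \<le> B" and DB: "\<And>x. norm (D x) \<le> B"
  shows "(\<integral>x. (f x)\<^sup>2 * p x \<partial>lborel)
    \<le> 2 * (\<integral>x. (f x)\<^sup>2 * indicator (ball 0 r) x * p x \<partial>lborel)
      + 8 / (a\<^sup>2 * r\<^sup>2) * (\<integral>x. (norm (D x))\<^sup>2 * p x \<partial>lborel)"
proof -
  have cf: "continuous_on UNIV f"
    by (rule continuous_on_GDERIV[OF f])
  note [measurable] = borel_measurable_continuous_onI[OF cf] borel_measurable_continuous_onI[OF D]
  have f2: "(f x)\<^sup>2 \<le> B\<^sup>2" for x using fB[of x] by (metis abs_ge_zero power2_abs power_mono)
  define I0 where "I0 = (\<integral>x. (f x)\<^sup>2 * p x \<partial>lborel)"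
  define I1 where "I1 = (\<integral>x. (f x)\<^sup>2 * (norm x)\<^sup>2 * p x \<partial>lborel)"
  define I2 where "I2 = (\<integral>x. (norm (D x))\<^sup>2 * p x \<partial>lborel)"
  define IB where "IB = (\<integral>x. (f x)\<^sup>2 * indicator (ball 0 r) x * p x \<partial>lborel)"
  have i0: "integrable lborel (\<lambda>x. (f x)\<^sup>2 * p x)"
    by (rule integrable_bounded_mult_p[of _ "B\<^sup>2"]) (use f2 in auto)
  have iB: "integrable lborel (\<lambda>x. (f x)\<^sup>2 * indicator (ball 0 r) x * p x)"
    by (rule integrable_bounded_mult_p[of _ "B\<^sup>2"]) (use f2 in \<open>auto simp: indicator_def\<close>)
  have i1: "integrable lborel (\<lambda>x. (f x)\<^sup>2 * (norm x)\<^sup>2 * p x)"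
    by (rule integrable_sq_norm_sq_mult_p[OF _ fB]) measurable
  have "I0 \<le> (\<integral>x. (f x)\<^sup>2 * indicator (ball 0 r) x * p x + 1 / r\<^sup>2 * ((f x)\<^sup>2 * (norm x)\<^sup>2 * p x) \<partial>lborel)"
    unfolding I0_def
  proof (rule integral_mono)
    fix x
    show "(f x)\<^sup>2 * p x \<le> (f x)\<^sup>2 * indicator (ball 0 r) x * p x + 1 / r\<^sup>2 * ((f x)\<^sup>2 * (norm x)\<^sup>2 * p x)"
    proof (cases "x \<in> ball 0 r")
      case False
      then have "r\<^sup>2 \<le> (norm x)\<^sup>2" using r by (intro power_mono) auto
      then have "1 \<le> (norm x)\<^sup>2 / r\<^sup>2" using r by simp
      then have "((f x)\<^sup>2 * p x) * 1 \<le> ((f x)\<^sup>2 * p x) * ((norm x)\<^sup>2 / r\<^sup>2)"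
        using p_pos[of x] by (intro mult_left_mono) auto
      then show ?thesis using False by (simp add: mult_ac)
    qed (use p_pos[of x] in simp)
  qed (use i0 iB i1 in auto)
  also have "\<dots> = IB + 1 / r\<^sup>2 * I1"
    using iB i1 by (simp add: IB_def I1_def)
  finally have le0: "I0 \<le> IB + 1 / r\<^sup>2 * I1" .
  have sm: "a / 2 * I1 \<le> (b + real DIM('a)) * I0 + 2 / a * I2"
    unfolding I0_def I1_def I2_def by (rule second_moment_le[OF f D fB DB])
  have I0: "I0 \<ge> 0" unfolding I0_def using p_pos by (intro integral_nonneg_AE) (auto simp: less_imp_le)
  have "1 / r\<^sup>2 * I1 = 2 / (a * r\<^sup>2) * (a / 2 * I1)" using a_pos by simp
  also have "\<dots> \<le> 2 / (a * r\<^sup>2) * ((b + real DIM('a)) * I0 + 2 / a * I2)"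
    using a_pos by (intro mult_left_mono sm) auto
  also have "\<dots> = (4 * (b + real DIM('a))) * (I0 / (2 * (a * r\<^sup>2))) + 4 / (a\<^sup>2 * r\<^sup>2) * I2"
    using a_pos r by (simp add: field_simps power2_eq_square)
  also have "\<dots> \<le> (a * r\<^sup>2) * (I0 / (2 * (a * r\<^sup>2))) + 4 / (a\<^sup>2 * r\<^sup>2) * I2"
    using r(2) I0 a_pos by (intro add_right_mono mult_right_mono) auto
  also have "(a * r\<^sup>2) * (I0 / (2 * (a * r\<^sup>2))) = I0 / 2"
    using a_pos r by simp
  finally have "1 / r\<^sup>2 * I1 \<le> I0 / 2 + 4 / (a\<^sup>2 * r\<^sup>2) * I2" .
  with le0 have "I0 \<le> 2 * IB + 2 * (4 / (a\<^sup>2 * r\<^sup>2) * I2)" by linarith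
  then show ?thesis by (simp add: I0_def IB_def I2_def)
qed

end

locale confined_probability_density = confined_density +
  assumes integral_p: "(\<integral>x. p x \<partial>lborel) = 1"
begin

lemma variance_eq:
  fixes f :: "'a \<Rightarrow> real"
  assumes [measurable]: "f \<in> borel_measurable borel" and f: "\<And>x. \<bar>f x\<bar> \<le> B"
  shows "(\<integral>x. (f x - c)\<^sup>2 * p x \<partial>lborel)
    = (\<integral>x. (f x)\<^sup>2 * p x \<partial>lborel) - 2 * c * (\<integral>x. f x * p x \<partial>lborel) + c\<^sup>2"
proof -
  have "(f x)\<^sup>2 \<le> B\<^sup>2" for x using f[of x] by (metis abs_ge_zero power2_abs power_mono)
  then have "integrable lborel (\<lambda>x. (f x)\<^sup>2 * p x)"
    by (intro integrable_bounded_mult_p[of _ "B\<^sup>2"]) auto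
  moreover have "integrable lborel (\<lambda>x. f x * p x)"
    by (intro integrable_bounded_mult_p[of _ "B"] f) auto
  moreover have "(f x - c)\<^sup>2 * p x = (f x)\<^sup>2 * p x - 2 * c * (f x * p x) + c\<^sup>2 * p x" for x
    by (simp add: power2_eq_square algebra_simps)
  ultimately show ?thesis using integrable_p integral_p by simp
qed

text \<open>The variance is at most \<open>\<integral> (f - f(y))\<^sup>2 p\<close> for each point \<open>y\<close> of a large ball. By the previous lemma
only the part of this integral over the ball matters, and averaging over \<open>y\<close> leads to the two-point
Poincare inequality on the ball, where \<open>p\<close> is bounded above and below.\<close>

lemma poincare:
  obtains C where "C \<ge> 0"
    "\<And>(f :: 'a \<Rightarrow> real) D B. (\<And>x. GDERIV f x :> D x) \<Longrightarrow> continuous_on UNIV D \<Longrightarrow> (\<And>x. \<bar>f x\<bar> \<le> B) \<Longrightarrow> (\<And>x. norm (D x) \<le> B) \<Longrightarrow>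
       (\<integral>x. (f x - (\<integral>x. f x * p x \<partial>lborel))\<^sup>2 * p x \<partial>lborel) \<le> C * (\<integral>x. (norm (D x))\<^sup>2 * p x \<partial>lborel)"
proof -
  \<comment> \<open>The smallest radius that the previous lemma admits.\<close>
  define r where "r = 2 * sqrt ((b + real DIM('a)) / a)"
  have bd: "b + real DIM('a) > 0" using b_nonneg by (simp add: add_nonneg_pos)
  then have r: "r > 0" using a_pos by (simp add: r_def)
  have r2: "4 * (b + real DIM('a)) \<le> a * r\<^sup>2" using a_pos bd by (simp add: r_def power_mult_distrib)
  define S where "S = ball (0::'a) r"
  have [measurable]: "S \<in> sets borel" by (simp add: S_def)
  define \<beta> where "\<beta> = measure lborel S"
  have \<beta>: "\<beta> > 0" using r by (simp add: \<beta>_def S_def content_ball_pos)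
  have eS: "emeasure lborel S = ennreal \<beta>"
    unfolding \<beta>_def using emeasure_lborel_ball_finite[of "0::'a" r]
    by (intro emeasure_eq_ennreal_measure) (auto simp: S_def)
  have cp: "continuous_on (cball 0 r) p" using continuous_p by (rule continuous_on_subset) auto
  have ne: "cball (0::'a) r \<noteq> {}" using r by simp
  obtain x1 where x1: "\<And>x. x \<in> cball 0 r \<Longrightarrow> p x \<le> p x1"
    using continuous_attains_sup[OF compact_cball ne cp] by blast
  obtain x2 where x2: "\<And>x. x \<in> cball 0 r \<Longrightarrow> p x2 \<le> p x"
    using continuous_attains_inf[OF compact_cball ne cp] by blast
  define k where "k = (2 * r)\<^sup>2 * 2 ^ DIM('a)"
  have k: "k \<ge> 0" by (simp add: k_def)
  define C where "C = 2 * p x1 * k / p x2 + 8 / (a\<^sup>2 * r\<^sup>2)"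
  show thesis
  proof (rule that)
    show "C \<ge> 0" using p_pos[of x1] p_pos[of x2] k by (simp add: C_def)
    fix f :: "'a \<Rightarrow> real" and D B assume f: "\<And>x. GDERIV f x :> D x" and D: "continuous_on UNIV D"
      and fB: "\<And>x. \<bar>f x\<bar> \<le> B" and DB: "\<And>x. norm (D x) \<le> B"
    have cf: "continuous_on UNIV f"
      by (rule continuous_on_GDERIV[OF f])
    note [measurable] = borel_measurable_continuous_onI[OF cf] borel_measurable_continuous_onI[OF D]
    define m where "m = (\<integral>x. f x * p x \<partial>lborel)"
    define Var where "Var = (\<integral>x. (f x - m)\<^sup>2 * p x \<partial>lborel)"
    define I where "I = (\<integral>x. (norm (D x))\<^sup>2 * p x \<partial>lborel)"
    have I0: "I \<ge> 0" unfolding I_def using p_pos by (intro integral_nonneg_AE) (auto simp: less_imp_le)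
    have Var0: "Var \<ge> 0" unfolding Var_def using p_pos by (intro integral_nonneg_AE) (auto simp: less_imp_le)
    have B0: "B \<ge> 0" using fB[of 0] by linarith
    have D2: "(norm (D x))\<^sup>2 \<le> B\<^sup>2" for x using DB[of x] by (intro power_mono) auto
    have iI: "integrable lborel (\<lambda>x. (norm (D x))\<^sup>2 * p x)"
      by (rule integrable_bounded_mult_p[of _ "B\<^sup>2"]) (use D2 in auto)
    define E where "E = 8 / (a\<^sup>2 * r\<^sup>2) * I"
    have E0: "E \<ge> 0" using I0 by (simp add: E_def)
    have Var_le: "Var \<le> (\<integral>x. (f x - c)\<^sup>2 * p x \<partial>lborel)" for c
    proof -
      have "0 \<le> (c - m)\<^sup>2" by simp
      then show ?thesis
        unfolding Var_def variance_eq[OF borel_measurable_continuous_onI[OF cf] fB] m_def[symmetric]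
        by (simp add: power2_eq_square algebra_simps)
    qed
    have base: "ennreal Var * indicator S y
      \<le> ennreal (2 * p x1) * (\<integral>\<^sup>+x. ennreal ((f x - f y)\<^sup>2) * indicator S y * indicator S x \<partial>lborel)
         + ennreal E * indicator S y" for y
    proof (cases "y \<in> S")
      case True
      have fy: "\<bar>f x - f y\<bar> \<le> 2 * B" for x using fB[of x] fB[of y] by linarith
      have fy2: "(f x - f y)\<^sup>2 \<le> (2 * B)\<^sup>2" for x using fy[of x] by (metis abs_ge_zero power2_abs power_mono)
      have der: "GDERIV (\<lambda>x. f x - f y) x :> D x" for x
        using GDERIV_diff[OF f GDERIV_const] by simp
      have DB2: "norm (D x) \<le> 2 * B" for x using DB[of x] B0 by linarith
      have "Var \<le> (\<integral>x. (f x - f y)\<^sup>2 * p x \<partial>lborel)" by (rule Var_le)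
      also have "\<dots> \<le> 2 * (\<integral>x. (f x - f y)\<^sup>2 * indicator S x * p x \<partial>lborel) + E"
        unfolding S_def E_def I_def by (rule poincare_off_ball[OF r r2 der D fy DB2])
      finally have "ennreal Var \<le> ennreal (2 * (\<integral>x. (f x - f y)\<^sup>2 * indicator S x * p x \<partial>lborel) + E)"
        by (rule ennreal_leI)
      also have "\<dots> = ennreal (2 * (\<integral>x. (f x - f y)\<^sup>2 * indicator S x * p x \<partial>lborel)) + ennreal E"
        using E0 p_pos by (intro ennreal_plus mult_nonneg_nonneg integral_nonneg_AE) (auto simp: less_imp_le)
      also have "ennreal (2 * (\<integral>x. (f x - f y)\<^sup>2 * indicator S x * p x \<partial>lborel))
          = 2 * (\<integral>\<^sup>+x. ennreal ((f x - f y)\<^sup>2 * indicator S x * p x) \<partial>lborel)"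
      proof -
        have "integrable lborel (\<lambda>x. (f x - f y)\<^sup>2 * indicator S x * p x)"
          by (rule integrable_bounded_mult_p[of _ "(2 * B)\<^sup>2"])
             (use fy2 in \<open>auto simp: indicator_def\<close>)
        then show ?thesis using p_pos
          by (subst nn_integral_eq_integral) (auto simp: ennreal_mult' less_imp_le)
      qed
      also have "(\<integral>\<^sup>+x. ennreal ((f x - f y)\<^sup>2 * indicator S x * p x) \<partial>lborel)
          \<le> (\<integral>\<^sup>+x. ennreal (p x1) * (ennreal ((f x - f y)\<^sup>2) * indicator S y * indicator S x) \<partial>lborel)"
      proof (intro nn_integral_mono)
        fix x
        show "ennreal ((f x - f y)\<^sup>2 * indicator S x * p x)
          \<le> ennreal (p x1) * (ennreal ((f x - f y)\<^sup>2) * indicator S y * indicator S x)"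
        proof (cases "x \<in> S")
          case xS: True
          then have "p x \<le> p x1" by (intro x1) (auto simp: S_def)
          then have "(f x - f y)\<^sup>2 * p x \<le> p x1 * (f x - f y)\<^sup>2"
            by (subst mult.commute) (intro mult_right_mono, auto)
          then have "ennreal ((f x - f y)\<^sup>2 * p x) \<le> ennreal (p x1 * (f x - f y)\<^sup>2)" by (rule ennreal_leI)
          then show ?thesis using xS True p_pos[of x1] by (simp add: ennreal_mult less_imp_le)
        qed simp
      qed
      also have "\<dots> = ennreal (p x1) * (\<integral>\<^sup>+x. ennreal ((f x - f y)\<^sup>2) * indicator S y * indicator S x \<partial>lborel)"
        by (rule nn_integral_cmult) measurable
      finally show ?thesis using True p_pos[of x1]
        by (simp add: ennreal_mult less_imp_le mult.assoc mult_left_mono add_right_mono)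
    qed simp
    have "ennreal Var * ennreal \<beta> = (\<integral>\<^sup>+y. ennreal Var * indicator S y \<partial>lborel)"
      by (simp add: nn_integral_cmult_indicator eS)
    also have "\<dots> \<le> (\<integral>\<^sup>+y. ennreal (2 * p x1) * (\<integral>\<^sup>+x. ennreal ((f x - f y)\<^sup>2) * indicator S y * indicator S x \<partial>lborel)
         + ennreal E * indicator S y \<partial>lborel)"
      by (intro nn_integral_mono base)
    also have "\<dots> = ennreal (2 * p x1) * (\<integral>\<^sup>+y. \<integral>\<^sup>+x. ennreal ((f x - f y)\<^sup>2) * indicator S y * indicator S x \<partial>lborel \<partial>lborel)
         + ennreal E * ennreal \<beta>"
      by (subst nn_integral_add, measurable, subst nn_integral_cmult, measurable)
         (simp add: nn_integral_cmult_indicator eS)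
    also have "\<dots> \<le> ennreal (2 * p x1) * (ennreal k * ennreal \<beta> * ennreal (I / p x2)) + ennreal E * ennreal \<beta>"
    proof (intro add_right_mono mult_left_mono)
      have "(\<integral>\<^sup>+y. \<integral>\<^sup>+x. ennreal ((f x - f y)\<^sup>2) * indicator S y * indicator S x \<partial>lborel \<partial>lborel)
        \<le> ennreal k * ennreal \<beta> * (\<integral>\<^sup>+x. ennreal ((norm (D x))\<^sup>2) * indicator S x \<partial>lborel)"
        using ball_two_point_poincare[OF f D, of r] unfolding k_def eS[symmetric] S_def .
      also have "(\<integral>\<^sup>+x. ennreal ((norm (D x))\<^sup>2) * indicator S x \<partial>lborel) \<le> ennreal (I / p x2)"
      proof -
        have "(\<integral>\<^sup>+x. ennreal ((norm (D x))\<^sup>2) * indicator S x \<partial>lborel)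
          \<le> (\<integral>\<^sup>+x. ennreal ((norm (D x))\<^sup>2 * p x / p x2) \<partial>lborel)"
        proof (intro nn_integral_mono)
          fix x
          show "ennreal ((norm (D x))\<^sup>2) * indicator S x \<le> ennreal ((norm (D x))\<^sup>2 * p x / p x2)"
          proof (cases "x \<in> S")
            case True
            then have "p x2 \<le> p x" by (intro x2) (auto simp: S_def)
            then have "(norm (D x))\<^sup>2 * 1 \<le> (norm (D x))\<^sup>2 * (p x / p x2)"
              using p_pos[of x2] by (intro mult_left_mono) auto
            then show ?thesis using True by (simp add: ennreal_leI)
          qed simp
        qed
        also have "\<dots> = ennreal (I / p x2)"
          using iI p_pos by (subst nn_integral_eq_integral) (auto simp: I_def less_imp_le)
        finally show ?thesis .
      qed
      finally show "(\<integral>\<^sup>+y. \<integral>\<^sup>+x. ennreal ((f x - f y)\<^sup>2) * indicator S y * indicator S x \<partial>lborel \<partial>lborel)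
        \<le> ennreal k * ennreal \<beta> * ennreal (I / p x2)"
        by (simp add: mult_left_mono)
    qed auto
    also have "\<dots> = ennreal ((2 * p x1) * (k * \<beta> * (I / p x2)) + E * \<beta>)"
      using p_pos[of x1] p_pos[of x2] k \<beta> I0 E0 by (simp add: ennreal_mult[symmetric] ennreal_plus[symmetric] del: ennreal_plus)
    also have "(2 * p x1) * (k * \<beta> * (I / p x2)) + E * \<beta> = C * I * \<beta>"
      by (simp add: C_def E_def algebra_simps)
    finally have "ennreal (Var * \<beta>) \<le> ennreal (C * I * \<beta>)"
      using Var0 \<beta> by (simp add: ennreal_mult)
    then have "Var * \<beta> \<le> C * I * \<beta>"
      using I0 \<beta> \<open>C \<ge> 0\<close> by (subst (asm) ennreal_le_iff) auto
    then have "Var \<le> C * I" using \<beta> by simp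
    then show "(\<integral>x. (f x - (\<integral>x. f x * p x \<partial>lborel))\<^sup>2 * p x \<partial>lborel) \<le> C * (\<integral>x. (norm (D x))\<^sup>2 * p x \<partial>lborel)"
      by (simp add: Var_def I_def m_def)
  qed
qed

end

context confined_density begin

text \<open>Apply the Euclidean bound to \<open>v = u \<surd>p\<close>. Its energy is at most \<open>\<integral> 2 |\<nabla>u|\<^sup>2 p\<close> plus a multiple of
\<open>\<integral> u\<^sup>2 (1 + |x|\<^sup>2) p\<close>, and passing from \<open>ln v\<^sup>2\<close> to \<open>ln u\<^sup>2 = ln v\<^sup>2 - ln p\<close> costs another multiple of
\<open>\<integral> u\<^sup>2 (1 + |x|\<^sup>2) p\<close>, since \<open>- ln p\<close> grows at most quadratically. The second moment bound removes
the weight.\<close>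

lemma entropy_plus_bound:
  obtains C where "C \<ge> 0"
    "\<And>(u :: 'a \<Rightarrow> real) D B. (\<And>x. GDERIV u x :> D x) \<Longrightarrow> continuous_on UNIV D \<Longrightarrow> (\<And>x. \<bar>u x\<bar> \<le> B) \<Longrightarrow> (\<And>x. norm (D x) \<le> B) \<Longrightarrow>
       (\<integral>x. (u x)\<^sup>2 * p x \<partial>lborel) \<le> 1 \<Longrightarrow>
       (\<integral>\<^sup>+x. ennreal ((u x)\<^sup>2 * max 0 (ln ((u x)\<^sup>2)) * p x) \<partial>lborel)
         \<le> ennreal (C * ((\<integral>x. (u x)\<^sup>2 * p x \<partial>lborel) + (\<integral>x. (norm (D x))\<^sup>2 * p x \<partial>lborel)))"
proof -
  obtain c A :: real where c: "c \<ge> 0" and A: "A \<ge> 0" and euclidean: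
    "\<And>(v :: 'a \<Rightarrow> real) D. (\<And>x. GDERIV v x :> D x) \<Longrightarrow> continuous_on UNIV D \<Longrightarrow>
       (\<integral>\<^sup>+x. ennreal ((v x)\<^sup>2) \<partial>lborel) \<le> 1 \<Longrightarrow>
       (\<integral>\<^sup>+x. ennreal ((v x)\<^sup>2 * max 0 (ln ((v x)\<^sup>2))) \<partial>lborel)
         \<le> ennreal c * (\<integral>\<^sup>+x. ennreal ((v x)\<^sup>2) \<partial>lborel)
           + ennreal A * (\<integral>\<^sup>+x. ennreal ((norm (D x))\<^sup>2) \<partial>lborel)"
    using euclidean_entropy_bound by blast
  define w where "w = \<bar>ln (p 0)\<bar> + 2 * L"
  have w: "w \<ge> 0" using L_pos by (simp add: w_def)
  have ln_p: "- ln (p x) \<le> w * (1 + (norm x)\<^sup>2)" for x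
  proof -
    have "ln (p 0 * exp (- (2 * L * (1 + (norm x)\<^sup>2)))) \<le> ln (p x)"
      using p_lower[of x] p_pos[of 0] by (intro ln_mono) auto
    then have "- ln (p x) \<le> - ln (p 0) + 2 * L * (1 + (norm x)\<^sup>2)"
      using p_pos[of 0] by (simp add: ln_mult_pos)
    moreover have "- ln (p 0) \<le> \<bar>ln (p 0)\<bar> * (1 + (norm x)\<^sup>2)"
      using mult_left_mono[of 1 "1 + (norm x)\<^sup>2" "\<bar>ln (p 0)\<bar>"] by simp
    ultimately show ?thesis by (simp add: w_def distrib_right)
  qed
  define e where "e = b + real DIM('a)"
  have e: "e \<ge> 0" using b_nonneg by (simp add: e_def)
  define k where "k = A * L\<^sup>2 + w"
  have k: "k \<ge> 0" using A w by (simp add: k_def)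
  define C where "C = c + 2 * A + k + k * (2 * e / a) + k * (4 / a\<^sup>2)"
  show thesis
  proof (rule that)
    show "C \<ge> 0" using c A k e a_pos by (simp add: C_def)
    fix u :: "'a \<Rightarrow> real" and D B
    assume u: "\<And>x. GDERIV u x :> D x" and D: "continuous_on UNIV D"
      and uB: "\<And>x. \<bar>u x\<bar> \<le> B" and DB: "\<And>x. norm (D x) \<le> B"
      and le1: "(\<integral>x. (u x)\<^sup>2 * p x \<partial>lborel) \<le> 1"
    have cu: "continuous_on UNIV u"
      by (rule continuous_on_GDERIV[OF u])
    note [measurable] = borel_measurable_continuous_onI[OF cu] borel_measurable_continuous_onI[OF D]
    have u2: "(u x)\<^sup>2 \<le> B\<^sup>2" for x using uB[of x] by (metis abs_ge_zero power2_abs power_mono)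
    have D2: "(norm (D x))\<^sup>2 \<le> B\<^sup>2" for x using DB[of x] by (intro power_mono) auto
    define I0 where "I0 = (\<integral>x. (u x)\<^sup>2 * p x \<partial>lborel)"
    define I1 where "I1 = (\<integral>x. (u x)\<^sup>2 * (norm x)\<^sup>2 * p x \<partial>lborel)"
    define I2 where "I2 = (\<integral>x. (norm (D x))\<^sup>2 * p x \<partial>lborel)"
    have i0: "integrable lborel (\<lambda>x. (u x)\<^sup>2 * p x)"
      by (rule integrable_bounded_mult_p[of _ "B\<^sup>2"]) (use u2 in auto)
    have i1: "integrable lborel (\<lambda>x. (u x)\<^sup>2 * (norm x)\<^sup>2 * p x)"
      by (rule integrable_sq_norm_sq_mult_p[OF _ uB]) measurable
    have i2: "integrable lborel (\<lambda>x. (norm (D x))\<^sup>2 * p x)"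
      by (rule integrable_bounded_mult_p[of _ "B\<^sup>2"]) (use D2 in auto)
    have nn: "I0 \<ge> 0" "I1 \<ge> 0" "I2 \<ge> 0"
      unfolding I0_def I1_def I2_def using p_pos by (auto intro!: integral_nonneg_AE simp: less_imp_le)
    define v where "v x = u x * sqrt (p x)" for x
    define Dv where "Dv x = sqrt (p x) *\<^sub>R D x + (u x / (2 * sqrt (p x))) *\<^sub>R G x" for x
    have v: "GDERIV v x :> Dv x" for x
    proof -
      have "GDERIV (\<lambda>x. sqrt (p x)) x :> (inverse (sqrt (p x)) / 2) *\<^sub>R G x"
        by (rule GDERIV_DERIV_compose[OF GDERIV_p DERIV_real_sqrt[OF p_pos]])
      from GDERIV_mult[OF u this] show ?thesis
        unfolding v_def by (rule GDERIV_subst) (simp add: Dv_def inverse_eq_divide add.commute)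
    qed
    have Dv: "continuous_on UNIV Dv"
    proof -
      have "2 * sqrt (p x) \<noteq> 0" for x using p_pos[of x] by simp
      then show ?thesis unfolding Dv_def
        by (intro continuous_intros cu D continuous_G continuous_p) auto
    qed
    have v2: "(v x)\<^sup>2 = (u x)\<^sup>2 * p x" for x
      using p_pos[of x] by (simp add: v_def power_mult_distrib)
    have int_v2: "(\<integral>\<^sup>+x. ennreal ((v x)\<^sup>2) \<partial>lborel) = ennreal I0"
      unfolding v2 I0_def using i0 p_pos by (intro nn_integral_eq_integral) (auto simp: less_imp_le)
    have Dv2: "(norm (Dv x))\<^sup>2 \<le> 2 * ((norm (D x))\<^sup>2 * p x) + L\<^sup>2 * ((u x)\<^sup>2 * p x + (u x)\<^sup>2 * (norm x)\<^sup>2 * p x)" for x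
    proof -
      define X where "X = sqrt (p x) * norm (D x)"
      define Y where "Y = \<bar>u x\<bar> / (2 * sqrt (p x)) * norm (G x)"
      have "norm (Dv x) \<le> X + Y"
        unfolding Dv_def X_def Y_def by (rule order_trans[OF norm_triangle_ineq]) (use p_pos[of x] in \<open>simp add: abs_mult\<close>)
      then have "(norm (Dv x))\<^sup>2 \<le> (X + Y)\<^sup>2" by (intro power_mono) auto
      also have "\<dots> \<le> 2 * X\<^sup>2 + 2 * Y\<^sup>2"
        using zero_le_power2[of "X - Y"] by (simp add: power2_sum power2_diff)
      also have "X\<^sup>2 = (norm (D x))\<^sup>2 * p x"
        using p_pos[of x] by (simp add: X_def power_mult_distrib)
      also have "2 * Y\<^sup>2 \<le> L\<^sup>2 * ((u x)\<^sup>2 * p x + (u x)\<^sup>2 * (norm x)\<^sup>2 * p x)"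
      proof -
        have "Y \<le> \<bar>u x\<bar> / (2 * sqrt (p x)) * (L * (1 + norm x) * p x)"
          unfolding Y_def using p_pos[of x] by (intro mult_left_mono norm_G_le) auto
        also have "\<dots> = \<bar>u x\<bar> / 2 * L * (1 + norm x) * sqrt (p x)"
        proof -
          define q where "q = sqrt (p x)"
          have q: "q > 0" "p x = q * q" using p_pos[of x] by (auto simp: q_def)
          show ?thesis unfolding q_def[symmetric] unfolding q(2) using q(1) by simp
        qed
        finally have "Y\<^sup>2 \<le> (\<bar>u x\<bar> / 2 * L * (1 + norm x) * sqrt (p x))\<^sup>2"
          using p_pos[of x] by (intro power_mono) (auto simp: Y_def)
        also have "\<dots> = L\<^sup>2 * (u x)\<^sup>2 * p x * ((1 + norm x)\<^sup>2 / 4)"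
          using p_pos[of x] by (simp add: power_mult_distrib power_divide)
        also have "\<dots> \<le> L\<^sup>2 * (u x)\<^sup>2 * p x * ((1 + (norm x)\<^sup>2) / 2)"
          using p_pos[of x] zero_le_power2[of "norm x - 1"]
          by (intro mult_left_mono) (auto simp: power2_sum power2_diff)
        finally show ?thesis by (simp add: field_simps)
      qed
      finally show ?thesis by simp
    qed
    have int_Dv2: "(\<integral>\<^sup>+x. ennreal ((norm (Dv x))\<^sup>2) \<partial>lborel) \<le> ennreal (2 * I2 + L\<^sup>2 * (I0 + I1))"
    proof -
      have "(\<integral>\<^sup>+x. ennreal ((norm (Dv x))\<^sup>2) \<partial>lborel)
        \<le> (\<integral>\<^sup>+x. ennreal (2 * ((norm (D x))\<^sup>2 * p x) + L\<^sup>2 * ((u x)\<^sup>2 * p x + (u x)\<^sup>2 * (norm x)\<^sup>2 * p x)) \<partial>lborel)"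
        by (intro nn_integral_mono ennreal_leI Dv2)
      also have "\<dots> = ennreal (\<integral>x. 2 * ((norm (D x))\<^sup>2 * p x) + L\<^sup>2 * ((u x)\<^sup>2 * p x + (u x)\<^sup>2 * (norm x)\<^sup>2 * p x) \<partial>lborel)"
        using i0 i1 i2 p_pos by (intro nn_integral_eq_integral) (auto simp: less_imp_le)
      also have "(\<integral>x. 2 * ((norm (D x))\<^sup>2 * p x) + L\<^sup>2 * ((u x)\<^sup>2 * p x + (u x)\<^sup>2 * (norm x)\<^sup>2 * p x) \<partial>lborel)
          = 2 * I2 + L\<^sup>2 * (I0 + I1)"
        using i0 i1 i2 by (simp add: I0_def I1_def I2_def)
      finally show ?thesis .
    qed
    have pt: "(u x)\<^sup>2 * max 0 (ln ((u x)\<^sup>2)) * p x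
        \<le> (v x)\<^sup>2 * max 0 (ln ((v x)\<^sup>2)) + w * ((u x)\<^sup>2 * p x + (u x)\<^sup>2 * (norm x)\<^sup>2 * p x)" for x
    proof (cases "u x = 0")
      case False
      then have "ln ((v x)\<^sup>2) = ln ((u x)\<^sup>2) + ln (p x)"
        unfolding v2 using p_pos[of x] by (intro ln_mult_pos) auto
      then have "max 0 (ln ((u x)\<^sup>2)) \<le> max 0 (ln ((v x)\<^sup>2)) + w * (1 + (norm x)\<^sup>2)"
        using ln_p[of x] w by auto
      then have "((u x)\<^sup>2 * p x) * max 0 (ln ((u x)\<^sup>2)) \<le> ((u x)\<^sup>2 * p x) * (max 0 (ln ((v x)\<^sup>2)) + w * (1 + (norm x)\<^sup>2))"
        using p_pos[of x] by (intro mult_left_mono) auto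
      then show ?thesis unfolding v2 by (simp add: algebra_simps)
    qed (simp add: v_def)
    have "(\<integral>\<^sup>+x. ennreal ((u x)\<^sup>2 * max 0 (ln ((u x)\<^sup>2)) * p x) \<partial>lborel)
      \<le> (\<integral>\<^sup>+x. ennreal ((v x)\<^sup>2 * max 0 (ln ((v x)\<^sup>2)))
            + ennreal (w * ((u x)\<^sup>2 * p x + (u x)\<^sup>2 * (norm x)\<^sup>2 * p x)) \<partial>lborel)"
    proof (intro nn_integral_mono)
      fix x
      have "0 \<le> w * ((u x)\<^sup>2 * p x + (u x)\<^sup>2 * (norm x)\<^sup>2 * p x)"
        using w p_pos[of x] by (intro mult_nonneg_nonneg add_nonneg_nonneg) auto
      then show "ennreal ((u x)\<^sup>2 * max 0 (ln ((u x)\<^sup>2)) * p x)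
          \<le> ennreal ((v x)\<^sup>2 * max 0 (ln ((v x)\<^sup>2)))
            + ennreal (w * ((u x)\<^sup>2 * p x + (u x)\<^sup>2 * (norm x)\<^sup>2 * p x))"
        using ennreal_leI[OF pt[of x]] by (subst (asm) ennreal_plus) auto
    qed
    also have "\<dots> = (\<integral>\<^sup>+x. ennreal ((v x)\<^sup>2 * max 0 (ln ((v x)\<^sup>2))) \<partial>lborel)
        + (\<integral>\<^sup>+x. ennreal (w * ((u x)\<^sup>2 * p x + (u x)\<^sup>2 * (norm x)\<^sup>2 * p x)) \<partial>lborel)"
      unfolding v2 by (rule nn_integral_add) measurable
    also have "(\<integral>\<^sup>+x. ennreal (w * ((u x)\<^sup>2 * p x + (u x)\<^sup>2 * (norm x)\<^sup>2 * p x)) \<partial>lborel)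
        = ennreal (\<integral>x. w * ((u x)\<^sup>2 * p x + (u x)\<^sup>2 * (norm x)\<^sup>2 * p x) \<partial>lborel)"
      using i0 i1 p_pos w by (intro nn_integral_eq_integral) (auto simp: less_imp_le)
    also have "(\<integral>x. w * ((u x)\<^sup>2 * p x + (u x)\<^sup>2 * (norm x)\<^sup>2 * p x) \<partial>lborel) = w * (I0 + I1)"
      using i0 i1 by (simp add: I0_def I1_def)
    also have "(\<integral>\<^sup>+x. ennreal ((v x)\<^sup>2 * max 0 (ln ((v x)\<^sup>2))) \<partial>lborel)
        \<le> ennreal c * ennreal I0 + ennreal A * ennreal (2 * I2 + L\<^sup>2 * (I0 + I1))"
    proof -
      have "(\<integral>\<^sup>+x. ennreal ((v x)\<^sup>2) \<partial>lborel) \<le> 1"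
        unfolding int_v2 using le1 by (simp add: I0_def)
      from euclidean[OF v Dv this] have "(\<integral>\<^sup>+x. ennreal ((v x)\<^sup>2 * max 0 (ln ((v x)\<^sup>2))) \<partial>lborel)
         \<le> ennreal c * ennreal I0 + ennreal A * (\<integral>\<^sup>+x. ennreal ((norm (Dv x))\<^sup>2) \<partial>lborel)"
        unfolding int_v2 .
      also have "\<dots> \<le> ennreal c * ennreal I0 + ennreal A * ennreal (2 * I2 + L\<^sup>2 * (I0 + I1))"
        by (intro add_left_mono mult_left_mono int_Dv2) auto
      finally show ?thesis .
    qed
    also have "ennreal c * ennreal I0 + ennreal A * ennreal (2 * I2 + L\<^sup>2 * (I0 + I1)) + ennreal (w * (I0 + I1))
        = ennreal (c * I0 + A * (2 * I2 + L\<^sup>2 * (I0 + I1)) + w * (I0 + I1))"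
      using c A w nn by (simp add: ennreal_mult)
    also have "\<dots> \<le> ennreal (C * (I0 + I2))"
    proof (rule ennreal_leI)
      have "a / 2 * I1 \<le> e * I0 + 2 / a * I2"
        unfolding I0_def I1_def I2_def e_def by (rule second_moment_le[OF u D uB DB])
      then have "2 / a * (a / 2 * I1) \<le> 2 / a * (e * I0 + 2 / a * I2)"
        using a_pos by (intro mult_left_mono) auto
      then have I1: "I1 \<le> 2 * e / a * I0 + 4 / a\<^sup>2 * I2"
        using a_pos by (simp add: algebra_simps power2_eq_square)
      have "c * I0 + A * (2 * I2 + L\<^sup>2 * (I0 + I1)) + w * (I0 + I1) = c * I0 + 2 * A * I2 + k * I0 + k * I1"
        by (simp add: k_def algebra_simps)
      also have "\<dots> \<le> c * I0 + 2 * A * I2 + k * I0 + k * (2 * e / a * I0 + 4 / a\<^sup>2 * I2)"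
        using I1 k by (intro add_left_mono mult_left_mono) auto
      also have "\<dots> \<le> C * (I0 + I2)"
      proof -
        have "C * (I0 + I2) - (c * I0 + 2 * A * I2 + k * I0 + k * (2 * e / a * I0 + 4 / a\<^sup>2 * I2))
          = 2 * A * I0 + k * (4 / a\<^sup>2) * I0 + (c + k + k * (2 * e / a)) * I2"
          by (simp add: C_def algebra_simps add_divide_distrib)
        also have "\<dots> \<ge> 0" using c A k e a_pos nn by simp
        finally show ?thesis by simp
      qed
      finally show "c * I0 + A * (2 * I2 + L\<^sup>2 * (I0 + I1)) + w * (I0 + I1) \<le> C * (I0 + I2)" .
    qed
    finally show "(\<integral>\<^sup>+x. ennreal ((u x)\<^sup>2 * max 0 (ln ((u x)\<^sup>2)) * p x) \<partial>lborel)
         \<le> ennreal (C * ((\<integral>x. (u x)\<^sup>2 * p x \<partial>lborel) + (\<integral>x. (norm (D x))\<^sup>2 * p x \<partial>lborel)))"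
      by (simp add: I0_def I2_def add_right_mono)
  qed
qed

end

context confined_probability_density begin

text \<open>Both the variance and the entropy term of the deviation \<open>u\<close> from the mean are bounded by the energy,
so no additive constant remains.\<close>

theorem log_sobolev_inequality:
  obtains C where "C > 0"
    "\<And>(f :: 'a \<Rightarrow> real) D B. (\<And>x. GDERIV f x :> D x) \<Longrightarrow> continuous_on UNIV D \<Longrightarrow> (\<And>x. \<bar>f x\<bar> \<le> B) \<Longrightarrow> (\<And>x. norm (D x) \<le> B) \<Longrightarrow>
       (\<integral>x. (f x)\<^sup>2 * p x \<partial>lborel) = 1 \<Longrightarrow>
       (\<integral>x. (f x)\<^sup>2 * ln ((f x)\<^sup>2) * p x \<partial>lborel) \<le> C * (\<integral>x. (norm (D x))\<^sup>2 * p x \<partial>lborel)"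
proof -
  obtain CP where CP: "CP \<ge> 0" and poin: "\<And>(f :: 'a \<Rightarrow> real) D B. (\<And>x. GDERIV f x :> D x) \<Longrightarrow> continuous_on UNIV D \<Longrightarrow> (\<And>x. \<bar>f x\<bar> \<le> B) \<Longrightarrow> (\<And>x. norm (D x) \<le> B) \<Longrightarrow>
       (\<integral>x. (f x - (\<integral>x. f x * p x \<partial>lborel))\<^sup>2 * p x \<partial>lborel) \<le> CP * (\<integral>x. (norm (D x))\<^sup>2 * p x \<partial>lborel)"
    using poincare by blast
  obtain CE where CE: "CE \<ge> 0" and ent:
    "\<And>(u :: 'a \<Rightarrow> real) D B. (\<And>x. GDERIV u x :> D x) \<Longrightarrow> continuous_on UNIV D \<Longrightarrow> (\<And>x. \<bar>u x\<bar> \<le> B) \<Longrightarrow> (\<And>x. norm (D x) \<le> B) \<Longrightarrow>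
       (\<integral>x. (u x)\<^sup>2 * p x \<partial>lborel) \<le> 1 \<Longrightarrow>
       (\<integral>\<^sup>+x. ennreal ((u x)\<^sup>2 * max 0 (ln ((u x)\<^sup>2)) * p x) \<partial>lborel)
         \<le> ennreal (CE * ((\<integral>x. (u x)\<^sup>2 * p x \<partial>lborel) + (\<integral>x. (norm (D x))\<^sup>2 * p x \<partial>lborel)))"
    using entropy_plus_bound by blast
  define C where "C = 18 * (2 * CP + CE * (CP + 1)) + 1"
  show thesis
  proof (rule that)
    show "C > 0" using CP CE by (simp add: C_def add_nonneg_pos)
    fix f :: "'a \<Rightarrow> real" and D B
    assume f: "\<And>x. GDERIV f x :> D x" and D: "continuous_on UNIV D"
      and fB: "\<And>x. \<bar>f x\<bar> \<le> B" and DB: "\<And>x. norm (D x) \<le> B"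
      and f1: "(\<integral>x. (f x)\<^sup>2 * p x \<partial>lborel) = 1"
    have cf: "continuous_on UNIV f"
      by (rule continuous_on_GDERIV[OF f])
    note fm[measurable] = borel_measurable_continuous_onI[OF cf]
    define m where "m = (\<integral>x. f x * p x \<partial>lborel)"
    define u where "u x = f x - m" for x
    have [measurable]: "u \<in> borel_measurable borel" unfolding u_def by measurable
    define s where "s = (\<integral>x. (u x)\<^sup>2 * p x \<partial>lborel)"
    define I where "I = (\<integral>x. (norm (D x))\<^sup>2 * p x \<partial>lborel)"
    define E where "E = (\<integral>x. (u x)\<^sup>2 * max 0 (ln ((u x)\<^sup>2)) * p x \<partial>lborel)"
    have I: "I \<ge> 0" unfolding I_def using p_pos by (intro integral_nonneg_AE) (auto simp: less_imp_le)
    have s0: "s \<ge> 0" unfolding s_def using p_pos by (intro integral_nonneg_AE) (auto simp: less_imp_le)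
    have s: "s = 1 - m\<^sup>2"
      using variance_eq[OF fm fB, of m] by (simp add: f1 m_def[symmetric] s_def u_def power2_eq_square[of m])
    have s1: "s \<le> 1" using s by simp
    have sI: "s \<le> CP * I"
      using poin[OF f D fB DB] by (simp add: s_def u_def I_def m_def)
    have B0: "B \<ge> 0" using fB[of 0] by linarith
    have uB: "\<bar>u x\<bar> \<le> B + \<bar>m\<bar>" for x using fB[of x] by (simp add: u_def)
    have DB': "norm (D x) \<le> B + \<bar>m\<bar>" for x using DB[of x] by simp
    have du: "GDERIV u x :> D x" for x
      using GDERIV_diff[OF f GDERIV_const[of m]] by (simp add: u_def[abs_def])
    \<comment> \<open>Boundedness of \<open>f\<^sup>2 ln f\<^sup>2\<close> makes the integrals below finite.\<close>
    have ln_bd: "\<bar>y * ln y\<bar> \<le> M * \<bar>ln M\<bar> + 1" if "0 \<le> y" "y \<le> M" for y M :: real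
    proof (cases "y \<ge> 1")
      case True
      then have "y * ln y \<le> M * ln M" using that by (intro mult_mono) auto
      then show ?thesis using True that by (simp add: abs_mult) 
    next
      case False
      show ?thesis
      proof (cases "y = 0")
        case True then show ?thesis using that by simp
      next
        case nz: False
        with that have y: "y > 0" by simp
        have "ln (1 / y) \<le> 1 / y - 1" using y by (intro ln_le_minus_one) auto
        then have "- ln y \<le> 1 / y" using y by (simp add: ln_div)
        then have "y * (- ln y) \<le> y * (1 / y)" using y by (intro mult_left_mono) auto
        moreover have "y * ln y \<le> 0" using False y by (intro mult_nonneg_nonpos) auto
        ultimately have "\<bar>y * ln y\<bar> \<le> 1" using y by simp
        moreover have "0 \<le> M * \<bar>ln M\<bar>" using that by simp
        ultimately show ?thesis by linarith
      qed
    qed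
    have f2: "(f x)\<^sup>2 \<le> B\<^sup>2" for x using fB[of x] by (metis abs_ge_zero power2_abs power_mono)
    have u2: "(u x)\<^sup>2 \<le> (B + \<bar>m\<bar>)\<^sup>2" for x using uB[of x] by (metis abs_ge_zero power2_abs power_mono)
    have if0: "integrable lborel (\<lambda>x. (f x)\<^sup>2 * p x)"
      by (rule integrable_bounded_mult_p[of _ "B\<^sup>2"]) (use f2 in auto)
    have iu0: "integrable lborel (\<lambda>x. (u x)\<^sup>2 * p x)"
      by (rule integrable_bounded_mult_p[of _ "(B + \<bar>m\<bar>)\<^sup>2"]) (use u2 in auto)
    have ifl: "integrable lborel (\<lambda>x. (f x)\<^sup>2 * ln ((f x)\<^sup>2) * p x)"
      by (rule integrable_bounded_mult_p[of _ "B\<^sup>2 * \<bar>ln (B\<^sup>2)\<bar> + 1"]) (use ln_bd f2 in auto)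
    have iul: "integrable lborel (\<lambda>x. (u x)\<^sup>2 * max 0 (ln ((u x)\<^sup>2)) * p x)"
    proof (rule integrable_bounded_mult_p)
      fix x
      have "\<bar>(u x)\<^sup>2 * max 0 (ln ((u x)\<^sup>2))\<bar> \<le> \<bar>(u x)\<^sup>2 * ln ((u x)\<^sup>2)\<bar>"
        unfolding abs_mult by (intro mult_left_mono) auto
      also have "\<dots> \<le> (B + \<bar>m\<bar>)\<^sup>2 * \<bar>ln ((B + \<bar>m\<bar>)\<^sup>2)\<bar> + 1"
        by (intro ln_bd u2) auto
      finally show "\<bar>(u x)\<^sup>2 * max 0 (ln ((u x)\<^sup>2))\<bar> \<le> (B + \<bar>m\<bar>)\<^sup>2 * \<bar>ln ((B + \<bar>m\<bar>)\<^sup>2)\<bar> + 1" .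
    qed measurable
    have E_le: "E \<le> CE * (s + I)"
    proof -
      have "ennreal E = (\<integral>\<^sup>+x. ennreal ((u x)\<^sup>2 * max 0 (ln ((u x)\<^sup>2)) * p x) \<partial>lborel)"
        unfolding E_def using iul p_pos
        by (intro nn_integral_eq_integral[symmetric]) (auto simp: less_imp_le)
      also have "\<dots> \<le> ennreal (CE * (s + I))"
        unfolding s_def I_def by (rule ent[OF du D uB DB']) (use s1 in \<open>simp add: s_def\<close>)
      finally show ?thesis using CE s0 I by (subst (asm) ennreal_le_iff) auto
    qed
    have "(\<integral>x. (f x)\<^sup>2 * ln ((f x)\<^sup>2) * p x \<partial>lborel)
      \<le> (\<integral>x. (f x)\<^sup>2 * p x - p x + 18 * (s\<^sup>2 * p x + (u x)\<^sup>2 * p x + (u x)\<^sup>2 * max 0 (ln ((u x)\<^sup>2)) * p x) \<partial>lborel)"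
    proof (rule integral_mono)
      fix x
      have "(f x)\<^sup>2 * ln ((f x)\<^sup>2) \<le> ((f x)\<^sup>2 - 1) + 18 * (s\<^sup>2 + (u x)\<^sup>2 + (u x)\<^sup>2 * max 0 (ln ((u x)\<^sup>2)))"
        using sq_ln_sq_le_deviation[OF s s0, of "u x"] by (simp add: u_def)
      then have "(f x)\<^sup>2 * ln ((f x)\<^sup>2) * p x \<le> (((f x)\<^sup>2 - 1) + 18 * (s\<^sup>2 + (u x)\<^sup>2 + (u x)\<^sup>2 * max 0 (ln ((u x)\<^sup>2)))) * p x"
        using p_pos[of x] by (intro mult_right_mono) auto
      then show "(f x)\<^sup>2 * ln ((f x)\<^sup>2) * p x
        \<le> (f x)\<^sup>2 * p x - p x + 18 * (s\<^sup>2 * p x + (u x)\<^sup>2 * p x + (u x)\<^sup>2 * max 0 (ln ((u x)\<^sup>2)) * p x)"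
        by (simp add: algebra_simps)
    qed (use if0 iu0 ifl iul integrable_p in auto)
    also have "\<dots> = 18 * (s\<^sup>2 + s + E)"
      using if0 iu0 iul integrable_p f1 integral_p by (simp add: E_def s_def)
    also have "\<dots> \<le> 18 * (2 * (CP * I) + CE * (CP * I + I))"
    proof -
      have "s\<^sup>2 \<le> s" using s0 s1 by (simp add: power2_eq_square mult_left_le_one_le)
      moreover have "CE * (s + I) \<le> CE * (CP * I + I)" using CE sI by (intro mult_left_mono) auto
      ultimately show ?thesis using sI E_le by simp
    qed
    also have "\<dots> \<le> C * I" using I by (simp add: C_def algebra_simps)
    finally show "(\<integral>x. (f x)\<^sup>2 * ln ((f x)\<^sup>2) * p x \<partial>lborel) \<le> C * (\<integral>x. (norm (D x))\<^sup>2 * p x \<partial>lborel)"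
      by (simp add: I_def)
  qed
qed

end

section \<open>Potentials that are uniformly convex at infinity\<close>

text \<open>\<open>H x\<close> is the Hessian at \<open>x\<close> as a linear map, bounded by \<open>\<Lambda>\<close> everywhere and at least \<open>K\<close> outside the
ball of radius \<open>R\<close>.\<close>

locale potential_convex_at_infinity =
  fixes V :: "'a::euclidean_space \<Rightarrow> real" and g :: "'a \<Rightarrow> 'a" and H :: "'a \<Rightarrow> 'a \<Rightarrow> 'a"
    and K \<Lambda> R :: real
  assumes GDERIV_V: "\<And>x. GDERIV V x :> g x"
    and g_deriv: "\<And>x. (g has_derivative H x) (at x)"
    and norm_H_le: "\<And>x h. norm (H x h) \<le> \<Lambda> * norm h"
    and H_lower: "\<And>x h. norm x > R \<Longrightarrow> K * (norm h)\<^sup>2 \<le> h \<bullet> H x h"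
    and K_pos: "K > 0" and \<Lambda>_nonneg: "\<Lambda> \<ge> 0" and R_nonneg: "R \<ge> 0"
begin

lemma continuous_g: "continuous_on UNIV g"
  using g_deriv by (auto intro!: has_derivative_continuous_on)

lemma continuous_V: "continuous_on UNIV V"
  by (rule continuous_on_GDERIV[OF GDERIV_V])

lemma g_lipschitz: "norm (g x - g y) \<le> \<Lambda> * norm (x - y)"
  by (rule differentiable_bound[of UNIV g H])
     (use g_deriv norm_H_le in \<open>auto intro!: onorm_le\<close>)

text \<open>The total loss of convexity along a line, per unit of \<open>|x|\<close>: the Hessian falls short of \<open>K\<close> by at
most \<open>K + \<Lambda>\<close>, and \<open>(1 + R\<^sup>2) \<pi>\<close> is the integral of \<open>(1 + R\<^sup>2) / (1 + \<tau>\<^sup>2)\<close> over the line, which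
dominates the indicator of \<open>[-R, R]\<close>.\<close>

definition "\<kappa> = (K + \<Lambda>) * (1 + R\<^sup>2) * pi"

lemma \<kappa>_nonneg: "\<kappa> \<ge> 0"
  using K_pos \<Lambda>_nonneg by (simp add: \<kappa>_def)

text \<open>Along the segment from \<open>-z\<close> to \<open>x - z\<close>, the derivative of \<open>x \<bullet> g\<close> is at least \<open>K |x|\<^sup>2\<close> except
where the point lies in the ball of radius \<open>R\<close>. There its projection \<open>\<tau>\<close> on the direction of \<open>x\<close>
lies in \<open>[-R, R]\<close>, and the derivative of a multiple of \<open>arctan \<tau>\<close> makes up for the defect. Since
\<open>arctan\<close> is bounded, the correction is uniform in \<open>z\<close>.\<close>

lemma gradient_increment_lower:
  "K * (norm x)\<^sup>2 - \<kappa> * norm x \<le> x \<bullet> (g (x - z) - g (- z))"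
proof (cases "x = 0")
  case False
  define n where "n = norm x"
  have n: "n > 0" using False by (simp add: n_def)
  define \<tau> where "\<tau> s = ((s *\<^sub>R x - z) \<bullet> x) / n" for s
  define c where "c = (K + \<Lambda>) * n * (1 + R\<^sup>2)"
  have c: "c \<ge> 0" using K_pos \<Lambda>_nonneg n by (simp add: c_def)
  define \<phi> where "\<phi> s = x \<bullet> g (s *\<^sub>R x - z) - K * n\<^sup>2 * s + c * arctan (\<tau> s)" for s
  have "\<phi> 0 \<le> \<phi> 1"
  proof (rule DERIV_nonneg_imp_nondecreasing[where f = \<phi>])
    fix s :: real
    define y where "y = s *\<^sub>R x - z"
    have d1: "((\<lambda>s. x \<bullet> g (s *\<^sub>R x - z)) has_real_derivative x \<bullet> H y x) (at s)"
    proof -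
      have "((\<lambda>s. g (s *\<^sub>R x - z)) has_derivative (\<lambda>t. H y (t *\<^sub>R x))) (at s)"
        by (rule has_derivative_compose[of "\<lambda>s. s *\<^sub>R x - z" _ _ _ g])
           (use g_deriv[of y] in \<open>auto intro!: derivative_eq_intros simp: y_def\<close>)
      then have "((\<lambda>s. x \<bullet> g (s *\<^sub>R x - z)) has_derivative (\<lambda>t. x \<bullet> H y (t *\<^sub>R x))) (at s)"
        by (rule has_derivative_inner_right)
      then show ?thesis
        by (rule has_derivative_imp_has_field_derivative)
           (simp add: linear_cmul[OF has_derivative_linear[OF g_deriv]])
    qed
    have tau: "\<tau> = (\<lambda>s. s * n - (z \<bullet> x) / n)"
      using n by (simp add: fun_eq_iff \<tau>_def inner_diff_left n_def dot_square_norm diff_divide_distrib power2_eq_square)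
    have d2: "(\<tau> has_real_derivative n) (at s)"
      unfolding tau by (auto intro!: derivative_eq_intros)
    have "(\<phi> has_real_derivative x \<bullet> H y x - K * n\<^sup>2 + c * (n / (1 + (\<tau> s)\<^sup>2))) (at s)"
      unfolding \<phi>_def
      by (rule derivative_eq_intros d1 DERIV_chain2[OF DERIV_arctan d2] refl)+ (simp add: divide_inverse mult.commute)
    moreover have "0 \<le> x \<bullet> H y x - K * n\<^sup>2 + c * (n / (1 + (\<tau> s)\<^sup>2))"
    proof (cases "norm y > R")
      case True
      have "0 \<le> c * (n / (1 + (\<tau> s)\<^sup>2))" using c n by (simp add: add_pos_nonneg)
      with H_lower[OF True, of x] show ?thesis by (simp add: n_def)
    next
      case False
      have "\<bar>\<tau> s\<bar> \<le> norm y"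
        using Cauchy_Schwarz_ineq2[of y x] n by (simp add: \<tau>_def y_def[symmetric] n_def[symmetric] pos_divide_le_eq)
      then have "(\<tau> s)\<^sup>2 \<le> R\<^sup>2" using False by (metis abs_ge_zero linorder_not_less order_trans power2_abs power_mono)
      then have "1 \<le> (1 + R\<^sup>2) / (1 + (\<tau> s)\<^sup>2)" by (simp add: add_pos_nonneg)
      then have "(K + \<Lambda>) * n\<^sup>2 * 1 \<le> (K + \<Lambda>) * n\<^sup>2 * ((1 + R\<^sup>2) / (1 + (\<tau> s)\<^sup>2))"
        using K_pos \<Lambda>_nonneg by (intro mult_left_mono) auto
      also have "\<dots> = c * (n / (1 + (\<tau> s)\<^sup>2))" by (simp add: c_def power2_eq_square mult_ac)
      finally have "(K + \<Lambda>) * n\<^sup>2 \<le> c * (n / (1 + (\<tau> s)\<^sup>2))" by simp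
      moreover have "- (\<Lambda> * n\<^sup>2) \<le> x \<bullet> H y x"
        using Cauchy_Schwarz_ineq2[of x "H y x"] mult_left_mono[OF norm_H_le[of y x] norm_ge_zero[of x]]
        by (simp add: n_def power2_eq_square mult_ac)
      ultimately show ?thesis by (simp add: distrib_right)
    qed
    ultimately show "\<exists>y. (\<phi> has_real_derivative y) (at s) \<and> 0 \<le> y" by blast
  qed simp
  moreover have "c * (arctan (\<tau> 1) - arctan (\<tau> 0)) \<le> c * pi"
    using c arctan_bounded[of "\<tau> 1"] arctan_bounded[of "\<tau> 0"] by (intro mult_left_mono) auto
  moreover have "c * pi = \<kappa> * n" by (simp add: c_def \<kappa>_def)
  ultimately show ?thesis
    by (simp add: \<phi>_def n_def[symmetric] inner_diff_right right_diff_distrib)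
qed simp

lemma V_lower: "V 0 + K / 2 * (norm x)\<^sup>2 - (\<kappa> + norm (g 0)) * norm x \<le> V x"
proof -
  define n where "n = norm x"
  define c where "c = (\<kappa> + norm (g 0)) * n"
  have "V (0 *\<^sub>R x) - K / 2 * n\<^sup>2 * 0\<^sup>2 + c * 0 \<le> V (1 *\<^sub>R x) - K / 2 * n\<^sup>2 * 1\<^sup>2 + c * 1"
  proof (rule DERIV_nonneg_imp_nondecreasing[where f = "\<lambda>t. V (t *\<^sub>R x) - K / 2 * n\<^sup>2 * t\<^sup>2 + c * t"])
    fix t :: real assume t: "0 \<le> t" "t \<le> 1"
    have "((\<lambda>t. V (t *\<^sub>R x) - K / 2 * n\<^sup>2 * t\<^sup>2 + c * t) has_real_derivative x \<bullet> g (t *\<^sub>R x) - K * n\<^sup>2 * t + c) (at t)"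
      by (auto intro!: derivative_eq_intros has_real_derivative_along_ray GDERIV_V)
    moreover have "0 \<le> x \<bullet> g (t *\<^sub>R x) - K * n\<^sup>2 * t + c"
    proof -
      have x0: "- (norm (g 0) * n) \<le> x \<bullet> g 0"
        using Cauchy_Schwarz_ineq2[of x "g 0"] by (simp add: n_def mult.commute)
      show ?thesis
      proof (cases "t = 0")
        case True
        have "0 \<le> \<kappa> * n" using \<kappa>_nonneg by (simp add: n_def)
        with x0 True show ?thesis by (simp add: c_def distrib_right)
      next
        case False
        with t have t: "t > 0" by simp
        have "t * (K * n\<^sup>2 * t - \<kappa> * n) \<le> t * (x \<bullet> (g (t *\<^sub>R x) - g 0))"
          using gradient_increment_lower[of "t *\<^sub>R x" 0] t
          by (simp add: n_def power_mult_distrib power2_eq_square algebra_simps)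
        then have "K * n\<^sup>2 * t - \<kappa> * n \<le> x \<bullet> (g (t *\<^sub>R x) - g 0)"
          using t by (rule mult_left_le_imp_le)
        with x0 show ?thesis by (simp add: inner_diff_right c_def distrib_right)
      qed
    qed
    ultimately show "\<exists>y. ((\<lambda>t. V (t *\<^sub>R x) - K / 2 * n\<^sup>2 * t\<^sup>2 + c * t) has_real_derivative y) (at t) \<and> 0 \<le> y"
      by blast
  qed simp
  then show ?thesis by (simp add: c_def n_def)
qed

text \<open>The density of \<open>e\<^sup>-\<^sup>V dx\<close> and, below, its gradient.\<close>

definition "q x = exp (- V x)"

definition "Q x = - q x *\<^sub>R g x"

lemma q_pos: "q x > 0" by (simp add: q_def)

lemma continuous_q: "continuous_on UNIV q"
  unfolding q_def by (intro continuous_intros continuous_V)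

lemma GDERIV_q: "GDERIV q x :> Q x"
  using GDERIV_DERIV_compose[OF GDERIV_minus[OF GDERIV_V] DERIV_exp, of x]
  by (simp add: q_def[abs_def] Q_def)

lemma q_decay: obtains M where "M > 0" "\<And>x. (1 + norm x)\<^sup>2 * q x \<le> M"
proof (rule that)
  define c where "c = \<kappa> + norm (g 0) + 2"
  fix x :: 'a
  define n where "n = norm x"
  have "(1 + n)\<^sup>2 \<le> (exp n)\<^sup>2" by (intro power_mono exp_ge_add_one_self) (simp add: n_def)
  also have "\<dots> = exp (2 * n)" by (simp add: exp_double)
  finally have "(1 + n)\<^sup>2 * q x \<le> exp (2 * n) * q x" using q_pos[of x] by (intro mult_right_mono) auto
  also have "\<dots> = exp (2 * n - V x)" by (simp add: q_def exp_diff exp_minus divide_inverse)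
  also have "\<dots> \<le> exp (c\<^sup>2 / (2 * K) - V 0)"
  proof -
    have "0 \<le> (K * n - c)\<^sup>2 / (2 * K)" using K_pos by simp
    also have "\<dots> = K / 2 * n\<^sup>2 - c * n + c\<^sup>2 / (2 * K)"
      using K_pos by (simp add: power2_eq_square field_simps)
    finally have "c * n - K / 2 * n\<^sup>2 \<le> c\<^sup>2 / (2 * K)" by simp
    with V_lower[of x] show ?thesis by (simp add: n_def[symmetric] c_def distrib_right)
  qed
  finally show "(1 + norm x)\<^sup>2 * q x \<le> exp (c\<^sup>2 / (2 * K) - V 0)" by (simp add: n_def)
qed simp

text \<open>The Hessian of \<open>q\<close> is \<open>q\<close> times a quadratic expression in \<open>g\<close> plus \<open>q\<close> times the Hessian of \<open>V\<close>, and the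
decay of \<open>q\<close> beats the growth of both. The uniform second order bounds allow differentiation under
the integral sign in the convolution.\<close>

lemma q_second_order:
  obtains M where "M > 0" "\<And>x. q x \<le> M" "\<And>x. norm (Q x) \<le> M"
    "\<And>x y. norm (Q x - Q y) \<le> M * norm (x - y)"
    "\<And>x h. \<bar>q (x + h) - q x - h \<bullet> Q x\<bar> \<le> M * (norm h)\<^sup>2"
proof -
  obtain M0 where M0: "M0 > 0" "\<And>x. (1 + norm x)\<^sup>2 * q x \<le> M0"
    using q_decay by blast
  define \<Gamma> where "\<Gamma> = norm (g 0) + \<Lambda>"
  have \<Gamma>: "\<Gamma> \<ge> 0" using \<Lambda>_nonneg by (simp add: \<Gamma>_def)
  have g_le: "norm (g x) \<le> \<Gamma> * (1 + norm x)" for x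
  proof -
    have "norm (g x) \<le> norm (g 0) + \<Lambda> * norm x"
      using g_lipschitz[of x 0] norm_triangle_sub[of "g x" "g 0"] by simp
    also have "\<dots> \<le> \<Gamma> * (1 + norm x)" using \<Lambda>_nonneg by (simp add: \<Gamma>_def algebra_simps)
    finally show ?thesis .
  qed
  have poly: "(1 + norm x) ^ k * q x \<le> M0" if "k \<le> 2" for k x
  proof -
    have "(1 + norm x) ^ k * q x \<le> (1 + norm x)\<^sup>2 * q x"
      using that q_pos[of x] by (intro mult_right_mono power_increasing) auto
    with M0(2)[of x] show ?thesis by linarith
  qed
  define M where "M = M0 * (1 + \<Gamma> + \<Lambda> + \<Gamma>\<^sup>2)"
  have le: "M0 * s \<le> M" if "s \<le> 1 + \<Gamma> + \<Lambda> + \<Gamma>\<^sup>2" for s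
    unfolding M_def using M0(1) that by (intro mult_left_mono) auto
  have q_le: "q x \<le> M" for x
    using poly[of 0 x] le[of 1] \<Gamma> \<Lambda>_nonneg by simp
  have Q_le: "norm (Q x) \<le> M" for x
  proof -
    have "norm (Q x) \<le> q x * (\<Gamma> * (1 + norm x))"
      using q_pos[of x] g_le[of x] by (simp add: Q_def mult_left_mono)
    also have "\<dots> = ((1 + norm x) ^ 1 * q x) * \<Gamma>" by simp
    also have "\<dots> \<le> M0 * \<Gamma>" using \<Gamma> by (intro mult_right_mono poly) auto
    also have "\<dots> \<le> M" using \<Lambda>_nonneg by (intro le) auto
    finally show ?thesis .
  qed
  define Q' where "Q' x h = - (q x *\<^sub>R H x h + (h \<bullet> Q x) *\<^sub>R g x)" for x h
  have Q_deriv: "(Q has_derivative Q' x) (at x)" for x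
    unfolding Q_def[abs_def]
    by (rule derivative_eq_intros GDERIV_q[unfolded gderiv_def] g_deriv refl)+
       (simp add: fun_eq_iff Q'_def)
  have Q'_le: "norm (Q' x h) \<le> M * norm h" for x h
  proof -
    have "norm (Q' x h) \<le> q x * norm (H x h) + \<bar>h \<bullet> Q x\<bar> * norm (g x)"
      unfolding Q'_def norm_minus_cancel
      using norm_triangle_ineq[of "q x *\<^sub>R H x h" "(h \<bullet> Q x) *\<^sub>R g x"] q_pos[of x] by simp
    also have "\<dots> \<le> q x * (\<Lambda> * norm h) + (norm h * (q x * norm (g x))) * norm (g x)"
      using Cauchy_Schwarz_ineq2[of h "Q x"] q_pos[of x] norm_H_le[of x h]
      by (intro add_mono mult_left_mono mult_right_mono) (auto simp: Q_def)
    also have "\<dots> = norm h * (\<Lambda> * ((1 + norm x) ^ 0 * q x)) + norm h * (q x * (norm (g x))\<^sup>2)"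
      by (simp add: power2_eq_square)
    also have "\<dots> \<le> norm h * (\<Lambda> * M0) + norm h * (M0 * \<Gamma>\<^sup>2)"
    proof (intro add_mono mult_left_mono poly)
      have "q x * (norm (g x))\<^sup>2 \<le> q x * (\<Gamma> * (1 + norm x))\<^sup>2"
        using q_pos[of x] g_le[of x] by (intro mult_left_mono power_mono) auto
      also have "\<dots> = ((1 + norm x)\<^sup>2 * q x) * \<Gamma>\<^sup>2" by (simp add: power_mult_distrib)
      also have "\<dots> \<le> M0 * \<Gamma>\<^sup>2" by (intro mult_right_mono M0) auto
      finally show "q x * (norm (g x))\<^sup>2 \<le> M0 * \<Gamma>\<^sup>2" .
    qed (use \<Lambda>_nonneg in auto)
    also have "\<dots> = norm h * (M0 * (\<Lambda> + \<Gamma>\<^sup>2))" by (simp add: algebra_simps)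
    also have "\<dots> \<le> norm h * M" using \<Gamma> by (intro mult_left_mono le) auto
    finally show ?thesis by (simp add: mult.commute)
  qed
  have Q_lip: "norm (Q x - Q y) \<le> M * norm (x - y)" for x y
    by (rule differentiable_bound[of UNIV Q Q']) (use Q_deriv Q'_le in \<open>auto intro!: onorm_le\<close>)
  have q_taylor: "\<bar>q (x + h) - q x - h \<bullet> Q x\<bar> \<le> M * (norm h)\<^sup>2" for x h
  proof -
    have "norm (q (x + h) - q x - (x + h - x) \<bullet> Q x) \<le> norm (x + h - x) * (M * norm h)"
    proof (rule differentiable_bound_linearization[where S = "cball x (norm h)" and f' = "\<lambda>y k. k \<bullet> Q y"])
      show "x + t *\<^sub>R (x + h - x) \<in> cball x (norm h)" if "t \<in> {0..1}" for t
        using that by (auto simp: dist_norm mult_left_le_one_le)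
      show "(q has_derivative (\<lambda>k. k \<bullet> Q y)) (at y within cball x (norm h))" for y
        using GDERIV_q[of y] unfolding gderiv_def by (rule has_derivative_at_withinI)
      show "onorm ((\<lambda>k. k \<bullet> Q y) - (\<lambda>k. k \<bullet> Q x)) \<le> M * norm h" if "y \<in> cball x (norm h)" for y
      proof (rule onorm_le)
        fix k
        have "norm (((\<lambda>k. k \<bullet> Q y) - (\<lambda>k. k \<bullet> Q x)) k) = \<bar>k \<bullet> (Q y - Q x)\<bar>"
          by (simp add: inner_diff_right)
        also have "\<dots> \<le> norm k * norm (Q y - Q x)" by (rule Cauchy_Schwarz_ineq2)
        also have "\<dots> \<le> norm k * (M * norm (y - x))" by (intro mult_left_mono Q_lip) auto
        also have "\<dots> \<le> norm k * (M * norm h)"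
          using that q_le[of 0] q_pos[of 0]
          by (intro mult_left_mono) (auto simp: dist_norm norm_minus_commute)
        finally show "norm (((\<lambda>k. k \<bullet> Q y) - (\<lambda>k. k \<bullet> Q x)) k) \<le> M * norm h * norm k"
          by (simp add: mult_ac)
      qed
    qed auto
    then show ?thesis by (simp add: power2_eq_square mult_ac)
  qed
  have "M > 0" using q_le[of 0] q_pos[of 0] by linarith
  from that[OF this q_le Q_le Q_lip q_taylor] show thesis .
qed

end

section \<open>The density of the convolution\<close>

locale smoothed_density = potential_convex_at_infinity V g H K \<Lambda> R + prob_space \<nu>
  for V :: "'a::euclidean_space \<Rightarrow> real" and g H K \<Lambda> R and \<nu> :: "'a measure" +
  assumes sets_\<nu> [measurable_cong]: "sets \<nu> = sets borel"
    and nn_integral_q: "(\<integral>\<^sup>+x. ennreal (q x) \<partial>lborel) = 1"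
begin

definition "p x = (\<integral>z. q (x - z) \<partial>\<nu>)"

definition "G x = (\<integral>z. Q (x - z) \<partial>\<nu>)"

lemma borel_measurable_q [measurable]: "q \<in> borel_measurable borel"
  using continuous_q by (rule borel_measurable_continuous_onI)

lemma borel_measurable_g [measurable]: "g \<in> borel_measurable borel"
  using continuous_g by (rule borel_measurable_continuous_onI)

lemma borel_measurable_Q [measurable]: "Q \<in> borel_measurable borel"
  unfolding Q_def[abs_def] by measurable

lemma integrable_q: "integrable \<nu> (\<lambda>z. q (x - z))"
proof -
  obtain M where "\<And>x. q x \<le> M" using q_second_order by metis
  then show ?thesis using q_pos by (intro integrable_const_bound[of _ M]) (auto simp: less_imp_le)
qed

lemma integrable_Q: "integrable \<nu> (\<lambda>z. Q (x - z))"
proof -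
  obtain M where "\<And>x. norm (Q x) \<le> M" using q_second_order by metis
  then show ?thesis by (intro integrable_const_bound[of _ M]) auto
qed

lemma p_pos: "p x > 0"
proof -
  have "p x \<noteq> 0"
  proof
    assume "p x = 0"
    then have "AE z in \<nu>. q (x - z) = 0"
      unfolding p_def using integrable_q q_pos
      by (subst (asm) integral_nonneg_eq_0_iff_AE) (auto simp: less_imp_le)
    then have "AE z in \<nu>. False"
      by eventually_elim (use q_pos less_irrefl in metis)
    then show False by simp
  qed
  moreover have "p x \<ge> 0" unfolding p_def using q_pos by (intro integral_nonneg_AE) (auto simp: less_imp_le)
  ultimately show ?thesis by simp
qed

lemma nn_integral_q_shift: "(\<integral>\<^sup>+z. ennreal (q (x - z)) \<partial>\<nu>) = ennreal (p x)"
  unfolding p_def using integrable_q q_pos by (intro nn_integral_eq_integral) (auto simp: less_imp_le)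

text \<open>The Taylor remainder of \<open>q\<close> is at most \<open>M |h|\<^sup>2\<close> uniformly in the base point, hence so is that of
its average \<open>p\<close>.\<close>

lemma GDERIV_p: "GDERIV p x :> G x"
proof -
  obtain M where M: "\<And>x h. \<bar>q (x + h) - q x - h \<bullet> Q x\<bar> \<le> M * (norm h)\<^sup>2"
    using q_second_order by metis
  have taylor: "\<bar>p y - p x - (y - x) \<bullet> G x\<bar> \<le> M * (norm (y - x))\<^sup>2" for y
  proof -
    have eq: "p y - p x - (y - x) \<bullet> G x = (\<integral>z. q (y - z) - q (x - z) - (y - x) \<bullet> Q (x - z) \<partial>\<nu>)"
      unfolding p_def G_def using integrable_q integrable_Q
      by (simp add: integral_inner_right)
    have "\<bar>p y - p x - (y - x) \<bullet> G x\<bar> \<le> (\<integral>z. \<bar>q (y - z) - q (x - z) - (y - x) \<bullet> Q (x - z)\<bar> \<partial>\<nu>)"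
      unfolding eq by (rule integral_abs_bound)
    also have "\<dots> \<le> (\<integral>z. M * (norm (y - x))\<^sup>2 \<partial>\<nu>)"
    proof (rule integral_mono)
      show "integrable \<nu> (\<lambda>z. \<bar>q (y - z) - q (x - z) - (y - x) \<bullet> Q (x - z)\<bar>)"
        by (rule integrable_abs[OF Bochner_Integration.integrable_diff[OF
              Bochner_Integration.integrable_diff[OF integrable_q integrable_q] integrable_inner_right[OF integrable_Q]]])
      show "\<bar>q (y - z) - q (x - z) - (y - x) \<bullet> Q (x - z)\<bar> \<le> M * (norm (y - x))\<^sup>2" for z
      proof -
        have e: "x - z + (y - x) = y - z" by simp
        show ?thesis using M[of "x - z" "y - x"] unfolding e .
      qed
      show "integrable \<nu> (\<lambda>z. M * (norm (y - x))\<^sup>2)" by (rule integrable_const)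
    qed
    also have "\<dots> = M * (norm (y - x))\<^sup>2" by (simp add: prob_space)
    finally show ?thesis .
  qed
  show ?thesis
    unfolding gderiv_def
  proof (rule has_derivativeI_sandwich[of 1 _ _ _ _ "\<lambda>y. M * norm (y - x)"])
    show "bounded_linear (\<lambda>h. h \<bullet> G x)" by (rule bounded_linear_inner_left)
    show "norm (p y - p x - (y - x) \<bullet> G x) / norm (y - x) \<le> M * norm (y - x)" if "y \<noteq> x" for y
      using taylor[of y] that by (simp add: pos_divide_le_eq power2_eq_square mult.assoc)
    have "((\<lambda>y. M * norm (y - x)) \<longlongrightarrow> M * norm (x - x)) (at x)" by (intro tendsto_intros)
    then show "((\<lambda>y. M * norm (y - x)) \<longlongrightarrow> 0) (at x)" by simp
  qed simp
qed

lemma continuous_G: "continuous_on UNIV G"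
proof -
  obtain M where M0: "M > 0" and M: "\<And>x y. norm (Q x - Q y) \<le> M * norm (x - y)"
    using q_second_order by metis
  have lip: "norm (G x - G y) \<le> M * norm (x - y)" for x y
  proof -
    have "norm (G x - G y) = norm (\<integral>z. Q (x - z) - Q (y - z) \<partial>\<nu>)"
      unfolding G_def using integrable_Q by simp
    also have "\<dots> \<le> (\<integral>z. norm (Q (x - z) - Q (y - z)) \<partial>\<nu>)" by (rule integral_norm_bound)
    also have "\<dots> \<le> (\<integral>z. M * norm (x - y) \<partial>\<nu>)"
    proof (rule integral_mono)
      show "norm (Q (x - z) - Q (y - z)) \<le> M * norm (x - y)" for z
        using M[of "x - z" "y - z"] by simp
    qed (use integrable_Q in auto)
    also have "\<dots> = M * norm (x - y)" by (simp add: prob_space)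
    finally show ?thesis .
  qed
  have "M-lipschitz_on UNIV G"
    using lip M0 by (intro lipschitz_onI) (auto simp: dist_norm)
  then show ?thesis by (rule lipschitz_on_continuous_on)
qed

lemma continuous_p: "continuous_on UNIV p"
  by (rule continuous_on_GDERIV[OF GDERIV_p])

lemma nn_integral_convolution_q:
  assumes [measurable]: "F \<in> borel_measurable borel"
  shows "(\<integral>\<^sup>+x. ennreal (q x) * (\<integral>\<^sup>+z. F (x + z) \<partial>\<nu>) \<partial>lborel) = (\<integral>\<^sup>+x. ennreal (p x) * F x \<partial>lborel)"
proof -
  interpret P: pair_sigma_finite lborel \<nu> ..
  have "(\<integral>\<^sup>+x. ennreal (q x) * (\<integral>\<^sup>+z. F (x + z) \<partial>\<nu>) \<partial>lborel)
      = (\<integral>\<^sup>+x. (\<integral>\<^sup>+z. ennreal (q x) * F (x + z) \<partial>\<nu>) \<partial>lborel)"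
    by (subst nn_integral_cmult) auto
  also have "\<dots> = (\<integral>\<^sup>+z. (\<integral>\<^sup>+x. ennreal (q x) * F (x + z) \<partial>lborel) \<partial>\<nu>)"
    by (rule P.Fubini'[symmetric]) measurable
  also have "\<dots> = (\<integral>\<^sup>+z. (\<integral>\<^sup>+x. ennreal (q (x - z)) * F x \<partial>lborel) \<partial>\<nu>)"
  proof (rule nn_integral_cong)
    fix z :: 'a
    show "(\<integral>\<^sup>+x. ennreal (q x) * F (x + z) \<partial>lborel) = (\<integral>\<^sup>+x. ennreal (q (x - z)) * F x \<partial>lborel)"
      using nn_integral_lborel_affine_euclidean[of "\<lambda>x. ennreal (q (x - z)) * F x" 1 z]
      by (simp add: add.commute)
  qed
  also have "\<dots> = (\<integral>\<^sup>+x. (\<integral>\<^sup>+z. ennreal (q (x - z)) * F x \<partial>\<nu>) \<partial>lborel)"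
    by (rule P.Fubini') measurable
  also have "\<dots> = (\<integral>\<^sup>+x. ennreal (p x) * F x \<partial>lborel)"
    by (subst nn_integral_multc) (auto simp: nn_integral_q_shift)
  finally show ?thesis .
qed

lemma nn_integral_p: "(\<integral>\<^sup>+x. ennreal (p x) \<partial>lborel) = 1"
  using nn_integral_convolution_q[of "\<lambda>_. 1"] nn_integral_q by (simp add: emeasure_space_1)

text \<open>At a point where the weighted mean of \<open>|\<nabla>V(-z)|\<close> is at most \<open>K' |x|\<close>, both bounds follow by
averaging: the first from the Lipschitz bound for \<open>g\<close>, the second from the lower bound on its radial
increment.\<close>

lemma
  assumes K'_nonneg: "0 \<le> K'"
    and mean_gradient_le: "(\<integral>\<^sup>+z. ennreal (norm (g (- z)) * q (x - z)) \<partial>\<nu>) \<le> ennreal (K' * norm x * p x)"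
  shows norm_G_le_far: "norm (G x) \<le> (K' + \<Lambda>) * norm x * p x"
    and drift_far: "x \<bullet> G x \<le> (\<kappa> * norm x - (K - K') * (norm x)\<^sup>2) * p x"
proof -
  have int_g: "integrable \<nu> (\<lambda>z. norm (g (- z)) * q (x - z))"
    using mean_gradient_le q_pos
    by (intro integrableI_nonneg) (auto simp: less_imp_le top_unique intro: le_less_trans[OF _ ennreal_less_top])
  have g_le: "(\<integral>z. norm (g (- z)) * q (x - z) \<partial>\<nu>) \<le> K' * norm x * p x"
  proof -
    have "ennreal (\<integral>z. norm (g (- z)) * q (x - z) \<partial>\<nu>) \<le> ennreal (K' * norm x * p x)"
      using mean_gradient_le q_pos int_g
      by (subst nn_integral_eq_integral[symmetric]) (auto simp: less_imp_le)
    moreover have "0 \<le> K' * norm x * p x" using K'_nonneg p_pos[of x] by simp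
    ultimately show ?thesis by (simp add: ennreal_le_iff)
  qed
  have "norm (G x) \<le> (\<integral>z. norm (Q (x - z)) \<partial>\<nu>)" unfolding G_def by (rule integral_norm_bound)
  also have "\<dots> \<le> (\<integral>z. norm (g (- z)) * q (x - z) + \<Lambda> * norm x * q (x - z) \<partial>\<nu>)"
  proof (rule integral_mono)
    fix z
    have "norm (g (x - z)) \<le> norm (g (- z)) + \<Lambda> * norm x"
      using g_lipschitz[of "x - z" "- z"] norm_triangle_sub[of "g (x - z)" "g (- z)"] by simp
    then show "norm (Q (x - z)) \<le> norm (g (- z)) * q (x - z) + \<Lambda> * norm x * q (x - z)"
      using q_pos[of "x - z"] mult_right_mono[of "norm (g (x - z))" _ "q (x - z)"]
      by (simp add: Q_def distrib_right[symmetric] mult.commute)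
  qed (use integrable_Q integrable_q int_g in auto)
  also have "\<dots> = (\<integral>z. norm (g (- z)) * q (x - z) \<partial>\<nu>) + \<Lambda> * norm x * p x"
    using int_g integrable_q by (simp add: p_def)
  also have "\<dots> \<le> (K' + \<Lambda>) * norm x * p x" using g_le by (simp add: algebra_simps)
  finally show "norm (G x) \<le> (K' + \<Lambda>) * norm x * p x" .
  have "x \<bullet> G x = (\<integral>z. x \<bullet> Q (x - z) \<partial>\<nu>)"
    unfolding G_def using integrable_Q by (simp add: integral_inner_right)
  also have "\<dots> \<le> (\<integral>z. norm x * (norm (g (- z)) * q (x - z)) + (\<kappa> * norm x - K * (norm x)\<^sup>2) * q (x - z) \<partial>\<nu>)"
  proof (rule integral_mono)
    fix z
    have "- (norm x * norm (g (- z))) \<le> x \<bullet> g (- z)"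
      using Cauchy_Schwarz_ineq2[of x "g (- z)"] by simp
    then have "K * (norm x)\<^sup>2 - \<kappa> * norm x - norm x * norm (g (- z)) \<le> x \<bullet> g (x - z)"
      using gradient_increment_lower[of x z] by (simp add: inner_diff_right)
    then have "(K * (norm x)\<^sup>2 - \<kappa> * norm x - norm x * norm (g (- z))) * q (x - z) \<le> (x \<bullet> g (x - z)) * q (x - z)"
      using q_pos[of "x - z"] by (intro mult_right_mono) auto
    then show "x \<bullet> Q (x - z) \<le> norm x * (norm (g (- z)) * q (x - z)) + (\<kappa> * norm x - K * (norm x)\<^sup>2) * q (x - z)"
      by (simp add: Q_def algebra_simps)
  qed (use integrable_Q integrable_q int_g in auto)
  also have "\<dots> = norm x * (\<integral>z. norm (g (- z)) * q (x - z) \<partial>\<nu>) + (\<kappa> * norm x - K * (norm x)\<^sup>2) * p x"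
    using int_g integrable_q by (simp add: p_def)
  also have "\<dots> \<le> norm x * (K' * norm x * p x) + (\<kappa> * norm x - K * (norm x)\<^sup>2) * p x"
    by (intro add_right_mono mult_left_mono g_le) auto
  also have "\<dots> = (\<kappa> * norm x - (K - K') * (norm x)\<^sup>2) * p x"
    by (simp add: power2_eq_square algebra_simps)
  finally show "x \<bullet> G x \<le> (\<kappa> * norm x - (K - K') * (norm x)\<^sup>2) * p x" .
qed

text \<open>Outside a compact ball this is the previous lemma. On the ball \<open>|G| / p\<close> is bounded by compactness,
and \<open>L\<close> and \<open>b\<close> are chosen to cover both regions; half of \<open>K - K'\<close> pays for the linear term
\<open>\<kappa> |x|\<close>.\<close>

lemma confined:
  assumes K'_nonneg: "0 \<le> K'" and K'_less: "K' < K"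
    and mean_gradient_le: "\<And>x. norm x \<ge> R' \<Longrightarrow>
      (\<integral>\<^sup>+z. ennreal (norm (g (- z)) * q (x - z)) \<partial>\<nu>) \<le> ennreal (K' * norm x * p x)"
  obtains L b where "confined_probability_density p G L ((K - K') / 2) b"
proof -
  define a where "a = (K - K') / 2"
  have a: "a > 0" using K'_less by (simp add: a_def)
  define S where "S = cball (0::'a) (max R' 1)"
  have "continuous_on S (\<lambda>x. norm (G x) / p x)"
    using p_pos by (intro continuous_intros continuous_on_subset[OF continuous_G] continuous_on_subset[OF continuous_p])
      (auto simp: less_le)
  then have "bounded ((\<lambda>x. norm (G x) / p x) ` S)"
    by (intro compact_imp_bounded compact_continuous_image) (auto simp: S_def)
  then obtain N where "\<And>x. x \<in> S \<Longrightarrow> norm (norm (G x) / p x) \<le> N"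
    unfolding bounded_iff by blast
  then have N: "norm (G x) / p x \<le> N" if "x \<in> S" for x
    using that by (metis abs_le_D1 real_norm_def)
  define L where "L = \<bar>N\<bar> + \<bar>K' + \<Lambda>\<bar> + 1"
  define b where "b = a * (max R' 1)\<^sup>2 + max R' 1 * \<bar>N\<bar> + \<kappa>\<^sup>2 / (4 * a)"
  have b0: "b \<ge> 0" using a by (simp add: b_def)
  have near: "norm (G x) \<le> \<bar>N\<bar> * p x" if "x \<in> S" for x
  proof -
    have "norm (G x) \<le> N * p x" using N[OF that] p_pos[of x] by (simp add: pos_divide_le_eq)
    also have "\<dots> \<le> \<bar>N\<bar> * p x" using p_pos[of x] by (intro mult_right_mono) auto
    finally show ?thesis .
  qed
  have "confined_probability_density p G L a b"
  proof
    fix x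
    show "GDERIV p x :> G x" by (rule GDERIV_p)
    show "0 < p x" by (rule p_pos)
    show "norm (G x) \<le> L * (1 + norm x) * p x"
    proof (cases "x \<in> S")
      case True
      have "\<bar>N\<bar> * 1 \<le> L * (1 + norm x)" by (intro mult_mono) (auto simp: L_def)
      then have "\<bar>N\<bar> * p x \<le> L * (1 + norm x) * p x" using p_pos[of x] by (intro mult_right_mono) auto
      with near[OF True] show ?thesis by linarith
    next
      case False
      then have "norm (G x) \<le> (K' + \<Lambda>) * norm x * p x" by (intro norm_G_le_far K'_nonneg mean_gradient_le) (auto simp: S_def)
      also have "\<dots> \<le> L * (1 + norm x) * p x"
        using p_pos[of x] by (intro mult_right_mono mult_mono) (auto simp: L_def)
      finally show ?thesis .
    qed
    show "x \<bullet> G x \<le> (b - a * (norm x)\<^sup>2) * p x"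
    proof (cases "x \<in> S")
      case True
      then have nx: "norm x \<le> max R' 1" by (simp add: S_def)
      have "x \<bullet> G x \<le> norm x * norm (G x)" using Cauchy_Schwarz_ineq2[of x "G x"] by linarith
      also have "\<dots> \<le> max R' 1 * (\<bar>N\<bar> * p x)" using nx near[OF True] by (intro mult_mono) auto
      also have "\<dots> = (max R' 1 * \<bar>N\<bar>) * p x" by simp
      also have "\<dots> \<le> (b - a * (norm x)\<^sup>2) * p x"
      proof (intro mult_right_mono)
        have "a * (norm x)\<^sup>2 \<le> a * (max R' 1)\<^sup>2" using a nx by (intro mult_left_mono power_mono) auto
        moreover have "0 \<le> \<kappa>\<^sup>2 / (4 * a)" using a by simp
        ultimately show "max R' 1 * \<bar>N\<bar> \<le> b - a * (norm x)\<^sup>2" by (simp add: b_def)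
      qed (use p_pos[of x] in simp)
      finally show ?thesis .
    next
      case False
      then have "x \<bullet> G x \<le> (\<kappa> * norm x - (K - K') * (norm x)\<^sup>2) * p x" by (intro drift_far K'_nonneg mean_gradient_le) (auto simp: S_def)
      also have "\<dots> \<le> (b - a * (norm x)\<^sup>2) * p x"
      proof (intro mult_right_mono)
        have "0 \<le> (2 * a * norm x - \<kappa>)\<^sup>2 / (4 * a)" using a by simp
        also have "\<dots> = a * (norm x)\<^sup>2 - \<kappa> * norm x + \<kappa>\<^sup>2 / (4 * a)"
          using a by (simp add: power2_eq_square field_simps)
        finally have "\<kappa> * norm x - a * (norm x)\<^sup>2 \<le> \<kappa>\<^sup>2 / (4 * a)" by simp
        moreover have "0 \<le> a * (max R' 1)\<^sup>2" "0 \<le> max R' 1 * \<bar>N\<bar>" using a by auto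
        moreover have "(K - K') * (norm x)\<^sup>2 = 2 * (a * (norm x)\<^sup>2)" by (simp add: a_def)
        ultimately show "\<kappa> * norm x - (K - K') * (norm x)\<^sup>2 \<le> b - a * (norm x)\<^sup>2"
          unfolding b_def by linarith
      qed (use p_pos[of x] in simp)
      finally show ?thesis .
    qed
  next
    have [measurable]: "p \<in> borel_measurable borel"
      using continuous_p by (rule borel_measurable_continuous_onI)
    show "continuous_on UNIV G" by (rule continuous_G)
    show "integrable lborel p"
      using nn_integral_p p_pos by (intro integrableI_nonneg) (auto simp: less_imp_le)
    then show "(\<integral>x. p x \<partial>lborel) = 1"
      using nn_integral_p p_pos by (simp add: integral_eq_nn_integral less_imp_le)
    show "L > 0" by (simp add: L_def add_nonneg_pos)
  qed (use a b0 in auto)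
  then show thesis using that by (simp add: a_def)
qed

end

section \<open>The logarithmic Sobolev inequality for the convolution\<close>

lemma norm_matrix_vector_mult_le:
  fixes A :: "real ^ 'n ^ 'n"
  shows "norm (A *v x) \<le> real CARD('n) * real CARD('n) * norm A * norm x"
proof -
  have "\<bar>A $ i $ j\<bar> \<le> norm A" for i j
    using Finite_Cartesian_Product.norm_nth_le[of "A $ i" j] Finite_Cartesian_Product.norm_nth_le[of A i]
    by simp
  then have "onorm ((*v) A) \<le> real CARD('n) * real CARD('n) * norm A"
    by (rule onorm_le_matrix_component)
  moreover have "norm (A *v x) \<le> onorm ((*v) A) * norm x"
    by (rule onorm[OF matrix_vector_mul_bounded_linear])
  ultimately show ?thesis
    by (meson mult_right_mono norm_ge_zero order_trans)
qed

lemma gibbs_convolution_eq_density: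
  fixes V :: "real ^ 'n \<Rightarrow> real"
  assumes V: "continuous_on UNIV V" and fin: "prob_space (gibbs V)" "prob_space \<nu>"
    and sets: "sets \<nu> = sets borel"
    and conv: "\<And>F. F \<in> borel_measurable borel \<Longrightarrow>
       (\<integral>\<^sup>+x. ennreal (exp (- V x)) * (\<integral>\<^sup>+z. F (x + z) \<partial>\<nu>) \<partial>lborel) = (\<integral>\<^sup>+x. ennreal (p x) * F x \<partial>lborel)"
    and p: "p \<in> borel_measurable borel"
  shows "gibbs V \<star> \<nu> = density lborel (\<lambda>x. ennreal (p x))"
proof (rule measure_eqI)
  note [measurable] = p borel_measurable_continuous_onI[OF V]
  note [measurable_cong] = sets
  interpret N: prob_space \<nu> by fact
  fix A assume "A \<in> sets (gibbs V \<star> \<nu>)"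
  then have [measurable]: "A \<in> sets borel" by simp
  have "emeasure (gibbs V \<star> \<nu>) A = (\<integral>\<^sup>+x. indicator A x \<partial>(gibbs V \<star> \<nu>))" by simp
  also have "\<dots> = (\<integral>\<^sup>+x. (\<integral>\<^sup>+z. indicator A (x + z) \<partial>\<nu>) \<partial>gibbs V)"
    using fin sets by (intro nn_integral_convolution) (auto simp: prob_space_def gibbs_def)
  also have "\<dots> = (\<integral>\<^sup>+x. ennreal (exp (- V x)) * (\<integral>\<^sup>+z. indicator A (x + z) \<partial>\<nu>) \<partial>lborel)"
    unfolding gibbs_def by (rule nn_integral_density) measurable
  also have "\<dots> = (\<integral>\<^sup>+x. ennreal (p x) * indicator A x \<partial>lborel)"
    by (rule conv) measurable
  also have "\<dots> = emeasure (density lborel (\<lambda>x. ennreal (p x))) A"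
    by (simp add: emeasure_density)
  finally show "emeasure (gibbs V \<star> \<nu>) A = emeasure (density lborel (\<lambda>x. ennreal (p x))) A" .
qed simp

lemma log_sobolev_confined_density:
  fixes p :: "real ^ 'n \<Rightarrow> real"
  assumes "confined_probability_density p G L a b"
  shows "log_sobolev (density lborel (\<lambda>x. ennreal (p x)))"
proof -
  interpret confined_probability_density p G L a b by fact
  have int: "(\<integral>x. h x \<partial>density lborel (\<lambda>x. ennreal (p x))) = (\<integral>x. h x * p x \<partial>lborel)"
    if [measurable]: "h \<in> borel_measurable borel" for h :: "real ^ 'n \<Rightarrow> real"
    using p_pos by (subst integral_density) (auto simp: less_imp_le mult.commute)
  obtain C where C: "C > 0" and lsi:
    "\<And>(f :: real ^ 'n \<Rightarrow> real) D B. (\<And>x. GDERIV f x :> D x) \<Longrightarrow> continuous_on UNIV D \<Longrightarrow> (\<And>x. \<bar>f x\<bar> \<le> B) \<Longrightarrow> (\<And>x. norm (D x) \<le> B) \<Longrightarrow>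
       (\<integral>x. (f x)\<^sup>2 * p x \<partial>lborel) = 1 \<Longrightarrow>
       (\<integral>x. (f x)\<^sup>2 * ln ((f x)\<^sup>2) * p x \<partial>lborel) \<le> C * (\<integral>x. (norm (D x))\<^sup>2 * p x \<partial>lborel)"
    using log_sobolev_inequality by blast
  show ?thesis
    unfolding log_sobolev_def
  proof (intro exI[of _ C] conjI ballI impI C)
    fix f :: "real ^ 'n \<Rightarrow> real"
    assume "f \<in> Cb1"
    then have f: "C1 f" "bounded (range f)" "bounded (range (gradient f))" by (auto simp: Cb1_def)
    assume f1: "(\<integral>x. (f x)\<^sup>2 \<partial>density lborel (\<lambda>x. ennreal (p x))) = 1"
    have der: "GDERIV f x :> gradient f x" for x
      using f(1) by (intro GDERIV_gradient) (simp add: C1_def)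
    have D: "continuous_on UNIV (gradient f)" using f(1) by (simp add: C1_def)
    have cf: "continuous_on UNIV f"
      by (rule continuous_on_GDERIV[OF der])
    note [measurable] = borel_measurable_continuous_onI[OF cf] borel_measurable_continuous_onI[OF D]
    obtain B1 where B1: "\<And>x. norm (f x) \<le> B1" using f(2) by (auto simp: bounded_iff)
    obtain B2 where B2: "\<And>x. norm (gradient f x) \<le> B2" using f(3) by (auto simp: bounded_iff)
    have "(\<integral>x. (f x)\<^sup>2 * ln ((f x)\<^sup>2) * p x \<partial>lborel) \<le> C * (\<integral>x. (norm (gradient f x))\<^sup>2 * p x \<partial>lborel)"
    proof (rule lsi[OF der D])
      show "\<bar>f x\<bar> \<le> max B1 B2" for x using B1[of x] by simp
      show "norm (gradient f x) \<le> max B1 B2" for x using B2[of x] by simp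
      show "(\<integral>x. (f x)\<^sup>2 * p x \<partial>lborel) = 1" using f1 by (subst (asm) int) auto
    qed
    then show "(\<integral>x. (f x)\<^sup>2 * ln ((f x)\<^sup>2) \<partial>density lborel (\<lambda>x. ennreal (p x)))
        \<le> C * (\<integral>x. (norm (gradient f x))\<^sup>2 \<partial>density lborel (\<lambda>x. ennreal (p x)))"
      by (subst (1 2) int) auto
  qed
qed

text \<open>A number strictly between the upper limit and \<open>K\<close> serves as \<open>K'\<close>; multiplying by the normalising
constant of the tilted measure and by \<open>|x|\<close> clears the denominators.\<close>

lemma mean_gradient_tilted_bound:
  fixes V :: "real ^ 'n \<Rightarrow> real"
  assumes lim: "Limsup at_infinity
      (\<lambda>x. (\<integral>\<^sup>+ z. ennreal (norm (g (- z))) \<partial>tilted V \<nu> x) / ennreal (norm x)) < ennreal K"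
    and V: "continuous_on UNIV V" and g: "g \<in> borel_measurable borel" and sets: "sets \<nu> = sets borel"
    and p: "\<And>x. p_conv V \<nu> x > 0"
  obtains K' R' where "0 \<le> K'" "K' < K"
    "\<And>x. norm x \<ge> R' \<Longrightarrow> (\<integral>\<^sup>+z. ennreal (norm (g (- z)) * exp (- V (x - z))) \<partial>\<nu>)
       \<le> ennreal (K' * norm x * p_conv V \<nu> x)"
proof -
  note [measurable] = g borel_measurable_continuous_onI[OF V]
  note [measurable_cong] = sets
  obtain c where c: "Limsup at_infinity
      (\<lambda>x. (\<integral>\<^sup>+ z. ennreal (norm (g (- z))) \<partial>tilted V \<nu> x) / ennreal (norm x)) < c" "c < ennreal K"
    using dense[OF lim] by blast
  then obtain K' where K': "c = ennreal K'" "K' \<ge> 0"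
    by (cases c) auto
  have "K' < K" using c(2) K' by (simp add: ennreal_less_iff)
  have "\<forall>\<^sub>F x in at_infinity. (\<integral>\<^sup>+ z. ennreal (norm (g (- z))) \<partial>tilted V \<nu> x) / ennreal (norm x) < c"
    using c(1) by (rule Limsup_lessD)
  then obtain R0 where R0: "\<And>x. norm x \<ge> R0 \<Longrightarrow>
      (\<integral>\<^sup>+ z. ennreal (norm (g (- z))) \<partial>tilted V \<nu> x) / ennreal (norm x) < c"
    by (auto simp: eventually_at_infinity)
  show thesis
  proof (rule that[OF K'(2) \<open>K' < K\<close>])
    fix x :: "real ^ 'n"
    assume "norm x \<ge> max R0 1"
    then have x: "norm x \<ge> R0" "norm x \<ge> 1" by auto
    define N where "N = (\<integral>\<^sup>+ z. ennreal (norm (g (- z))) \<partial>tilted V \<nu> x)"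
    define q where "q z = exp (- V (x - z))" for z
    have [measurable]: "q \<in> borel_measurable borel" unfolding q_def by measurable
    have "N / ennreal (norm x) \<le> c" using R0[OF x(1)] by (simp add: N_def less_imp_le)
    then have "N / ennreal (norm x) * ennreal (norm x) \<le> c * ennreal (norm x)" by (rule mult_right_mono) simp
    also have "N / ennreal (norm x) * ennreal (norm x) = N"
    proof -
      have "ennreal (norm x) \<noteq> 0" "ennreal (norm x) \<noteq> \<top>" using x by auto
      then show ?thesis by (metis ennreal_mult_divide_eq ennreal_times_divide mult.commute)
    qed
    finally have N: "N \<le> ennreal (K' * norm x)" using K' by (simp add: ennreal_mult)
    have "N = (\<integral>\<^sup>+z. ennreal (q z / p_conv V \<nu> x) * ennreal (norm (g (- z))) \<partial>\<nu>)"
      unfolding N_def tilted_def q_def by (rule nn_integral_density) measurable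
    then have "ennreal (p_conv V \<nu> x) * N = (\<integral>\<^sup>+z. ennreal (p_conv V \<nu> x) * (ennreal (q z / p_conv V \<nu> x) * ennreal (norm (g (- z)))) \<partial>\<nu>)"
      by (simp add: nn_integral_cmult)
    also have "\<dots> = (\<integral>\<^sup>+z. ennreal (norm (g (- z)) * q z) \<partial>\<nu>)"
      using p[of x] by (intro nn_integral_cong) (simp add: ennreal_mult[symmetric] q_def mult.commute)
    finally have "(\<integral>\<^sup>+z. ennreal (norm (g (- z)) * q z) \<partial>\<nu>) = ennreal (p_conv V \<nu> x) * N" ..
    also have "\<dots> \<le> ennreal (p_conv V \<nu> x) * ennreal (K' * norm x)" by (intro mult_left_mono N) simp
    also have "\<dots> = ennreal (K' * norm x * p_conv V \<nu> x)"
      using p[of x] K' by (simp add: ennreal_mult[symmetric] mult.commute)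
    finally show "(\<integral>\<^sup>+z. ennreal (norm (g (- z)) * exp (- V (x - z))) \<partial>\<nu>)
       \<le> ennreal (K' * norm x * p_conv V \<nu> x)" by (simp add: q_def)
  qed
qed

theorem theorem2p6:
  fixes V :: "real ^ 'n \<Rightarrow> real"
    and \<nu> :: "(real ^ 'n) measure"
    and K :: real
  assumes V_C2: "C2 V"
    and mu_prob: "prob_space (gibbs V)"
    and nu_borel: "sets \<nu> = sets borel"
    and nu_prob: "prob_space \<nu>"
    and hess_bounded: "bounded (range (hessian V))"
    and K_pos: "K > 0"
    and hess_lower: "\<exists>S. compact S \<and> (\<forall>x\<in>-S. quad_form_le (K *\<^sub>R mat 1) (hessian V x))"
    and cond_C1: "\<exists>c>0. \<forall>f\<in>Cb1. \<forall>x.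
          (\<integral>z. (f z)\<^sup>2 \<partial>tilted V \<nu> x) - (\<integral>z. f z \<partial>tilted V \<nu> x)\<^sup>2
            \<le> c * (SUP y. norm (gradient f y))\<^sup>2"
    and cond_C2: "Limsup at_infinity
          (\<lambda>x. (\<integral>\<^sup>+ z. ennreal (norm (gradient V (- z))) \<partial>tilted V \<nu> x) / ennreal (norm x))
        < ennreal K"
  shows "log_sobolev (gibbs V \<star> \<nu>)"
proof -
  have V: "GDERIV V x :> gradient V x" for x
    using V_C2 by (intro GDERIV_gradient) (auto simp: C2_def C1_def)
  have gV: "(gradient V has_derivative (\<lambda>h. hessian V x *v h)) (at x)" for x
    using V_C2 jacobian_works[of "gradient V" "at x"] by (auto simp: C2_def hessian_def)
  obtain B where B: "\<And>x. norm (hessian V x) \<le> B" using hess_bounded by (auto simp: bounded_iff)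
  define \<Lambda> where "\<Lambda> = real CARD('n) * real CARD('n) * B"
  have "B \<ge> 0" using B[of 0] norm_ge_zero order_trans by blast
  then have \<Lambda>: "\<Lambda> \<ge> 0" by (simp add: \<Lambda>_def)
  have H_le: "norm (hessian V x *v h) \<le> \<Lambda> * norm h" for x h
  proof -
    have "real CARD('n) * real CARD('n) * norm (hessian V x) * norm h \<le> \<Lambda> * norm h"
      unfolding \<Lambda>_def by (intro mult_right_mono mult_left_mono B) auto
    then show ?thesis using norm_matrix_vector_mult_le[of "hessian V x" h] by linarith
  qed
  obtain S where S: "compact S" "\<And>x. x \<notin> S \<Longrightarrow> quad_form_le (K *\<^sub>R mat 1) (hessian V x)"
    using hess_lower by auto
  obtain R0 where R0: "\<And>x. x \<in> S \<Longrightarrow> norm x \<le> R0"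
    using compact_imp_bounded[OF S(1)] by (auto simp: bounded_iff)
  define R where "R = max R0 0"
  have H_lower: "K * (norm h)\<^sup>2 \<le> h \<bullet> (hessian V x *v h)" if "norm x > R" for x h
  proof -
    have "x \<notin> S" using R0[of x] that by (auto simp: R_def)
    from S(2)[OF this] have "h \<bullet> ((K *\<^sub>R mat 1) *v h) \<le> h \<bullet> (hessian V x *v h)"
      by (simp add: quad_form_le_def)
    moreover have "(K *\<^sub>R mat 1) *v h = K *\<^sub>R h"
      by (simp add: scaleR_matrix_vector_assoc[symmetric])
    ultimately show ?thesis by (simp add: power2_norm_eq_inner)
  qed
  interpret pot: potential_convex_at_infinity V "gradient V" "\<lambda>x h. hessian V x *v h" K \<Lambda> R
    by unfold_locales (use V gV H_le H_lower K_pos \<Lambda> in \<open>auto simp: R_def\<close>)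
  interpret N: prob_space \<nu> by fact
  note [measurable] = borel_measurable_continuous_onI[OF pot.continuous_V]
    borel_measurable_continuous_onI[OF pot.continuous_q]
  have nn_q: "(\<integral>\<^sup>+x. ennreal (pot.q x) \<partial>lborel) = 1"
  proof -
    have "emeasure (gibbs V) UNIV = 1"
      using prob_space.emeasure_space_1[OF mu_prob] by (simp add: gibbs_def)
    then show ?thesis by (simp add: gibbs_def emeasure_density pot.q_def)
  qed
  interpret sm: smoothed_density V "gradient V" "\<lambda>x h. hessian V x *v h" K \<Lambda> R \<nu>
    by unfold_locales (use nu_borel nn_q in auto)
  have p_eq: "p_conv V \<nu> x = sm.p x" for x
    by (simp add: p_conv_def sm.p_def pot.q_def)
  obtain K' R' where K': "0 \<le> K'" "K' < K" and
    mean: "\<And>x. norm x \<ge> R' \<Longrightarrow> (\<integral>\<^sup>+z. ennreal (norm (gradient V (- z)) * exp (- V (x - z))) \<partial>\<nu>)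
       \<le> ennreal (K' * norm x * p_conv V \<nu> x)"
    using mean_gradient_tilted_bound[OF cond_C2 pot.continuous_V sm.borel_measurable_g nu_borel]
      sm.p_pos unfolding p_eq by blast
  obtain L b where "confined_probability_density sm.p sm.G L ((K - K') / 2) b"
    using sm.confined[OF K'] mean unfolding p_eq pot.q_def by blast
  then have "log_sobolev (density lborel (\<lambda>x. ennreal (sm.p x)))"
    by (rule log_sobolev_confined_density)
  moreover have "gibbs V \<star> \<nu> = density lborel (\<lambda>x. ennreal (sm.p x))"
  proof (rule gibbs_convolution_eq_density[OF pot.continuous_V mu_prob nu_prob nu_borel])
    show "sm.p \<in> borel_measurable borel"
      using sm.continuous_p by (rule borel_measurable_continuous_onI)
  qed (use sm.nn_integral_convolution_q in \<open>simp add: pot.q_def\<close>)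
  ultimately show ?thesis by simp
qed

end
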